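(* Let $p>0$ be a prime, let $R:=\mathbb{Z}_p[[x]]$, let $a,b\geq2$ be integers, and let $f:=p^a+x^b\in R$. Let $R_0:=\mathbb{F}_p[[y,x]]$ and $f_0:=y^a+x^b\in R_0$. Then $$\operatorname{fpt}(R_0,f_0)\leq\operatorname{ppt}(R,f)\leq\frac1a+\frac1b.$$
   Context: For an integral domain $S$, $S^+$ denotes its absolute integral closure, i.e. the integral closure of $S$ in a fixed algebraic closure of its fraction field. For $z\in S^+$ and a rational $\alpha=n/m\geq 0$ ($n,m\in\mathbb{Z}$, $m>0$), $z^\alpha$ denotes a choice of element of $S^+$ with $(z^\alpha)^m=z^n$; it is unique up to units, and nothing below depends on the choice. Plus-pure threshold: for a complete Noetherian local domain $(S,\mathfrak{m})$ of residue characteristic $p>0$ and $0\neq f\in\mathfrak{m}$, $$\operatorname{ppt}(S,f)=\sup\{\alpha\in\mathbb{Q}_{\geq0}\mid \text{the } S\text{-linear map } S\to S^+,\ 1\mapsto f^\alpha,\ \text{is pure}\}$$ (since $S$ is complete, pure is equivalent to split). $F$-pure threshold: for $R_0=\mathbb{F}_p[[y,x]]$ and $0\neq f_0\in(y,x)$, $$\operatorname{fpt}(R_0,f_0)=\sup\{t\in\mathbb{R}_{>0}\mid f_0^{\lceil tp^e\rceil}\notin(y^{p^e},x^{p^e})\text{ for some integer } e\geq1\}.$$ *)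

theory Defs
  imports
    "HOL-Algebra.Algebraic_Closure_Type"
    "HOL-Algebra.Free_Abelian_Groups"
    "Berlekamp_Zassenhaus.Finite_Field"
begin

section \<open>The ring of \<open>p\<close>-adic integers\<close>

text \<open>
  The prime \<open>p\<close> is the cardinality of the type parameter, as for \<^typ>\<open>'p mod_ring\<close>, the field
  with \<open>p\<close> elements.  A \<open>p\<close>-adic integer is a compatible system of residues modulo the powers
  of \<open>p\<close>, i.e. an element of the inverse limit of the rings \<open>\<int>/p\<^sup>n\<int>\<close>.
\<close>

typedef (overloaded) 'p padic_int =
  "{x :: nat \<Rightarrow> int. \<forall>n. x n \<in> {0..<int CARD('p::prime_card) ^ n} \<and>
      x (Suc n) mod int CARD('p) ^ n = x n}"
  morphisms residue Abs_padic_int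
proof
  show "(\<lambda>_. 0) \<in> {x :: nat \<Rightarrow> int. \<forall>n. x n \<in> {0..<int CARD('p) ^ n} \<and>
      x (Suc n) mod int CARD('p) ^ n = x n}"
    by (simp add: prime_gt_0_int[OF prime_card_int])
qed

setup_lifting type_definition_padic_int

lemma CARD_prime_pos [simp]: "0 < int CARD('p::prime_card)"
  by (simp add: prime_gt_0_int[OF prime_card_int])

lemma residue_bounds: "residue (x :: 'p::prime_card padic_int) n \<in> {0..<int CARD('p) ^ n}"
  using residue[of x] by auto

lemma residue_Suc: "residue (x :: 'p::prime_card padic_int) (Suc n) mod int CARD('p) ^ n = residue x n"
  using residue[of x] by auto

lemma residue_mod_self: "residue (x :: 'p::prime_card padic_int) n mod int CARD('p) ^ n = residue x n"
  using residue_bounds[of x n] by simp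

lemma residue_add: "residue (x :: 'p::prime_card padic_int) (n + k) mod int CARD('p) ^ n = residue x n"
proof (induction k)
  case 0
  then show ?case by (simp add: residue_mod_self)
next
  case (Suc k)
  have "int CARD('p) ^ n dvd int CARD('p) ^ (n + k)"
    by (simp add: le_imp_power_dvd)
  then have "residue x (Suc (n + k)) mod int CARD('p) ^ n
      = residue x (Suc (n + k)) mod int CARD('p) ^ (n + k) mod int CARD('p) ^ n"
    by (simp add: mod_mod_cancel)
  then show ?case using Suc by (simp add: residue_Suc)
qed

lemma mod_power_Suc: "(a::int) mod q ^ Suc n mod q ^ n = a mod q ^ n"
  by (rule mod_mod_cancel) (simp add: le_imp_power_dvd)

instantiation padic_int :: (prime_card) comm_ring_1
begin

lift_definition zero_padic_int :: "'a padic_int" is "\<lambda>_. 0"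
  by simp

lift_definition one_padic_int :: "'a padic_int" is "\<lambda>n. 1 mod int CARD('a) ^ n"
  by (auto simp: mod_power_Suc simp del: power_Suc)

lift_definition plus_padic_int :: "'a padic_int \<Rightarrow> 'a padic_int \<Rightarrow> 'a padic_int"
  is "\<lambda>x y n. (x n + y n) mod int CARD('a) ^ n"
  by (auto simp: mod_power_Suc simp del: power_Suc) (metis mod_add_eq)

lift_definition minus_padic_int :: "'a padic_int \<Rightarrow> 'a padic_int \<Rightarrow> 'a padic_int"
  is "\<lambda>x y n. (x n - y n) mod int CARD('a) ^ n"
  by (auto simp: mod_power_Suc simp del: power_Suc) (metis mod_diff_eq)

lift_definition uminus_padic_int :: "'a padic_int \<Rightarrow> 'a padic_int"
  is "\<lambda>x n. (- x n) mod int CARD('a) ^ n"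
  by (auto simp: mod_power_Suc simp del: power_Suc) (metis mod_minus_eq)

lift_definition times_padic_int :: "'a padic_int \<Rightarrow> 'a padic_int \<Rightarrow> 'a padic_int"
  is "\<lambda>x y n. (x n * y n) mod int CARD('a) ^ n"
  by (auto simp: mod_power_Suc simp del: power_Suc) (metis mod_mult_eq)

instance
proof
  fix a b c :: "'a padic_int"
  show "a * b * c = a * (b * c)"
    by transfer (simp add: mod_simps mult.assoc)
  show "a * b = b * a"
    by transfer (simp add: mult.commute)
  show "1 * a = a"
    by transfer (auto simp: mod_simps)
  show "a + b + c = a + (b + c)"
    by transfer (simp add: mod_simps add.assoc)
  show "a + b = b + a"
    by transfer (simp add: add.commute)
  show "0 + a = a"
    by transfer auto
  show "- a + a = 0"
    by transfer (simp add: mod_simps)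
  show "a - b = a + - b"
    by transfer (simp add: mod_simps)
  show "(a + b) * c = a * c + b * c"
    by transfer (simp add: mod_simps distrib_right)
  show "(0 :: 'a padic_int) \<noteq> 1"
  proof
    assume "(0 :: 'a padic_int) = 1"
    then have "(0 :: int) = 1 mod int CARD('a) ^ 1"
      by transfer metis
    moreover have "1 < int CARD('a)"
      by (rule prime_gt_1_int[OF prime_card_int])
    ultimately show False by simp
  qed
qed

end

lemma prime_power_dvd_mult_cases:
  fixes a b q :: int
  assumes q: "prime q" and d: "q ^ (m + n) dvd a * b"
  shows "q ^ m dvd a \<or> q ^ n dvd b"
proof (cases "a = 0 \<or> b = 0")
  case False
  have "m + n \<le> multiplicity q (a * b)"
    using d False q by (subst (asm) power_dvd_iff_le_multiplicity) auto
  also have "\<dots> = multiplicity q a + multiplicity q b"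
    using False q by (intro prime_elem_multiplicity_mult_distrib) auto
  finally have "m \<le> multiplicity q a \<or> n \<le> multiplicity q b" by linarith
  then show ?thesis by (auto intro: multiplicity_dvd')
qed auto

instance padic_int :: (prime_card) idom
proof
  fix a b :: "'a padic_int"
  assume "a \<noteq> 0" "b \<noteq> 0"
  then obtain m n where m: "residue a m \<noteq> 0" and n: "residue b n \<noteq> 0"
    by (metis residue_inject ext zero_padic_int.rep_eq)
  let ?q = "int CARD('a)"
  have "prime ?q" using prime_card_int[where ?'a = 'a] by simp
  moreover have "\<not> ?q ^ m dvd residue a (m + n)"
    using m residue_add[of a m n] by (metis dvd_eq_mod_eq_0)
  moreover have "\<not> ?q ^ n dvd residue b (m + n)"
    using n residue_add[of b n m] by (metis dvd_eq_mod_eq_0 add.commute)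
  ultimately have "\<not> ?q ^ (m + n) dvd residue a (m + n) * residue b (m + n)"
    using prime_power_dvd_mult_cases by blast
  then have "residue (a * b) (m + n) \<noteq> 0"
    by (simp add: times_padic_int.rep_eq dvd_eq_mod_eq_0)
  then show "a * b \<noteq> 0"
    by (auto simp: zero_padic_int.rep_eq)
qed


section \<open>Tensor products and pure homomorphisms\<close>

text \<open>
  The tensor product of two modules over a commutative ring, as an abelian group: the free abelian
  group on pairs modulo biadditivity and \<open>R\<close>-balancedness.
\<close>

definition tensor_relators ::
    "('r, 'x) ring_scheme \<Rightarrow> ('r, 'm, 'y) module_scheme \<Rightarrow> ('r, 'q, 'z) module_scheme
      \<Rightarrow> ('m \<times> 'q \<Rightarrow>\<^sub>0 int) set" where
  "tensor_relators R M Q =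
     {frag_of (x \<oplus>\<^bsub>M\<^esub> x', y) - frag_of (x, y) - frag_of (x', y) | x x' y.
        x \<in> carrier M \<and> x' \<in> carrier M \<and> y \<in> carrier Q} \<union>
     {frag_of (x, y \<oplus>\<^bsub>Q\<^esub> y') - frag_of (x, y) - frag_of (x, y') | x y y'.
        x \<in> carrier M \<and> y \<in> carrier Q \<and> y' \<in> carrier Q} \<union>
     {frag_of (r \<odot>\<^bsub>M\<^esub> x, y) - frag_of (x, r \<odot>\<^bsub>Q\<^esub> y) | r x y.
        r \<in> carrier R \<and> x \<in> carrier M \<and> y \<in> carrier Q}"

definition tensor_kernel ::
    "('r, 'x) ring_scheme \<Rightarrow> ('r, 'm, 'y) module_scheme \<Rightarrow> ('r, 'q, 'z) module_scheme
      \<Rightarrow> ('m \<times> 'q \<Rightarrow>\<^sub>0 int) set" where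
  "tensor_kernel R M Q =
     generate (free_Abelian_group (carrier M \<times> carrier Q)) (tensor_relators R M Q)"

definition tensor_product ::
    "('r, 'x) ring_scheme \<Rightarrow> ('r, 'm, 'y) module_scheme \<Rightarrow> ('r, 'q, 'z) module_scheme
      \<Rightarrow> ('m \<times> 'q \<Rightarrow>\<^sub>0 int) set monoid" where
  "tensor_product R M Q =
     free_Abelian_group (carrier M \<times> carrier Q) Mod tensor_kernel R M Q"

text \<open>
  For a linear map \<open>\<phi> : M \<rightarrow> N\<close>, the map \<open>\<phi> \<otimes> id : M \<otimes> Q \<rightarrow> N \<otimes> Q\<close>, written on cosets: all
  representatives of a coset are sent to one and the same coset, so the union is that coset.
\<close>

definition tensor_map ::
    "('r, 'x) ring_scheme \<Rightarrow> ('r, 'n, 'y) module_scheme \<Rightarrow> ('r, 'q, 'z) module_scheme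
      \<Rightarrow> ('m \<Rightarrow> 'n) \<Rightarrow> ('m \<times> 'q \<Rightarrow>\<^sub>0 int) set \<Rightarrow> ('n \<times> 'q \<Rightarrow>\<^sub>0 int) set" where
  "tensor_map R N Q \<phi> C =
     (\<Union>c\<in>C. tensor_kernel R N Q #>\<^bsub>free_Abelian_group (carrier N \<times> carrier Q)\<^esub>
              frag_extend (\<lambda>(x, y). frag_of (\<phi> x, y)) c)"

text \<open>
  A linear map \<open>\<phi> : M \<rightarrow> N\<close> is pure if \<open>\<phi> \<otimes> id\<^sub>Q\<close> is injective for every \<open>R\<close>-module \<open>Q\<close>.  HOL cannot
  quantify over the type of the elements of \<open>Q\<close>, so it is fixed to one that contains, up to
  isomorphism, every finitely generated \<open>R\<close>-module (as the cosets of a submodule of some \<open>R\<^sup>n\<close>,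
  embedded in \<^typ>\<open>nat \<Rightarrow> 'r\<close>).  This loses nothing, since tensor products commute with the directed
  union of the finitely generated submodules; the theorem \<open>pure_map_inj\<close> below proves it.
\<close>

definition pure_map ::
    "('r, 'x) ring_scheme \<Rightarrow> ('r, 'm, 'y) module_scheme \<Rightarrow> ('r, 'n, 'z) module_scheme
      \<Rightarrow> ('m \<Rightarrow> 'n) \<Rightarrow> bool" where
  "pure_map R M N \<phi> \<longleftrightarrow>
     (\<forall>Q :: ('r, (nat \<Rightarrow> 'r) set) module. module R Q \<longrightarrow>
        inj_on (tensor_map R N Q \<phi>) (carrier (tensor_product R M Q)))"

definition linear_map ::
    "('r, 'x) ring_scheme \<Rightarrow> ('r, 'm, 'y) module_scheme \<Rightarrow> ('r, 'n, 'z) module_scheme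
      \<Rightarrow> ('m \<Rightarrow> 'n) \<Rightarrow> bool" where
  "linear_map R M N \<phi> \<longleftrightarrow>
     (\<forall>x\<in>carrier M. \<phi> x \<in> carrier N) \<and>
     (\<forall>x\<in>carrier M. \<forall>y\<in>carrier M. \<phi> (x \<oplus>\<^bsub>M\<^esub> y) = \<phi> x \<oplus>\<^bsub>N\<^esub> \<phi> y) \<and>
     (\<forall>r\<in>carrier R. \<forall>x\<in>carrier M. \<phi> (r \<odot>\<^bsub>M\<^esub> x) = r \<odot>\<^bsub>N\<^esub> \<phi> x)"

abbreviation "frag_map \<phi> \<equiv> frag_extend (frag_of \<circ> \<phi>)"

lemma module_closed:
  assumes "module R M"
  shows "x \<in> carrier M \<Longrightarrow> y \<in> carrier M \<Longrightarrow> x \<oplus>\<^bsub>M\<^esub> y \<in> carrier M"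
    and "r \<in> carrier R \<Longrightarrow> x \<in> carrier M \<Longrightarrow> r \<odot>\<^bsub>M\<^esub> x \<in> carrier M"
proof -
  interpret module R M by fact
  show "x \<in> carrier M \<Longrightarrow> y \<in> carrier M \<Longrightarrow> x \<oplus>\<^bsub>M\<^esub> y \<in> carrier M" by simp
  show "r \<in> carrier R \<Longrightarrow> x \<in> carrier M \<Longrightarrow> r \<odot>\<^bsub>M\<^esub> x \<in> carrier M" by simp
qed

lemma tensor_relators_intros:
  "x \<in> carrier M \<Longrightarrow> x' \<in> carrier M \<Longrightarrow> y \<in> carrier Q \<Longrightarrow>
     frag_of (x \<oplus>\<^bsub>M\<^esub> x', y) - frag_of (x, y) - frag_of (x', y) \<in> tensor_relators R M Q"
  "x \<in> carrier M \<Longrightarrow> y \<in> carrier Q \<Longrightarrow> y' \<in> carrier Q \<Longrightarrow>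
     frag_of (x, y \<oplus>\<^bsub>Q\<^esub> y') - frag_of (x, y) - frag_of (x, y') \<in> tensor_relators R M Q"
  "r \<in> carrier R \<Longrightarrow> x \<in> carrier M \<Longrightarrow> y \<in> carrier Q \<Longrightarrow>
     frag_of (r \<odot>\<^bsub>M\<^esub> x, y) - frag_of (x, r \<odot>\<^bsub>Q\<^esub> y) \<in> tensor_relators R M Q"
  unfolding tensor_relators_def by blast+

lemma keys_diff3:
  assumes "a \<in> A" "b \<in> A" "c \<in> A"
  shows "Poly_Mapping.keys (frag_of a - frag_of b - frag_of c :: _ \<Rightarrow>\<^sub>0 int) \<subseteq> A"
  using assms keys_diff[of "frag_of a - frag_of b" "frag_of c :: _ \<Rightarrow>\<^sub>0 int"]
    keys_diff[of "frag_of a" "frag_of b :: _ \<Rightarrow>\<^sub>0 int"] by auto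

lemma keys_diff2:
  assumes "a \<in> A" "b \<in> A"
  shows "Poly_Mapping.keys (frag_of a - frag_of b :: _ \<Rightarrow>\<^sub>0 int) \<subseteq> A"
  using assms keys_diff[of "frag_of a" "frag_of b :: _ \<Rightarrow>\<^sub>0 int"] by auto

lemma tensor_relators_keys:
  assumes "module R M" "module R Q" "u \<in> tensor_relators R M Q"
  shows "Poly_Mapping.keys u \<subseteq> carrier M \<times> carrier Q"
proof -
  from assms(3) consider
      (1) x x' y where "u = frag_of (x \<oplus>\<^bsub>M\<^esub> x', y) - frag_of (x, y) - frag_of (x', y)"
        "x \<in> carrier M" "x' \<in> carrier M" "y \<in> carrier Q"
    | (2) x y y' where "u = frag_of (x, y \<oplus>\<^bsub>Q\<^esub> y') - frag_of (x, y) - frag_of (x, y')"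
        "x \<in> carrier M" "y \<in> carrier Q" "y' \<in> carrier Q"
    | (3) r x y where "u = frag_of (r \<odot>\<^bsub>M\<^esub> x, y) - frag_of (x, r \<odot>\<^bsub>Q\<^esub> y)"
        "r \<in> carrier R" "x \<in> carrier M" "y \<in> carrier Q"
    unfolding tensor_relators_def by blast
  then show ?thesis
  proof cases
    case 1
    then show ?thesis
      unfolding \<open>u = _\<close> by (intro keys_diff3) (simp_all add: module_closed[OF assms(1)])
  next
    case 2
    then show ?thesis
      unfolding \<open>u = _\<close> by (intro keys_diff3) (simp_all add: module_closed[OF assms(2)])
  next
    case 3
    then show ?thesis
      unfolding \<open>u = _\<close>
      by (intro keys_diff2) (simp_all add: module_closed[OF assms(1)] module_closed[OF assms(2)])
  qed
qed

lemma tensor_kernel_subgroup: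
  assumes "module R M" "module R Q"
  shows "subgroup (tensor_kernel R M Q) (free_Abelian_group (carrier M \<times> carrier Q))"
  unfolding tensor_kernel_def
  by (rule group.generate_is_subgroup) (use tensor_relators_keys[OF assms] in auto)

lemma tensor_kernel_keys:
  assumes "module R M" "module R Q" "u \<in> tensor_kernel R M Q"
  shows "Poly_Mapping.keys u \<subseteq> carrier M \<times> carrier Q"
  using subgroup.mem_carrier[OF tensor_kernel_subgroup[OF assms(1,2)] assms(3)] by simp

lemma tensor_kernel_induct [consumes 3, case_names zero rel neg add]:
  assumes "module R M" "module R Q" "u \<in> tensor_kernel R M Q"
    and "P 0" and "\<And>u. u \<in> tensor_relators R M Q \<Longrightarrow> P u"
    and "\<And>u. u \<in> tensor_relators R M Q \<Longrightarrow> P (- u)"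
    and "\<And>u v. P u \<Longrightarrow> P v \<Longrightarrow> P (u + v)"
  shows "P u"
  using assms(3) unfolding tensor_kernel_def
  by (induction rule: generate.induct)
    (use assms(4-) tensor_relators_keys[OF assms(1,2)] in auto)

lemma tensor_kernel_zero: "0 \<in> tensor_kernel R M Q"
  unfolding tensor_kernel_def by (metis generate.one one_free_Abelian_group)

lemma tensor_kernel_add:
  "u \<in> tensor_kernel R M Q \<Longrightarrow> v \<in> tensor_kernel R M Q \<Longrightarrow> u + v \<in> tensor_kernel R M Q"
  unfolding tensor_kernel_def by (metis generate.eng mult_free_Abelian_group)

lemma tensor_kernel_rel: "u \<in> tensor_relators R M Q \<Longrightarrow> u \<in> tensor_kernel R M Q"
  unfolding tensor_kernel_def by (rule generate.incl)

lemma tensor_kernel_neg: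
  assumes "module R M" "module R Q" "u \<in> tensor_kernel R M Q"
  shows "- u \<in> tensor_kernel R M Q"
  using subgroup.m_inv_closed[OF tensor_kernel_subgroup[OF assms(1,2)] assms(3)]
    tensor_kernel_keys[OF assms] by simp

lemma tensor_relators_map:
  assumes "linear_map R M N \<phi>" "linear_map R Q Q' h" "u \<in> tensor_relators R M Q"
  shows "frag_map (map_prod \<phi> h) u \<in> tensor_relators R N Q'"
proof -
  have l: "\<And>x. x \<in> carrier M \<Longrightarrow> \<phi> x \<in> carrier N"
    "\<And>x y. x \<in> carrier M \<Longrightarrow> y \<in> carrier M \<Longrightarrow> \<phi> (x \<oplus>\<^bsub>M\<^esub> y) = \<phi> x \<oplus>\<^bsub>N\<^esub> \<phi> y"
    "\<And>r x. r \<in> carrier R \<Longrightarrow> x \<in> carrier M \<Longrightarrow> \<phi> (r \<odot>\<^bsub>M\<^esub> x) = r \<odot>\<^bsub>N\<^esub> \<phi> x"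
    "\<And>x. x \<in> carrier Q \<Longrightarrow> h x \<in> carrier Q'"
    "\<And>x y. x \<in> carrier Q \<Longrightarrow> y \<in> carrier Q \<Longrightarrow> h (x \<oplus>\<^bsub>Q\<^esub> y) = h x \<oplus>\<^bsub>Q'\<^esub> h y"
    "\<And>r x. r \<in> carrier R \<Longrightarrow> x \<in> carrier Q \<Longrightarrow> h (r \<odot>\<^bsub>Q\<^esub> x) = r \<odot>\<^bsub>Q'\<^esub> h x"
    using assms(1,2) unfolding linear_map_def by auto
  from assms(3) consider
      (1) x x' y where "u = frag_of (x \<oplus>\<^bsub>M\<^esub> x', y) - frag_of (x, y) - frag_of (x', y)"
        "x \<in> carrier M" "x' \<in> carrier M" "y \<in> carrier Q"
    | (2) x y y' where "u = frag_of (x, y \<oplus>\<^bsub>Q\<^esub> y') - frag_of (x, y) - frag_of (x, y')"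
        "x \<in> carrier M" "y \<in> carrier Q" "y' \<in> carrier Q"
    | (3) r x y where "u = frag_of (r \<odot>\<^bsub>M\<^esub> x, y) - frag_of (x, r \<odot>\<^bsub>Q\<^esub> y)"
        "r \<in> carrier R" "x \<in> carrier M" "y \<in> carrier Q"
    unfolding tensor_relators_def by blast
  then show ?thesis
  proof cases
    case 1
    then have "frag_map (map_prod \<phi> h) u
        = frag_of (\<phi> x \<oplus>\<^bsub>N\<^esub> \<phi> x', h y) - frag_of (\<phi> x, h y) - frag_of (\<phi> x', h y)"
      by (simp add: frag_extend_diff l)
    then show ?thesis unfolding tensor_relators_def using 1 l by blast
  next
    case 2
    then have "frag_map (map_prod \<phi> h) u
        = frag_of (\<phi> x, h y \<oplus>\<^bsub>Q'\<^esub> h y') - frag_of (\<phi> x, h y) - frag_of (\<phi> x, h y')"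
      by (simp add: frag_extend_diff l)
    then show ?thesis unfolding tensor_relators_def using 2 l by blast
  next
    case 3
    then have "frag_map (map_prod \<phi> h) u
        = frag_of (r \<odot>\<^bsub>N\<^esub> \<phi> x, h y) - frag_of (\<phi> x, r \<odot>\<^bsub>Q'\<^esub> h y)"
      by (simp add: frag_extend_diff l)
    then show ?thesis unfolding tensor_relators_def using 3 l by blast
  qed
qed

lemma tensor_kernel_map:
  assumes M: "module R M" "module R Q" "module R N" "module R Q'"
    and lin: "linear_map R M N \<phi>" "linear_map R Q Q' h"
    and u: "u \<in> tensor_kernel R M Q"
  shows "frag_map (map_prod \<phi> h) u \<in> tensor_kernel R N Q'"
  using M(1,2) u
proof (induction rule: tensor_kernel_induct)
  case zero
  then show ?case by (simp add: tensor_kernel_zero)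
next
  case (rel u)
  then show ?case by (intro tensor_kernel_rel tensor_relators_map[OF lin])
next
  case (neg u)
  then show ?case
    using tensor_kernel_neg[OF M(3,4) tensor_kernel_rel[OF tensor_relators_map[OF lin neg]]]
    by (simp only: frag_extend_minus)
next
  case (add u v)
  then show ?case by (simp add: frag_extend_add tensor_kernel_add)
qed

lemma keys_frag_map:
  assumes "Poly_Mapping.keys u \<subseteq> A" "\<And>x. x \<in> A \<Longrightarrow> f x \<in> B"
  shows "Poly_Mapping.keys (frag_map f u) \<subseteq> B"
  using keys_frag_extend[of "frag_of \<circ> f" u] assms by fastforce

lemma linear_map_id: "linear_map R M M id"
  by (simp add: linear_map_def)

lemma tensor_map_inj_iff:
  assumes M: "module R M" "module R N" "module R Q" and lin: "linear_map R M N \<phi>"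
  shows "inj_on (tensor_map R N Q \<phi>) (carrier (tensor_product R M Q)) \<longleftrightarrow>
    (\<forall>u. Poly_Mapping.keys u \<subseteq> carrier M \<times> carrier Q \<longrightarrow>
       frag_map (map_prod \<phi> id) u \<in> tensor_kernel R N Q \<longrightarrow> u \<in> tensor_kernel R M Q)"
    (is "?L \<longleftrightarrow> ?R")
proof -
  let ?FM = "free_Abelian_group (carrier M \<times> carrier Q)"
  let ?FN = "free_Abelian_group (carrier N \<times> carrier Q)"
  let ?KM = "tensor_kernel R M Q" and ?KN = "tensor_kernel R N Q"
  have e: "frag_extend (\<lambda>(x, y). frag_of (\<phi> x, y)) = frag_map (map_prod \<phi> id)"
    by (intro ext arg_cong[where f = frag_extend]) auto
  have sM: "subgroup ?KM ?FM" and sN: "subgroup ?KN ?FN"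
    using M by (auto intro: tensor_kernel_subgroup)
  have cos: "K #>\<^bsub>free_Abelian_group A\<^esub> u = (\<lambda>k. k + u) ` K" for K A and u :: "'z \<Rightarrow>\<^sub>0 int"
    by (auto simp: r_coset_def)
  have cos_eq: "K #>\<^bsub>free_Abelian_group A\<^esub> u = K #>\<^bsub>free_Abelian_group A\<^esub> v \<longleftrightarrow> u - v \<in> K"
    if "subgroup K (free_Abelian_group A)" for K A and u v :: "'z \<Rightarrow>\<^sub>0 int"
  proof
    have z: "0 \<in> K" using subgroup.one_closed[OF that] by simp
    have add: "\<And>a b. a \<in> K \<Longrightarrow> b \<in> K \<Longrightarrow> a + b \<in> K" using subgroup.m_closed[OF that] by simp
    have neg: "\<And>a. a \<in> K \<Longrightarrow> - a \<in> K"
      using subgroup.m_inv_closed[OF that] subgroup.mem_carrier[OF that] by fastforce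
    show "u - v \<in> K" if "K #>\<^bsub>free_Abelian_group A\<^esub> u = K #>\<^bsub>free_Abelian_group A\<^esub> v"
    proof -
      have "u \<in> (\<lambda>k. k + v) ` K" using that z unfolding cos by force
      then show ?thesis by auto
    qed
    assume uv: "u - v \<in> K"
    show "K #>\<^bsub>free_Abelian_group A\<^esub> u = K #>\<^bsub>free_Abelian_group A\<^esub> v"
      unfolding cos
    proof (intro equalityI subsetI)
      fix w assume "w \<in> (\<lambda>k. k + u) ` K"
      then obtain k where "k \<in> K" "w = (k + (u - v)) + v" by auto
      then show "w \<in> (\<lambda>k. k + v) ` K" using add uv by blast
    next
      fix w assume "w \<in> (\<lambda>k. k + v) ` K"
      then obtain k where "k \<in> K" "w = (k + - (u - v)) + u" by auto
      then show "w \<in> (\<lambda>k. k + u) ` K" using add neg uv by blast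
    qed
  qed
  have carr: "carrier (tensor_product R M Q) = (\<lambda>u. ?KM #>\<^bsub>?FM\<^esub> u) ` carrier ?FM"
    unfolding tensor_product_def FactGroup_def RCOSETS_def by auto
  have map: "tensor_map R N Q \<phi> (?KM #>\<^bsub>?FM\<^esub> u) = ?KN #>\<^bsub>?FN\<^esub> frag_map (map_prod \<phi> id) u" for u
  proof -
    have eq: "?KN #>\<^bsub>?FN\<^esub> frag_map (map_prod \<phi> id) c = ?KN #>\<^bsub>?FN\<^esub> frag_map (map_prod \<phi> id) u"
      if "c \<in> ?KM #>\<^bsub>?FM\<^esub> u" for c
    proof -
      from that obtain k where "k \<in> ?KM" "c = k + u" unfolding cos by auto
      then show ?thesis
        using tensor_kernel_map[OF M(1,3,2,3) lin linear_map_id, of k]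
        by (simp add: cos_eq[OF sN] frag_extend_add)
    qed
    have "u \<in> ?KM #>\<^bsub>?FM\<^esub> u" unfolding cos using tensor_kernel_zero by force
    with eq show ?thesis unfolding tensor_map_def e by blast
  qed
  show ?thesis
  proof
    assume L: ?L
    show ?R
    proof (intro allI impI)
      fix u
      assume u: "Poly_Mapping.keys u \<subseteq> carrier M \<times> carrier Q" "frag_map (map_prod \<phi> id) u \<in> ?KN"
      then have "tensor_map R N Q \<phi> (?KM #>\<^bsub>?FM\<^esub> u) = tensor_map R N Q \<phi> (?KM #>\<^bsub>?FM\<^esub> 0)"
        unfolding map by (simp add: cos_eq[OF sN])
      then have "?KM #>\<^bsub>?FM\<^esub> u = ?KM #>\<^bsub>?FM\<^esub> 0"
        by (rule inj_onD[OF L]) (use u in \<open>auto simp: carr\<close>)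
      then show "u \<in> ?KM" by (simp add: cos_eq[OF sM])
    qed
  next
    assume R: ?R
    show ?L
    proof (rule inj_onI, unfold carr, elim imageE)
      fix x y u v
      assume "x = ?KM #>\<^bsub>?FM\<^esub> u" "y = ?KM #>\<^bsub>?FM\<^esub> v" "u \<in> carrier ?FM" "v \<in> carrier ?FM"
        "tensor_map R N Q \<phi> x = tensor_map R N Q \<phi> y"
      moreover from this have "frag_map (map_prod \<phi> id) (u - v) \<in> ?KN"
        by (simp add: map cos_eq[OF sN] frag_extend_diff)
      moreover have "Poly_Mapping.keys (u - v) \<subseteq> carrier M \<times> carrier Q"
        using calculation keys_diff[of u v] by auto
      ultimately show "x = y" using R by (simp add: cos_eq[OF sM])
    qed
  qed
qed


text \<open>An element of the kernel already lies in the kernel of a finitely generated submodule.\<close>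

lemma tensor_kernel_finite:
  assumes M: "module R M" "module R Q" and u: "u \<in> tensor_kernel R M Q"
  shows "\<exists>B. finite B \<and> B \<subseteq> carrier Q \<and>
    (\<forall>H. submodule H R Q \<longrightarrow> B \<subseteq> H \<longrightarrow> u \<in> tensor_kernel R M (Q\<lparr>carrier := H\<rparr>))"
proof -
  have that_rel: "\<exists>B. finite B \<and> B \<subseteq> carrier Q \<and>
      (\<forall>H. B \<subseteq> H \<longrightarrow> u \<in> tensor_relators R M (Q\<lparr>carrier := H\<rparr>))"
    if "u \<in> tensor_relators R M Q" for u
  proof -
    from that consider
        (1) x x' y where "u = frag_of (x \<oplus>\<^bsub>M\<^esub> x', y) - frag_of (x, y) - frag_of (x', y)"
          "x \<in> carrier M" "x' \<in> carrier M" "y \<in> carrier Q"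
      | (2) x y y' where "u = frag_of (x, y \<oplus>\<^bsub>Q\<^esub> y') - frag_of (x, y) - frag_of (x, y')"
          "x \<in> carrier M" "y \<in> carrier Q" "y' \<in> carrier Q"
      | (3) r x y where "u = frag_of (r \<odot>\<^bsub>M\<^esub> x, y) - frag_of (x, r \<odot>\<^bsub>Q\<^esub> y)"
          "r \<in> carrier R" "x \<in> carrier M" "y \<in> carrier Q"
      unfolding tensor_relators_def by blast
    then show ?thesis
    proof cases
      case 1
      have "u \<in> tensor_relators R M (Q\<lparr>carrier := H\<rparr>)" if "{y} \<subseteq> H" for H
        using tensor_relators_intros(1)[of x M x' y "Q\<lparr>carrier := H\<rparr>" R] 1 that by simp
      then show ?thesis using 1 by (intro exI[of _ "{y}"]) blast
    next
      case 2
      have "u \<in> tensor_relators R M (Q\<lparr>carrier := H\<rparr>)" if "{y, y'} \<subseteq> H" for H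
        using tensor_relators_intros(2)[of x M y "Q\<lparr>carrier := H\<rparr>" y' R] 2 that by simp
      then show ?thesis using 2 by (intro exI[of _ "{y, y'}"]) blast
    next
      case 3
      have "u \<in> tensor_relators R M (Q\<lparr>carrier := H\<rparr>)" if "{y} \<subseteq> H" for H
        using tensor_relators_intros(3)[of r R x M y "Q\<lparr>carrier := H\<rparr>"] 3 that by simp
      then show ?thesis using 3 by (intro exI[of _ "{y}"]) blast
    qed
  qed
  show ?thesis
    using M u
  proof (induction rule: tensor_kernel_induct)
    case zero
    then show ?case by (intro exI[of _ "{}"]) (simp add: tensor_kernel_zero)
  next
    case (rel u)
    then obtain B where B: "finite B" "B \<subseteq> carrier Q"
      "\<And>H. B \<subseteq> H \<Longrightarrow> u \<in> tensor_relators R M (Q\<lparr>carrier := H\<rparr>)"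
      using that_rel by metis
    show ?case
      by (intro exI[of _ B] conjI allI impI B(1,2)) (rule tensor_kernel_rel[OF B(3)])
  next
    case (neg u)
    then obtain B where B: "finite B" "B \<subseteq> carrier Q"
      "\<And>H. B \<subseteq> H \<Longrightarrow> u \<in> tensor_relators R M (Q\<lparr>carrier := H\<rparr>)"
      using that_rel by metis
    show ?case
      by (intro exI[of _ B] conjI allI impI B(1,2), rule tensor_kernel_neg[OF M(1)],
          erule submodule.submodule_is_module[OF _ M(2)], rule tensor_kernel_rel[OF B(3)])
  next
    case (add u v)
    from add(1) obtain B where B: "finite B" "B \<subseteq> carrier Q"
      "\<And>H. submodule H R Q \<Longrightarrow> B \<subseteq> H \<Longrightarrow> u \<in> tensor_kernel R M (Q\<lparr>carrier := H\<rparr>)"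
      by (elim exE conjE) metis
    from add(2) obtain C where C: "finite C" "C \<subseteq> carrier Q"
      "\<And>H. submodule H R Q \<Longrightarrow> C \<subseteq> H \<Longrightarrow> v \<in> tensor_kernel R M (Q\<lparr>carrier := H\<rparr>)"
      by (elim exE conjE) metis
    show ?case
    proof (intro exI[of _ "B \<union> C"] conjI allI impI)
      fix H assume H: "submodule H R Q" "B \<union> C \<subseteq> H"
      show "u + v \<in> tensor_kernel R M (Q\<lparr>carrier := H\<rparr>)"
        by (rule tensor_kernel_add[OF B(3)[OF H(1)] C(3)[OF H(1)]]) (use H(2) in auto)
    qed (use B(1,2) C(1,2) in auto)
  qed
qed

text \<open>Every finitely generated module has a copy on the type used in the definition of purity.\<close>

lemma fg_submodule_copy:
  fixes R :: "('r, 'x) ring_scheme" and Q :: "('r, 'q, 'z) module_scheme"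
  assumes Q: "module R Q" and B: "finite B" "B \<subseteq> carrier Q"
  obtains H and Q' :: "('r, (nat \<Rightarrow> 'r) set) module" and h k
  where "submodule H R Q" "B \<subseteq> H" "module R Q'"
    "linear_map R (Q\<lparr>carrier := H\<rparr>) Q' h" "linear_map R Q' (Q\<lparr>carrier := H\<rparr>) k"
    "\<And>x. x \<in> H \<Longrightarrow> k (h x) = x"
proof -
  interpret module R Q by fact
  obtain n b where b: "B = b ` {..<n::nat}"
    using B(1) by (metis finite_imp_nat_seg_image_inj_on lessThan_def)
  then have bQ: "\<And>i. i < n \<Longrightarrow> b i \<in> carrier Q" using B(2) by auto
  define P where "P = {c. \<forall>i::nat. c i \<in> carrier R}"
  define \<pi> where "\<pi> c = (\<Oplus>\<^bsub>Q\<^esub>i\<in>{..<n}. c i \<odot>\<^bsub>Q\<^esub> b i)" for c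
  define H where "H = \<pi> ` P"
  have \<pi>_closed: "\<pi> c \<in> carrier Q" if "c \<in> P" for c
    unfolding \<pi>_def using that bQ by (intro M.finsum_closed) (auto simp: P_def)
  have \<pi>_add: "\<pi> (\<lambda>i. c i \<oplus>\<^bsub>R\<^esub> d i) = \<pi> c \<oplus>\<^bsub>Q\<^esub> \<pi> d" if "c \<in> P" "d \<in> P" for c d
  proof -
    have "\<pi> (\<lambda>i. c i \<oplus>\<^bsub>R\<^esub> d i)
        = (\<Oplus>\<^bsub>Q\<^esub>i\<in>{..<n}. c i \<odot>\<^bsub>Q\<^esub> b i \<oplus>\<^bsub>Q\<^esub> d i \<odot>\<^bsub>Q\<^esub> b i)"
      unfolding \<pi>_def using that bQ by (intro M.finsum_cong') (auto simp: P_def smult_l_distr)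
    also have "\<dots> = \<pi> c \<oplus>\<^bsub>Q\<^esub> \<pi> d"
      unfolding \<pi>_def using that bQ by (intro M.finsum_addf) (auto simp: P_def)
    finally show ?thesis .
  qed
  have \<pi>_smult: "\<pi> (\<lambda>i. r \<otimes>\<^bsub>R\<^esub> c i) = r \<odot>\<^bsub>Q\<^esub> \<pi> c" if "r \<in> carrier R" "c \<in> P" for r c
  proof -
    have "\<pi> (\<lambda>i. r \<otimes>\<^bsub>R\<^esub> c i) = (\<Oplus>\<^bsub>Q\<^esub>i\<in>{..<n}. r \<odot>\<^bsub>Q\<^esub> (c i \<odot>\<^bsub>Q\<^esub> b i))"
      unfolding \<pi>_def using that bQ by (intro M.finsum_cong') (auto simp: P_def smult_assoc1)
    also have "\<dots> = r \<odot>\<^bsub>Q\<^esub> \<pi> c"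
      unfolding \<pi>_def using that bQ
      by (intro finsum_smult_ldistr[symmetric]) (auto simp: P_def)
    finally show ?thesis .
  qed
  have \<pi>_zero: "\<pi> (\<lambda>_. \<zero>\<^bsub>R\<^esub>) = \<zero>\<^bsub>Q\<^esub>"
    unfolding \<pi>_def using bQ by (intro M.add.finprod_one_eqI) auto
  have "B \<subseteq> H"
  proof
    fix x assume "x \<in> B"
    then obtain j where j: "j < n" "x = b j" using b by auto
    have "\<pi> (\<lambda>i. if i = j then \<one>\<^bsub>R\<^esub> else \<zero>\<^bsub>R\<^esub>) = (\<Oplus>\<^bsub>Q\<^esub>i\<in>{..<n}. if j = i then b i else \<zero>\<^bsub>Q\<^esub>)"
      unfolding \<pi>_def using bQ by (intro M.finsum_cong') auto
    also have "\<dots> = x"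
      using M.finsum_singleton[of j "{..<n}" b] j bQ by auto
    finally have "x = \<pi> (\<lambda>i. if i = j then \<one>\<^bsub>R\<^esub> else \<zero>\<^bsub>R\<^esub>)" ..
    moreover have "(\<lambda>i. if i = j then \<one>\<^bsub>R\<^esub> else \<zero>\<^bsub>R\<^esub>) \<in> P"
      by (auto simp: P_def)
    ultimately show "x \<in> H" unfolding H_def by blast
  qed
  have H_add: "x \<oplus>\<^bsub>Q\<^esub> y \<in> H" if "x \<in> H" "y \<in> H" for x y
  proof -
    from that obtain c d where cd: "c \<in> P" "d \<in> P" "x = \<pi> c" "y = \<pi> d" unfolding H_def by auto
    then have "(\<lambda>i. c i \<oplus>\<^bsub>R\<^esub> d i) \<in> P" by (auto simp: P_def)
    then show ?thesis using \<pi>_add[OF cd(1,2)] cd unfolding H_def by force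
  qed
  have H_smult: "r \<odot>\<^bsub>Q\<^esub> x \<in> H" if "r \<in> carrier R" "x \<in> H" for r x
  proof -
    from that obtain c where c: "c \<in> P" "x = \<pi> c" unfolding H_def by auto
    then have "(\<lambda>i. r \<otimes>\<^bsub>R\<^esub> c i) \<in> P" using that by (auto simp: P_def)
    then show ?thesis using \<pi>_smult[OF that(1) c(1)] c unfolding H_def by force
  qed
  have H_sub: "H \<subseteq> carrier Q" unfolding H_def using \<pi>_closed by auto
  have H_zero: "\<zero>\<^bsub>Q\<^esub> \<in> H"
    unfolding H_def using \<pi>_zero by (intro image_eqI[of _ _ "\<lambda>_. \<zero>\<^bsub>R\<^esub>"]) (auto simp: P_def)
  have H_neg: "\<ominus>\<^bsub>Q\<^esub> x \<in> H" if "x \<in> H" for x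
  proof -
    have "(\<ominus>\<^bsub>R\<^esub> \<one>\<^bsub>R\<^esub>) \<odot>\<^bsub>Q\<^esub> x = \<ominus>\<^bsub>Q\<^esub> x"
      using that H_sub by (subst smult_l_minus) auto
    then show ?thesis using H_smult[of "\<ominus>\<^bsub>R\<^esub> \<one>\<^bsub>R\<^esub>" x] that by simp
  qed
  have subm: "submodule H R Q"
    using H_sub H_zero H_neg H_add H_smult by (intro submoduleI) auto
  define h where "h x = {c \<in> P. \<pi> c = x}" for x
  define k where "k C = \<pi> (SOME c. c \<in> C)" for C
  have kh: "k (h x) = x" if "x \<in> H" for x
  proof -
    have "\<exists>c. c \<in> h x" using that unfolding H_def h_def by auto
    then have "(SOME c. c \<in> h x) \<in> h x" by (rule someI_ex)
    then show ?thesis unfolding k_def h_def by auto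
  qed
  define Q' :: "('r, (nat \<Rightarrow> 'r) set) module" where
    "Q' = \<lparr>carrier = h ` H, monoid.mult = (\<lambda>_ _. h \<zero>\<^bsub>Q\<^esub>), one = h \<zero>\<^bsub>Q\<^esub>, ring.zero = h \<zero>\<^bsub>Q\<^esub>,
       add = (\<lambda>C D. h (k C \<oplus>\<^bsub>Q\<^esub> k D)), module.smult = (\<lambda>r C. h (r \<odot>\<^bsub>Q\<^esub> k C))\<rparr>"
  have mod: "module R Q'"
  proof (rule moduleI)
    show "cring R" by (rule R.is_cring)
    show "abelian_group Q'"
    proof (rule abelian_groupI)
      show "\<exists>y\<in>carrier Q'. y \<oplus>\<^bsub>Q'\<^esub> x = \<zero>\<^bsub>Q'\<^esub>" if "x \<in> carrier Q'" for x
      proof -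
        from that obtain z where z: "z \<in> H" "x = h z" by (auto simp: Q'_def)
        then have "h (\<ominus>\<^bsub>Q\<^esub> z) \<oplus>\<^bsub>Q'\<^esub> x = \<zero>\<^bsub>Q'\<^esub>"
          using H_sub H_neg by (auto simp: Q'_def kh M.l_neg)
        then show ?thesis using z H_neg by (auto simp: Q'_def)
      qed
    next
      fix x y z assume "x \<in> carrier Q'" "y \<in> carrier Q'" "z \<in> carrier Q'"
      then show "x \<oplus>\<^bsub>Q'\<^esub> y \<oplus>\<^bsub>Q'\<^esub> z = x \<oplus>\<^bsub>Q'\<^esub> (y \<oplus>\<^bsub>Q'\<^esub> z)"
        using H_sub H_add by (auto simp: Q'_def kh M.a_assoc subset_iff)
    next
      fix x y assume "x \<in> carrier Q'" "y \<in> carrier Q'"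
      then show "x \<oplus>\<^bsub>Q'\<^esub> y = y \<oplus>\<^bsub>Q'\<^esub> x"
        using H_sub by (auto simp: Q'_def kh M.a_comm subset_iff)
    qed (use H_sub H_add H_zero in \<open>auto simp: Q'_def kh subset_iff\<close>)
  qed (use H_sub H_add H_smult in
      \<open>auto simp: Q'_def kh smult_l_distr smult_r_distr smult_assoc1 subset_iff\<close>)
  have "linear_map R (Q\<lparr>carrier := H\<rparr>) Q' h" "linear_map R Q' (Q\<lparr>carrier := H\<rparr>) k"
    unfolding linear_map_def using H_add H_smult by (auto simp: Q'_def kh)
  with subm \<open>B \<subseteq> H\<close> mod kh show ?thesis using that by blast
qed

text \<open>Hence a pure map stays injective after tensoring with a module over an arbitrary type.\<close>

theorem pure_map_inj:
  fixes R :: "('r, 'x) ring_scheme" and Q :: "('r, 'q, 'w) module_scheme"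
  assumes M: "module R M" "module R N" "module R Q"
    and lin: "linear_map R M N \<phi>" and pure: "pure_map R M N \<phi>"
  shows "inj_on (tensor_map R N Q \<phi>) (carrier (tensor_product R M Q))"
  unfolding tensor_map_inj_iff[OF M lin]
proof (intro allI impI)
  fix u
  assume u: "Poly_Mapping.keys u \<subseteq> carrier M \<times> carrier Q"
    and ker: "frag_map (map_prod \<phi> id) u \<in> tensor_kernel R N Q"
  obtain B where B: "finite B" "B \<subseteq> carrier Q"
    "\<And>H. submodule H R Q \<Longrightarrow> B \<subseteq> H \<Longrightarrow>
       frag_map (map_prod \<phi> id) u \<in> tensor_kernel R N (Q\<lparr>carrier := H\<rparr>)"
    using tensor_kernel_finite[OF M(2,3) ker] by auto
  define C where "C = B \<union> snd ` Poly_Mapping.keys u"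
  have C: "finite C" "C \<subseteq> carrier Q" using B u by (auto simp: C_def)
  obtain H and Q' :: "('r, (nat \<Rightarrow> 'r) set) module" and h k
    where H: "submodule H R Q" "C \<subseteq> H" "module R Q'"
      "linear_map R (Q\<lparr>carrier := H\<rparr>) Q' h" "linear_map R Q' (Q\<lparr>carrier := H\<rparr>) k"
      "\<And>x. x \<in> H \<Longrightarrow> k (h x) = x"
    using fg_submodule_copy[OF M(3) C] by metis
  define QH where "QH = Q\<lparr>carrier := H\<rparr>"
  have modH: "module R QH"
    unfolding QH_def by (rule submodule.submodule_is_module[OF H(1) M(3)])
  have uH: "Poly_Mapping.keys u \<subseteq> carrier M \<times> H"
    using u H(2) by (force simp: C_def)
  have "frag_map (map_prod \<phi> id) u \<in> tensor_kernel R N QH"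
    using B(3)[OF H(1)] H(2) by (auto simp: C_def QH_def)
  then have "frag_map (map_prod id h) (frag_map (map_prod \<phi> id) u) \<in> tensor_kernel R N Q'"
    by (intro tensor_kernel_map[OF M(2) modH M(2) H(3) linear_map_id])
      (use H(4) in \<open>auto simp: QH_def\<close>)
  also have "frag_map (map_prod id h) (frag_map (map_prod \<phi> id) u)
      = frag_map (map_prod \<phi> id) (frag_map (map_prod id h) u)"
    by (simp add: frag_extend_compose comp_assoc map_prod.comp)
  finally have "frag_map (map_prod \<phi> id) (frag_map (map_prod id h) u) \<in> tensor_kernel R N Q'" .
  moreover have "Poly_Mapping.keys (frag_map (map_prod id h) u) \<subseteq> carrier M \<times> carrier Q'"
    using uH by (rule keys_frag_map) (use H(4) in \<open>auto simp: linear_map_def\<close>)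
  ultimately have "frag_map (map_prod id h) u \<in> tensor_kernel R M Q'"
    using pure H(3) tensor_map_inj_iff[OF M(1,2) H(3) lin] unfolding pure_map_def by blast
  then have "frag_map (map_prod id k) (frag_map (map_prod id h) u) \<in> tensor_kernel R M QH"
    by (intro tensor_kernel_map[OF M(1) H(3) M(1) modH linear_map_id])
      (use H(5) in \<open>auto simp: QH_def\<close>)
  also have "frag_map (map_prod id k) (frag_map (map_prod id h) u) = frag_extend frag_of u"
    unfolding frag_extend_compose comp_assoc map_prod.comp
    by (rule frag_extend_eq) (use uH H(6) in auto)
  also have "\<dots> = u" by (rule frag_expansion[symmetric])
  finally have "frag_map (map_prod id id) u \<in> tensor_kernel R M Q"
    by (intro tensor_kernel_map[OF M(1) modH M(1,3) linear_map_id])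
      (use module.submoduleE(1)[OF M(3) H(1)] in \<open>auto simp: QH_def linear_map_def\<close>)
  moreover have "frag_map (map_prod id id) u = u"
    by (simp add: map_prod.id frag_expansion[symmetric])
  ultimately show "u \<in> tensor_kernel R M Q" by simp
qed


section \<open>Absolute integral closure and plus-pure threshold\<close>

definition to_closure :: "'a::idom \<Rightarrow> 'a fract alg_closure" where
  "to_closure s = to_ac (to_fract s)"

definition abs_int_closure :: "'a::idom fract alg_closure set" where
  "abs_int_closure =
     {z. \<exists>P :: 'a poly. lead_coeff P = 1 \<and> poly (map_poly to_closure P) z = 0}"

text \<open>
  \<open>z\<^sup>\<alpha>\<close> for \<open>\<alpha> = n/m \<ge> 0\<close> in lowest terms: one chosen element of the absolute integral closure whose
  \<open>m\<close>-th power is \<open>z\<^sup>n\<close>.  Any two such elements differ by a unit.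
\<close>

definition rat_power :: "'a::idom fract alg_closure \<Rightarrow> rat \<Rightarrow> 'a fract alg_closure" where
  "rat_power z \<alpha> = (case quotient_of \<alpha> of (n, m) \<Rightarrow>
     (SOME w. w \<in> abs_int_closure \<and> w ^ nat m = z ^ nat n))"

definition self_module :: "('a::idom, 'a) module" where
  "self_module =
     \<lparr>carrier = UNIV, monoid.mult = (*), one = 1, ring.zero = 0, add = (+), module.smult = (*)\<rparr>"

definition plus_module :: "('a::idom, 'a fract alg_closure) module" where
  "plus_module =
     \<lparr>carrier = abs_int_closure, monoid.mult = (*), one = 1, ring.zero = 0, add = (+),
      module.smult = (\<lambda>s z. to_closure s * z)\<rparr>"

text \<open>
  The supremum of the exponents for which the linear map sending \<open>1\<close> to \<open>f\<^sup>\<alpha>\<close> is pure.  The notion is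
  intended for a complete Noetherian local domain with positive residue characteristic and a
  nonzero \<open>f\<close> in its maximal ideal; no \<open>\<alpha> \<ge> 1\<close> qualifies then, so the set is bounded.
\<close>

definition ppt :: "'a::idom \<Rightarrow> real" where
  "ppt f = Sup {real_of_rat \<alpha> | \<alpha>. 0 \<le> \<alpha> \<and>
     pure_map ring_of_type_algebra self_module plus_module
       (\<lambda>s :: 'a. to_closure s * rat_power (to_closure f) \<alpha>)}"


section \<open>The F-pure threshold on a power series ring in two variables\<close>

text \<open>
  The ring of power series over \<open>\<F>\<^sub>p\<close> in \<open>y\<close> and \<open>x\<close> is taken as power series in \<open>x\<close> with
  coefficients that are power series in \<open>y\<close>, so \<open>y\<close> is \<^term>\<open>fps_const fps_X\<close> and \<open>x\<close> is \<^term>\<open>fps_X\<close>.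
\<close>

definition fpt :: "'p::prime_card mod_ring fps fps \<Rightarrow> real" where
  "fpt f = Sup {t. 0 < t \<and> (\<exists>e\<ge>1.
     f ^ nat \<lceil>t * real CARD('p) ^ e\<rceil> \<notin>
       Idl\<^bsub>ring_of_type_algebra\<^esub> {fps_const fps_X ^ (CARD('p) ^ e), fps_X ^ (CARD('p) ^ e)})}"

end

theory Submission
  imports Defs "Jordan_Normal_Form.Char_Poly"
begin

text \<open>
  Write \<open>T = R\<^sup>+\<close>.  Both inequalities rest on the criterion that \<open>1 \<mapsto> w\<close> is pure iff \<open>w \<notin> (p, x) T\<close>.
  One direction tensors with \<open>R/(p, x)\<close>.  For the other, \<open>p, x\<close> is a regular sequence on \<open>T\<close> (because
  \<open>R\<close> is normal), so \<open>w/(p x)\<close> is a nonzero class in \<open>T[1/(p x)] / (T[1/p] + T[1/x])\<close>; a maximal subgroup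
  avoiding it gives, by reading off coefficients digit by digit, an \<open>R\<close>-linear map \<open>T \<rightarrow> R\<close> that sends
  \<open>w\<close> to a unit.

  It remains to decide when powers of \<open>z\<^sub>e = f\<^sup>1\<^sup>/\<^sup>q\<close>, \<open>q = p\<^sup>e\<close>, lie in \<open>(p, x) T\<close>.  In characteristic \<open>p\<close> one
  has \<open>z\<^sub>e = p\<^sup>a\<^sup>/\<^sup>q + x\<^sup>b\<^sup>/\<^sup>q\<close>.  In mixed characteristic this holds up to a unit multiple and an error
  \<open>p\<^sup>1\<^sup>/\<^sup>q h\<close>, where modulo high powers of \<open>p\<^sup>1\<^sup>/\<^sup>q\<close> the term \<open>h\<close> is again homogeneous of the same degree in
  deeper roots of \<open>f\<close>, \<open>p\<^sup>a\<close> and \<open>x\<^sup>b\<close>.  This makes \<open>z\<^sub>e\<close> integral over \<open>(p\<^sup>a\<^sup>/\<^sup>q, x\<^sup>b\<^sup>/\<^sup>q)\<close> with an arbitrarily small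
  relative loss, so large powers are monomial combinations of almost the expected weight, which gives
  the upper bound.  It also makes the error have strictly larger weight than the main term, so a
  monomial of \<open>(p\<^sup>a\<^sup>/\<^sup>q + x\<^sup>b\<^sup>/\<^sup>q)\<^sup>N\<close> outside \<open>(p, x)\<close> with coefficient prime to \<open>p\<close> survives, which gives the
  lower bound.
\<close>

section \<open>Compatible systems of roots\<close>

text \<open>The obstacle is that taking p-power roots is not additive in mixed characteristic. The
  expansion of z_e is never run to a limit but cut off at a power of \<open>\<pi> e\<close>. For the
  upper bound the cut is at \<open>\<pi> e ^ a\<close>, a multiple of a generator of the ideal. For
  the lower bound, giving \<pi> weight b and \<xi> weight a, the cut is at
  \<open>\<pi> e ^ (a + 1)\<close>, of weight ab + b. There the error gains b over the main term,
  while eliminating z from it costs only ab / p^s; taking s = a + 1 keeps the cost below the gain,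
  because a < p^s. All of this uses of T only that it is a ring closed under roots, that p, x is
  regular on it, and that (p, x) T is proper. The quotient T[1/(p x)] / (T[1/p] + T[1/x]) is the
  second local cohomology of T with support in (p, x). The map from T to R is a concrete form of
  Matlis duality: instead of an R-linear map to an injective hull, an additive character with values
  in a Pruefer group is evaluated at z/(p^n x^(i+1)) for all n and i.\<close>

locale root_closed_subring =
  fixes T :: "'a::alg_closed_field set"
  assumes zero_mem [simp, intro]: "0 \<in> T"
    and one_mem [simp, intro]: "1 \<in> T"
    and add_mem [intro]: "x \<in> T \<Longrightarrow> y \<in> T \<Longrightarrow> x + y \<in> T"
    and mult_mem [intro]: "x \<in> T \<Longrightarrow> y \<in> T \<Longrightarrow> x * y \<in> T"
    and uminus_mem [intro]: "x \<in> T \<Longrightarrow> - x \<in> T"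
    and root_mem: "x ^ n \<in> T \<Longrightarrow> 0 < n \<Longrightarrow> x \<in> T"
begin

lemma diff_mem [intro]: "x \<in> T \<Longrightarrow> y \<in> T \<Longrightarrow> x - y \<in> T"
  using add_mem[of x "- y"] by auto

lemma power_mem [intro]: "x \<in> T \<Longrightarrow> x ^ n \<in> T"
  by (induction n) auto

lemma of_nat_mem [simp, intro]: "of_nat n \<in> T"
  by (induction n) auto

lemma of_int_mem [simp, intro]: "of_int n \<in> T"
  by (cases n) auto

lemma sum_mem [intro]: "(\<And>i. i \<in> I \<Longrightarrow> f i \<in> T) \<Longrightarrow> sum f I \<in> T"
  by (induction I rule: infinite_finite_induct) auto

text \<open>\<open>ipow G d\<close> is the \<open>d\<close>-th power of the ideal of \<open>T\<close> generated by \<open>G\<close>.\<close>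

inductive in_ipow :: "'a set \<Rightarrow> nat \<Rightarrow> 'a \<Rightarrow> bool" for G where
  "t \<in> T \<Longrightarrow> in_ipow G 0 t"
| "in_ipow G d 0"
| "x \<in> G \<Longrightarrow> in_ipow G d y \<Longrightarrow> in_ipow G (Suc d) (x * y)"
| "in_ipow G d y \<Longrightarrow> in_ipow G d z \<Longrightarrow> in_ipow G d (y + z)"

definition ipow :: "'a set \<Rightarrow> nat \<Rightarrow> 'a set" where
  "ipow G d = Collect (in_ipow G d)"

lemma ipow_base: "t \<in> T \<Longrightarrow> t \<in> ipow G 0"
  and ipow_zero: "0 \<in> ipow G d"
  and ipow_gen: "x \<in> G \<Longrightarrow> y \<in> ipow G d \<Longrightarrow> x * y \<in> ipow G (Suc d)"
  and ipow_add: "y \<in> ipow G d \<Longrightarrow> z \<in> ipow G d \<Longrightarrow> y + z \<in> ipow G d"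
  by (auto simp: ipow_def intro: in_ipow.intros)

lemmas ipow_intros = ipow_base ipow_zero ipow_gen ipow_add

lemma ipow_induct [consumes 1, case_names base zero gen add]:
  assumes "x \<in> ipow G d"
    and "\<And>t. t \<in> T \<Longrightarrow> P 0 t" and "\<And>d. P d 0"
    and "\<And>x y d. x \<in> G \<Longrightarrow> y \<in> ipow G d \<Longrightarrow> P d y \<Longrightarrow> P (Suc d) (x * y)"
    and "\<And>y z d. y \<in> ipow G d \<Longrightarrow> P d y \<Longrightarrow> z \<in> ipow G d \<Longrightarrow> P d z \<Longrightarrow> P d (y + z)"
  shows "P d x"
proof -
  have "in_ipow G d x" using assms(1) by (simp add: ipow_def)
  then show ?thesis by induction (use assms(2-) in \<open>auto simp: ipow_def\<close>)
qed

lemma ipow_smult: "y \<in> ipow G d \<Longrightarrow> t \<in> T \<Longrightarrow> t * y \<in> ipow G d"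
proof (induction rule: ipow_induct)
  case (gen x y d)
  then show ?case using ipow_gen[of x G "t * y" d] by (simp add: mult.left_commute)
qed (auto intro: ipow_intros simp: distrib_left)

lemma ipow_uminus: "y \<in> ipow G d \<Longrightarrow> - y \<in> ipow G d"
  using ipow_smult[of y G d "-1"] by auto

lemma ipow_diff: "y \<in> ipow G d \<Longrightarrow> z \<in> ipow G d \<Longrightarrow> y - z \<in> ipow G d"
  using ipow_add[of y G d "- z"] ipow_uminus by simp

lemma ipow_sum: "(\<And>i. i \<in> I \<Longrightarrow> f i \<in> ipow G d) \<Longrightarrow> sum f I \<in> ipow G d"
  by (induction I rule: infinite_finite_induct) (auto intro: ipow_intros)

lemma ipow_sum_list: "set xs \<subseteq> ipow G d \<Longrightarrow> sum_list xs \<in> ipow G d"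
  by (induction xs) (auto intro: ipow_intros)

lemma ipow_mult: "y \<in> ipow G d \<Longrightarrow> z \<in> ipow G e \<Longrightarrow> y * z \<in> ipow G (d + e)"
proof (induction rule: ipow_induct)
  case (gen x y d)
  then show ?case using ipow_gen[of x G "y * z" "d + e"] by (simp add: mult.assoc)
qed (auto intro: ipow_intros ipow_smult simp: distrib_right)

lemma ipow_power: "y \<in> ipow G d \<Longrightarrow> y ^ n \<in> ipow G (d * n)"
  by (induction n) (auto intro: ipow_base ipow_mult)

lemma ipow_1: "x \<in> G \<Longrightarrow> x \<in> ipow G 1"
  using ipow_gen[of x G 1 0] ipow_base[of 1] by simp

lemma ipow_trans: "x \<in> ipow G d \<Longrightarrow> G \<subseteq> ipow H k \<Longrightarrow> x \<in> ipow H (k * d)"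
proof (induction rule: ipow_induct)
  case (gen x y d)
  then show ?case using ipow_mult[of x H k y "k * d"] by auto
qed (auto intro: ipow_intros)

lemma ipow_scale: "x \<in> ipow G d \<Longrightarrow> s \<in> T \<Longrightarrow> s ^ d * x \<in> ipow ((*) s ` G) d"
proof (induction rule: ipow_induct)
  case (gen x y d)
  then have "(s * x) * (s ^ d * y) \<in> ipow ((*) s ` G) (Suc d)" by (intro ipow_gen) auto
  moreover have "s ^ Suc d * (x * y) = (s * x) * (s ^ d * y)" by (simp add: mult_ac)
  ultimately show ?case by (simp only:)
qed (auto intro: ipow_intros simp: distrib_left)

lemma ipow_mem: "x \<in> ipow G d \<Longrightarrow> G \<subseteq> T \<Longrightarrow> x \<in> T"
  by (induction rule: ipow_induct) auto

lemma ipow_dec: "x \<in> ipow G d \<Longrightarrow> G \<subseteq> T \<Longrightarrow> e \<le> d \<Longrightarrow> x \<in> ipow G e"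
proof (induction arbitrary: e rule: ipow_induct)
  case (gen x y d)
  show ?case
  proof (cases e)
    case 0
    then show ?thesis using gen ipow_mem[OF gen(2)] by (auto intro: ipow_base)
  next
    case (Suc e')
    then show ?thesis using gen by (auto intro: ipow_intros)
  qed
qed (auto intro: ipow_intros)

text \<open>Needed to turn the error term A, which involves z itself, into a polynomial in z whose
  coefficients are homogeneous in the other generators.\<close>

lemma ipow_insert:
  assumes "x \<in> ipow (insert z G) d"
  shows "\<exists>c. (\<forall>i\<le>d. c i \<in> ipow G (d - i)) \<and> x = (\<Sum>i\<le>d. c i * z ^ i)"
  using assms
proof (induction rule: ipow_induct)
  case (base t)
  then show ?case by (intro exI[of _ "\<lambda>_. t"]) (auto intro: ipow_intros)
next
  case (zero d)
  then show ?case by (intro exI[of _ "\<lambda>_. 0"]) (auto intro: ipow_intros)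
next
  case (add y w d)
  then obtain c c' where "\<forall>i\<le>d. c i \<in> ipow G (d - i)" "y = (\<Sum>i\<le>d. c i * z ^ i)"
    "\<forall>i\<le>d. c' i \<in> ipow G (d - i)" "w = (\<Sum>i\<le>d. c' i * z ^ i)" by blast
  then show ?case
    by (intro exI[of _ "\<lambda>i. c i + c' i"])
      (auto intro: ipow_intros simp: sum.distrib distrib_right)
next
  case (gen x y d)
  then obtain c where c: "\<forall>i\<le>d. c i \<in> ipow G (d - i)" "y = (\<Sum>i\<le>d. c i * z ^ i)" by blast
  show ?case
  proof (cases "x = z")
    case True
    have "(\<Sum>i\<le>Suc d. (case i of 0 \<Rightarrow> 0 | Suc j \<Rightarrow> c j) * z ^ i) = x * y"
      unfolding sum.atMost_Suc_shift c(2) True by (simp add: sum_distrib_left mult_ac)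
    then show ?thesis using c
      by (intro exI[of _ "\<lambda>i. case i of 0 \<Rightarrow> 0 | Suc j \<Rightarrow> c j"])
        (auto intro: ipow_intros split: nat.split)
  next
    case False
    then have "x \<in> G" using gen by auto
    moreover have "(\<Sum>i\<le>Suc d. (if i \<le> d then x * c i else 0) * z ^ i) = x * y"
      unfolding sum.atMost_Suc c(2) by (simp add: sum_distrib_left mult_ac)
    ultimately show ?thesis using c
      by (intro exI[of _ "\<lambda>i. if i \<le> d then x * c i else 0"])
        (auto intro: ipow_intros simp: Suc_diff_le)
  qed
qed

section \<open>Powers p^r of sums inside powers of an ideal\<close>

text \<open>The inner binomial coefficients are divisible by p. What matters is that the cofactor of
  p keeps degree d p; an error known only to lie in T would not do for the later weight
  estimates.\<close>

lemma ipow_add_power: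
  assumes p: "prime p" and xy: "x \<in> ipow G d" "y \<in> ipow G d"
  shows "\<exists>c\<in>ipow G (d * p). (x + y) ^ p = x ^ p + y ^ p + of_nat p * c"
proof -
  have p0: "p > 0" using p by (simp add: prime_gt_0_nat)
  define c where "c = (\<Sum>k\<in>{1..<p}. of_nat ((p choose k) div p) * (x ^ k * y ^ (p - k)))"
  have "(x + y) ^ p = (\<Sum>k\<le>p. of_nat (p choose k) * x ^ k * y ^ (p - k))"
    by (rule binomial_ring)
  also have "{..p} = insert 0 (insert p {1..<p})" using p0 by auto
  also have "(\<Sum>k\<in>insert 0 (insert p {1..<p}). of_nat (p choose k) * x ^ k * y ^ (p - k))
      = y ^ p + (x ^ p + (\<Sum>k\<in>{1..<p}. of_nat (p choose k) * x ^ k * y ^ (p - k)))"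
    using p0 by simp
  also have "(\<Sum>k\<in>{1..<p}. of_nat (p choose k) * x ^ k * y ^ (p - k)) = of_nat p * c"
    unfolding c_def sum_distrib_left
  proof (rule sum.cong)
    fix k assume k: "k \<in> {1..<p}"
    then have "p dvd p choose k" using p by (intro dvd_choose_prime) auto
    then have "(p choose k) = p * ((p choose k) div p)" by simp
    then have "(of_nat (p choose k) :: 'a) = of_nat p * of_nat ((p choose k) div p)"
      by (metis of_nat_mult)
    then show "of_nat (p choose k) * x ^ k * y ^ (p - k)
        = of_nat p * (of_nat ((p choose k) div p) * (x ^ k * y ^ (p - k)))"
      by (simp add: mult.assoc)
  qed simp
  finally have "(x + y) ^ p = x ^ p + y ^ p + of_nat p * c" by simp
  moreover have "c \<in> ipow G (d * p)"
    unfolding c_def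
  proof (rule ipow_sum, rule ipow_smult)
    fix k assume "k \<in> {1..<p}"
    then have "d * p = d * k + d * (p - k)" by (simp flip: distrib_left)
    then show "x ^ k * y ^ (p - k) \<in> ipow G (d * p)"
      using ipow_mult[OF ipow_power[OF xy(1), of k] ipow_power[OF xy(2), of "p - k"]] by simp
  qed (rule of_nat_mem)
  ultimately show ?thesis by blast
qed

lemma ipow_sum_list_power:
  assumes p: "prime p" and xs: "set xs \<subseteq> ipow G d"
  shows "\<exists>c\<in>ipow G (d * p). sum_list xs ^ p = (\<Sum>x\<leftarrow>xs. x ^ p) + of_nat p * c"
  using xs
proof (induction xs)
  case Nil
  then show ?case using p by (auto intro!: bexI[of _ 0] ipow_zero simp: prime_gt_0_nat)
next
  case (Cons x xs)
  then obtain c where c: "c \<in> ipow G (d * p)" "sum_list xs ^ p = (\<Sum>x\<leftarrow>xs. x ^ p) + of_nat p * c"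
    by auto
  have "sum_list xs \<in> ipow G d" using Cons.prems by (intro ipow_sum_list) auto
  then obtain c' where c': "c' \<in> ipow G (d * p)"
    "(x + sum_list xs) ^ p = x ^ p + sum_list xs ^ p + of_nat p * c'"
    using ipow_add_power[OF p, of x G d "sum_list xs"] Cons.prems by auto
  show ?case
    by (intro bexI[of _ "c + c'"]) (use c c' in \<open>auto intro: ipow_intros simp: algebra_simps\<close>)
qed

lemma ipow_sum_list_power_pow:
  assumes p: "prime p" and xs: "set xs \<subseteq> ipow G d"
  shows "\<exists>c\<in>ipow G (d * p ^ r). sum_list xs ^ (p ^ r) = (\<Sum>x\<leftarrow>xs. x ^ (p ^ r)) + of_nat p * c"
proof (induction r)
  case 0
  then show ?case by (auto intro!: bexI[of _ 0] ipow_zero)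
next
  case (Suc r)
  then obtain c where c: "c \<in> ipow G (d * p ^ r)"
    "sum_list xs ^ (p ^ r) = (\<Sum>x\<leftarrow>xs. x ^ (p ^ r)) + of_nat p * c" by blast
  \<comment> \<open>The error of stage r enters the next p-th power as one more summand. Its own
    p-th power p^p c^p is again p times a homogeneous element of the right degree.\<close>
  define ys where "ys = map (\<lambda>x. x ^ (p ^ r)) xs @ [of_nat p * c]"
  have "set ys \<subseteq> ipow G (d * p ^ r)"
    using xs c(1) by (auto simp: ys_def intro!: ipow_power ipow_smult)
  from ipow_sum_list_power[OF p this] obtain c' where c': "c' \<in> ipow G (d * p ^ Suc r)"
    "sum_list ys ^ p = (\<Sum>y\<leftarrow>ys. y ^ p) + of_nat p * c'" by (auto simp: mult_ac)
  obtain p' where p': "p = Suc p'" using p by (metis not_prime_0 nat.exhaust)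
  have "sum_list xs ^ (p ^ Suc r) = sum_list ys ^ p"
    using c(2) by (simp add: ys_def mult.commute[of p] power_mult)
  also have "\<dots> = (\<Sum>x\<leftarrow>xs. x ^ (p ^ Suc r)) + of_nat p ^ p * c ^ p + of_nat p * c'"
    unfolding c'(2) by (simp add: ys_def comp_def power_mult_distrib mult.commute[of p] power_mult)
  also have "\<dots> = (\<Sum>x\<leftarrow>xs. x ^ (p ^ Suc r)) + of_nat p * (of_nat p ^ p' * c ^ p + c')"
    using arg_cong[OF p', of "\<lambda>n. (of_nat p :: 'a) ^ n"]
    by (simp add: distrib_left mult.assoc add.assoc)
  finally have "sum_list xs ^ (p ^ Suc r)
      = (\<Sum>x\<leftarrow>xs. x ^ (p ^ Suc r)) + of_nat p * (of_nat p ^ p' * c ^ p + c')" .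
  moreover have "of_nat p ^ p' * c ^ p + c' \<in> ipow G (d * p ^ Suc r)"
    using c'(1) ipow_power[OF c(1), of p]
    by (intro ipow_add ipow_smult) (auto simp: mult_ac)
  ultimately show ?case by blast
qed

end

section \<open>Families of p-power roots and divisibility of their sums\<close>

locale prime_root_closed_subring = root_closed_subring T for T :: "'a::alg_closed_field set" +
  fixes p :: nat
  assumes p_prime: "prime p" and p_nz: "(of_nat p :: 'a) \<noteq> 0"
begin

definition root_system :: "(nat \<Rightarrow> 'a) \<Rightarrow> bool" where
  "root_system g \<longleftrightarrow> (\<forall>l. g l \<in> T \<and> g (Suc l) ^ p = g l)"

lemma p_pos: "0 < p"
  using p_prime by (rule prime_gt_0_nat)

lemma root_system_power: "root_system g \<Longrightarrow> g (l + k) ^ (p ^ k) = g l"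
proof (induction k)
  case (Suc k)
  then have "g (l + Suc k) ^ p = g (l + k)" by (simp add: root_system_def)
  then show ?case using Suc by (simp add: power_mult)
qed auto

lemma root_system_power': "root_system g \<Longrightarrow> l \<le> m \<Longrightarrow> g m ^ (p ^ (m - l)) = g l"
  using root_system_power[of g l "m - l"] by simp

lemma root_system_mem: "root_system g \<Longrightarrow> g l \<in> T"
  by (simp add: root_system_def)

lemma root_system_shift: "root_system g \<Longrightarrow> root_system (\<lambda>l. g (k + l))"
  by (simp add: root_system_def)

lemma root_system_mult: "root_system g \<Longrightarrow> root_system h \<Longrightarrow> root_system (\<lambda>l. g l * h l)"
  by (auto simp: root_system_def power_mult_distrib)

lemma root_system_pow: "root_system g \<Longrightarrow> root_system (\<lambda>l. g l ^ n)"
  by (auto simp: root_system_def) (metis mult.commute power_mult)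

lemma ex_root_system:
  assumes "c \<in> T"
  obtains g where "root_system g" "g 0 = c"
proof -
  define g where "g = rec_nat c (\<lambda>_ y. SOME z. z ^ p = y)"
  have g: "g (Suc l) ^ p = g l" for l
    unfolding g_def using someI_ex[OF nth_root_exists[OF p_pos]] by auto
  have "g l \<in> T" for l
  proof (induction l)
    case 0
    then show ?case using assms by (simp add: g_def)
  next
    case (Suc l)
    then show ?case using g[of l] root_mem[of "g (Suc l)" p] p_pos by simp
  qed
  with g have "root_system g" by (simp add: root_system_def)
  moreover have "g 0 = c" by (simp add: g_def)
  ultimately show thesis by (rule that)
qed

text \<open>Levels below k are forced, being powers of c; levels above are chosen roots. This lets a
  quotient found only at a deep level join a family that starts at level 0.\<close>

lemma ex_root_system_at:
  assumes "c \<in> T"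
  obtains g where "root_system g" "g k = c"
proof -
  obtain h where h: "root_system h" "h 0 = c" using ex_root_system[OF assms] .
  define g where "g l = (if l \<le> k then c ^ (p ^ (k - l)) else h (l - k))" for l
  have "g (Suc l) ^ p = g l" for l
  proof (cases "l < k")
    case True
    then have "k - l = Suc (k - Suc l)" by simp
    then have "c ^ (p ^ (k - l)) = (c ^ (p ^ (k - Suc l))) ^ p"
      by (simp add: mult.commute[of p] power_mult)
    then show ?thesis using True by (simp add: g_def)
  next
    case False
    then show ?thesis using h by (cases "l = k") (auto simp: g_def root_system_def Suc_diff_le)
  qed
  moreover have "g l \<in> T" for l
    using assms root_system_mem[OF h(1)] by (auto simp: g_def)
  ultimately have "root_system g" by (simp add: root_system_def)
  moreover have "g k = c" by (simp add: g_def)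
  ultimately show thesis by (rule that)
qed

definition level :: "(nat \<Rightarrow> 'a) list \<Rightarrow> nat \<Rightarrow> 'a set" where
  "level gs l = (\<lambda>g. g l) ` set gs"

lemma level_mem: "\<forall>g\<in>set gs. root_system g \<Longrightarrow> level gs l \<subseteq> T"
  by (auto simp: level_def root_system_mem)

lemma level_ipow:
  assumes "\<forall>g\<in>set gs. root_system g"
  shows "level gs l \<subseteq> ipow (level gs (l + k)) (p ^ k)"
proof
  fix x assume "x \<in> level gs l"
  then obtain g where g: "g \<in> set gs" "x = g l" by (auto simp: level_def)
  then have "x = g (l + k) ^ (p ^ k)" using assms root_system_power by metis
  moreover have "g (l + k) \<in> ipow (level gs (l + k)) 1"
    using g by (intro ipow_1) (auto simp: level_def)
  ultimately show "x \<in> ipow (level gs (l + k)) (p ^ k)"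
    using ipow_power[of "g (l + k)" _ 1 "p ^ k"] by simp
qed

lemma ipow_level_raise:
  assumes "\<forall>g\<in>set gs. root_system g" "x \<in> ipow (level gs l) d"
  shows "x \<in> ipow (level gs (l + k)) (p ^ k * d)"
  using ipow_trans[OF assms(2) level_ipow[OF assms(1)]] .

text \<open>Roots of a sum are not sums of roots, so x is broken into monomials first: each has the
  roots of its coefficient times the shifted roots of its generators. Degree d at level E + l means
  that a p^l-th root carries the fraction 1/p^l of the weight.\<close>

lemma ipow_root_systems:
  assumes gs: "\<forall>g\<in>set gs. root_system g" and x: "x \<in> ipow (level gs E) d"
  shows "\<exists>ms. (\<forall>m\<in>set ms. root_system m \<and> (\<forall>l. m l \<in> ipow (level gs (E + l)) d)) \<and>
    x = (\<Sum>m\<leftarrow>ms. m 0)"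
  using x
proof (induction rule: ipow_induct)
  case (base t)
  then obtain g where "root_system g" "g 0 = t" using ex_root_system by blast
  then show ?case
    by (intro exI[of _ "[g]"]) (auto intro: ipow_intros root_system_mem)
next
  case (zero d)
  then show ?case by (intro exI[of _ "[]"]) auto
next
  case (add y z d)
  then obtain ms ns where "\<forall>m\<in>set ms. root_system m \<and> (\<forall>l. m l \<in> ipow (level gs (E + l)) d)"
    "y = (\<Sum>m\<leftarrow>ms. m 0)"
    "\<forall>m\<in>set ns. root_system m \<and> (\<forall>l. m l \<in> ipow (level gs (E + l)) d)"
    "z = (\<Sum>m\<leftarrow>ns. m 0)" by blast
  then show ?case by (intro exI[of _ "ms @ ns"]) auto
next
  case (gen x y d)
  then obtain ms where ms: "\<forall>m\<in>set ms. root_system m \<and> (\<forall>l. m l \<in> ipow (level gs (E + l)) d)"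
    "y = (\<Sum>m\<leftarrow>ms. m 0)" by blast
  obtain g where g: "g \<in> set gs" "x = g E" using gen by (auto simp: level_def)
  then have "root_system g" using gs by auto
  have "\<forall>m\<in>set (map (\<lambda>m l. g (E + l) * m l) ms).
      root_system m \<and> (\<forall>l. m l \<in> ipow (level gs (E + l)) (Suc d))"
    using ms(1) g root_system_mult[OF root_system_shift[OF \<open>root_system g\<close>]]
    by (auto intro!: ipow_gen simp: level_def)
  moreover have "x * y = (\<Sum>m\<leftarrow>map (\<lambda>m l. g (E + l) * m l) ms. m 0)"
    by (simp add: g ms(2) comp_def sum_list_const_mult)
  ultimately show ?case by blast
qed

text \<open>
  Induction on \<open>k\<close>: at a deep level \<open>E\<close>, the \<open>p\<^sup>E\<close>-th power of the sum differs from the sum at level \<open>0\<close>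
  by \<open>p\<close> times homogeneous terms.  Hence the sum at level \<open>E\<close> is divisible by \<open>\<pi> E\<close>, and the quotient
  together with these terms is a new family of systems whose sum is divisible by \<open>p\<^sup>k\<close>.  The depth \<open>j\<close>
  must not depend on the family, since the new family is only controlled from level \<open>E\<close> on.
\<close>

lemma root_systems_divisible:
  assumes \<pi>: "root_system \<pi>" "\<pi> 0 = of_nat p"
  shows "\<exists>j. \<forall>gs. (\<forall>g\<in>set gs. root_system g) \<longrightarrow>
    (\<exists>B\<in>T. (\<Sum>g\<leftarrow>gs. g 0) = of_nat p ^ k * B) \<longrightarrow>
    (\<exists>A\<in>ipow (level gs (e + j)) (p ^ j). \<exists>B\<in>T. (\<Sum>g\<leftarrow>gs. g e) = \<pi> e * A + \<pi> e ^ k * B)"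
proof (induction k)
  case 0
  have "(\<Sum>g\<leftarrow>gs. g e) \<in> T" if "\<forall>g\<in>set gs. root_system g" for gs
    using that by (induction gs) (auto intro: root_system_mem)
  then show ?case
    by (intro exI[of _ 0] allI impI) (metis add_0 ipow_zero mult_1 mult_zero_right power_0)
next
  case (Suc k)
  then obtain j where IH: "\<And>gs. (\<forall>g\<in>set gs. root_system g) \<Longrightarrow>
    (\<exists>B\<in>T. (\<Sum>g\<leftarrow>gs. g 0) = of_nat p ^ k * B) \<Longrightarrow>
    (\<exists>A\<in>ipow (level gs (e + j)) (p ^ j). \<exists>B\<in>T. (\<Sum>g\<leftarrow>gs. g e) = \<pi> e * A + \<pi> e ^ k * B)"
    by blast
  define E where "E = e + j"
  show ?case
  proof (intro exI[of _ "E + j"] allI impI)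
    fix gs
    assume gs: "\<forall>g\<in>set gs. root_system g"
      and "\<exists>B\<in>T. (\<Sum>g\<leftarrow>gs. g 0) = of_nat p ^ Suc k * B"
    then obtain B0 where B0: "B0 \<in> T" "(\<Sum>g\<leftarrow>gs. g 0) = of_nat p ^ Suc k * B0" by blast
    define S where "S = (\<Sum>g\<leftarrow>gs. g E)"
    let ?xs = "map (\<lambda>g. g E) gs"
    have xs: "set ?xs \<subseteq> ipow (level gs E) 1" by (auto simp: level_def intro: ipow_1[simplified])
    have pe: "\<pi> E \<noteq> 0" "\<pi> e \<in> T" "\<pi> E ^ (p ^ E) = of_nat p" "\<pi> E ^ (p ^ j) = \<pi> e"
      using root_system_power[OF \<pi>(1), of 0 E] root_system_power[OF \<pi>(1), of e j] \<pi> p_nz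
        root_system_mem[OF \<pi>(1)] by (auto simp: E_def power_0_left split: if_splits)
    have gE: "g E ^ (p ^ E) = g 0" "g E ^ (p ^ j) = g e" if "g \<in> set gs" for g
      using that gs root_system_power[of g 0 E] root_system_power[of g e j] by (auto simp: E_def)
    obtain c where c: "c \<in> ipow (level gs E) (p ^ E)"
      "S ^ (p ^ E) = (\<Sum>x\<leftarrow>?xs. x ^ (p ^ E)) + of_nat p * c"
      using ipow_sum_list_power_pow[OF p_prime xs, of E] by (auto simp: S_def)
    have "(\<Sum>x\<leftarrow>?xs. x ^ (p ^ E)) = (\<Sum>g\<leftarrow>gs. g 0)"
      by (simp add: comp_def gE cong: map_cong)
    then have Sp: "S ^ (p ^ E) = of_nat p * (of_nat p ^ k * B0 + c)"
      using c(2) B0(2) by (simp add: algebra_simps)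
    \<comment> \<open>Divisibility by \<open>\<pi> E\<close> comes from root closure: the p^E-th
      power of the quotient lies in T.\<close>
    define Y where "Y = S / \<pi> E"
    have S: "S = \<pi> E * Y" using pe by (simp add: Y_def)
    then have "of_nat p * Y ^ (p ^ E) = of_nat p * (of_nat p ^ k * B0 + c)"
      using Sp pe by (simp add: power_mult_distrib)
    then have Yp: "Y ^ (p ^ E) = of_nat p ^ k * B0 + c" using p_nz by simp
    have cT: "c \<in> T" using ipow_mem[OF c(1) level_mem[OF gs]] .
    then have "Y ^ (p ^ E) \<in> T" using B0 Yp by auto
    then have "Y \<in> T" using root_mem p_pos by simp
    then obtain y where y: "root_system y" "y E = Y" using ex_root_system_at by blast
    \<comment> \<open>At level 0 the system through Y contributes p^k B0 + c, and the systems for -c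
      leave exactly p^k B0. This is one power of p less, as the induction hypothesis
      requires.\<close>
    obtain ms where ms: "\<And>m. m \<in> set ms \<Longrightarrow> root_system m"
      "\<And>m l. m \<in> set ms \<Longrightarrow> m l \<in> ipow (level gs (E + l)) (p ^ E)"
      "- c = (\<Sum>m\<leftarrow>ms. m 0)"
      using ipow_root_systems[OF gs ipow_uminus[OF c(1)]] by blast
    have "y 0 = Y ^ (p ^ E)" using root_system_power[OF y(1), of 0 E] y(2) by simp
    then have "(\<Sum>g\<leftarrow>y # ms. g 0) = of_nat p ^ k * B0" using Yp by (simp flip: ms(3))
    then obtain A' B' where A': "A' \<in> ipow (level (y # ms) E) (p ^ j)" and B': "B' \<in> T"
      and AB: "(\<Sum>g\<leftarrow>y # ms. g e) = \<pi> e * A' + \<pi> e ^ k * B'"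
      using IH[of "y # ms"] y ms(1) B0(1) unfolding E_def by auto
    \<comment> \<open>Degree p^(E + j) at level 2 E has the weight of a single generator at level e,
      because 2 E = e + (E + j).\<close>
    define J where "J = ipow (level gs (E + E)) (p ^ (E + j))"
    \<comment> \<open>Y alone is not known to be homogeneous, only \<open>\<pi> E * Y = S\<close>
      is. A' has degree p^j in Y and the \<open>m E\<close>, so it needs p^j factors
      \<open>\<pi> E\<close>, and these multiply to the \<open>\<pi> e\<close> in front of
      it.\<close>
    have S1: "S \<in> ipow (level gs E) 1"
      unfolding S_def using ipow_sum_list[OF xs] by simp
    have "(*) (\<pi> E) ` level (y # ms) E \<subseteq> ipow (level gs (E + E)) (p ^ E)"
      using ipow_level_raise[OF gs S1, of E] ms(2) S y(2) root_system_mem[OF \<pi>(1)]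
      by (auto simp: level_def intro!: ipow_smult)
    from ipow_trans[OF ipow_scale[OF A' root_system_mem[OF \<pi>(1)]] this]
    have J1: "\<pi> e * A' \<in> J" unfolding J_def by (simp add: pe power_add)
    have "m e \<in> J" if "m \<in> set ms" for m
    proof -
      have "m e \<in> ipow (level gs (E + e + j)) (p ^ j * p ^ E)"
        by (rule ipow_level_raise[OF gs ms(2)[OF that]])
      then show ?thesis unfolding J_def E_def by (simp add: add_ac power_add mult_ac)
    qed
    then have J2: "(\<Sum>m\<leftarrow>ms. m e) \<in> J"
      unfolding J_def by (intro ipow_sum_list) auto
    \<comment> \<open>The p^j-th power leads back from level E to level e. There S contributes a new
      factor \<open>\<pi> e\<close>, which turns \<open>\<pi> e ^ k\<close> into
      \<open>\<pi> e ^ Suc k\<close>; the correction is a multiple of p and hence of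
      \<open>\<pi> e\<close>.\<close>
    have "y e = Y ^ (p ^ j)" using root_system_power[OF y(1), of e j] y(2) by (simp add: E_def)
    then have Sj: "S ^ (p ^ j) = \<pi> e * y e" using pe S by (simp add: power_mult_distrib)
    obtain c' where c': "c' \<in> ipow (level gs E) (p ^ j)"
      "S ^ (p ^ j) = (\<Sum>x\<leftarrow>?xs. x ^ (p ^ j)) + of_nat p * c'"
      using ipow_sum_list_power_pow[OF p_prime xs, of j] by (auto simp: S_def)
    have "(\<Sum>x\<leftarrow>?xs. x ^ (p ^ j)) = (\<Sum>g\<leftarrow>gs. g e)"
      by (simp add: comp_def gE cong: map_cong)
    then have Sj': "(\<Sum>g\<leftarrow>gs. g e) = S ^ (p ^ j) - of_nat p * c'"
      using c'(2) by simp
    obtain n where n: "p ^ e = Suc n" using p_pos by (metis not0_implies_Suc power_not_zero not_gr0)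
    have pp: "of_nat p = \<pi> e * \<pi> e ^ n"
      using root_system_power[OF \<pi>(1), of 0 e] n \<pi>(2) by simp
    have J3: "\<pi> e ^ n * c' \<in> J"
      using ipow_level_raise[OF gs c'(1), of E] pe
      unfolding J_def by (auto simp: power_add intro!: ipow_smult)
    let ?A = "\<pi> e * A' - (\<Sum>m\<leftarrow>ms. m e) - \<pi> e ^ n * c'"
    have ye: "y e = \<pi> e * A' + \<pi> e ^ k * B' - (\<Sum>m\<leftarrow>ms. m e)"
      using AB by (simp add: eq_diff_eq)
    have "(\<Sum>g\<leftarrow>gs. g e) = \<pi> e * ?A + \<pi> e ^ Suc k * B'"
      unfolding Sj' Sj ye pp by (simp add: algebra_simps)
    moreover have "?A \<in> J"
      using J1 J2 J3 unfolding J_def by (intro ipow_diff)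
    moreover have "e + (E + j) = E + E" by (simp add: E_def)
    ultimately show "\<exists>A\<in>ipow (level gs (e + (E + j))) (p ^ (E + j)). \<exists>B\<in>T.
        (\<Sum>g\<leftarrow>gs. g e) = \<pi> e * A + \<pi> e ^ Suc k * B"
      using B' unfolding J_def by metis
  qed
qed

end

section \<open>Roots of \<open>p\<^sup>a + x\<^sup>b\<close>\<close>

locale diagonal_roots = prime_root_closed_subring T p for T :: "'a::alg_closed_field set" and p +
  fixes \<pi> \<xi> z :: "nat \<Rightarrow> 'a" and a b :: nat
  assumes \<pi>: "root_system \<pi>" "\<pi> 0 = of_nat p"
    and \<xi>: "root_system \<xi>" and \<xi>_nz: "\<xi> 0 \<noteq> 0"
    and z: "root_system z" "z 0 = \<pi> 0 ^ a + \<xi> 0 ^ b"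
    and a: "0 < a" and b: "0 < b"
begin

abbreviation U :: "nat \<Rightarrow> 'a" where "U l \<equiv> \<pi> l ^ a"
abbreviation V :: "nat \<Rightarrow> 'a" where "V l \<equiv> \<xi> l ^ b"

lemma T_roots [simp, intro]: "\<pi> l \<in> T" "\<xi> l \<in> T" "z l \<in> T"
  using \<pi> \<xi> z by (auto intro: root_system_mem)

lemma \<pi>_power: "l \<le> m \<Longrightarrow> \<pi> m ^ (p ^ (m - l)) = \<pi> l"
  and \<xi>_power: "l \<le> m \<Longrightarrow> \<xi> m ^ (p ^ (m - l)) = \<xi> l"
  and z_power: "l \<le> m \<Longrightarrow> z m ^ (p ^ (m - l)) = z l"
  using \<pi> \<xi> z by (auto intro: root_system_power')

text \<open>The sum z - U - V vanishes at level 0 and is thus divisible by every power of p, so k is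
  free. The term A may still involve z; the equation for \<zeta> makes it a unit of T.\<close>

lemma root_approximation:
  "\<exists>\<zeta> j. \<zeta> ^ (2 * p ^ e) = 1 \<and> \<zeta> \<in> T \<and> (\<exists>A\<in>ipow {z (e + j), U (e + j), V (e + j)} (p ^ j).
     \<exists>B\<in>T. z e = \<zeta> * (U e + V e) + \<pi> e * A + \<pi> e ^ k * B)"
proof -
  \<comment> \<open>The relation has to be a sum of root systems, so the minus sign becomes a system
    of roots of -1. For p = 2 a constant sign would not be one.\<close>
  obtain \<zeta> where \<zeta>: "root_system \<zeta>" "\<zeta> 0 = -1" using ex_root_system[of "-1"] by auto
  obtain j where j: "\<And>gs. (\<forall>g\<in>set gs. root_system g) \<Longrightarrow>
    (\<exists>B\<in>T. (\<Sum>g\<leftarrow>gs. g 0) = of_nat p ^ k * B) \<Longrightarrow>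
    (\<exists>A\<in>ipow (level gs (e + j)) (p ^ j). \<exists>B\<in>T. (\<Sum>g\<leftarrow>gs. g e) = \<pi> e * A + \<pi> e ^ k * B)"
    using root_systems_divisible[OF \<pi>, of k e] by blast
  define gs where "gs = [z, \<lambda>l. \<zeta> l * U l, \<lambda>l. \<zeta> l * V l]"
  have gs: "\<forall>g\<in>set gs. root_system g"
    using z \<pi> \<xi> \<zeta> by (auto simp: gs_def intro: root_system_mult root_system_pow)
  moreover have "(\<Sum>g\<leftarrow>gs. g 0) = of_nat p ^ k * 0"
    using z(2) \<zeta>(2) by (simp add: gs_def)
  ultimately obtain A B where A: "A \<in> ipow (level gs (e + j)) (p ^ j)" and B: "B \<in> T"
    and AB: "(\<Sum>g\<leftarrow>gs. g e) = \<pi> e * A + \<pi> e ^ k * B"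
    using j[of gs] by blast
  have "y \<in> ipow {z (e + j), U (e + j), V (e + j)} 1 \<and>
      \<zeta> (e + j) * y \<in> ipow {z (e + j), U (e + j), V (e + j)} 1"
    if "y \<in> {z (e + j), U (e + j), V (e + j)}" for y
    using that root_system_mem[OF \<zeta>(1)] by (intro conjI ipow_smult ipow_1)
  then have "level gs (e + j) \<subseteq> ipow {z (e + j), U (e + j), V (e + j)} 1"
    by (simp add: level_def gs_def)
  from ipow_trans[OF A this] have "A \<in> ipow {z (e + j), U (e + j), V (e + j)} (p ^ j)" by simp
  moreover have "z e = - \<zeta> e * (U e + V e) + \<pi> e * A + \<pi> e ^ k * B"
    using AB by (simp add: gs_def algebra_simps eq_diff_eq)
  moreover have "(- \<zeta> e) ^ (2 * p ^ e) = 1"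
  proof -
    have "(- \<zeta> e) ^ (2 * p ^ e) = (\<zeta> e ^ (p ^ e)) ^ 2"
      by (metis mult.commute power2_minus power_mult)
    then show ?thesis using root_system_power[OF \<zeta>(1), of 0 e] \<zeta>(2) by simp
  qed
  moreover have "- \<zeta> e \<in> T" using root_system_mem[OF \<zeta>(1)] by auto
  ultimately show ?thesis using B by blast
qed

text \<open>
  The loss \<open>p\<^sup>l\<^sup>-\<^sup>e\<close> is the fraction \<open>p\<^sup>-\<^sup>e\<close> of the exponent \<open>p\<^sup>l\<close> of the root, hence arbitrarily small.
\<close>

lemma z_power_ipow: "\<exists>l\<ge>e. \<forall>n. z l ^ n \<in> ipow {U l, V l} (n - p ^ (l - e))"
proof -
  \<comment> \<open>With k = a the tail is a multiple of \<open>\<pi> e ^ a = U e\<close> and so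
    lies in the ideal.\<close>
  obtain \<zeta> j A B where \<zeta>: "\<zeta> \<in> T"
    and A: "A \<in> ipow {z (e + j), U (e + j), V (e + j)} (p ^ j)" and B: "B \<in> T"
    and ze: "z e = \<zeta> * (U e + V e) + \<pi> e * A + U e * B"
    using root_approximation[of e a] by blast
  define l Q where "l = e + j" and "Q = p ^ j"
  define G where "G = {U l, V l}"
  have Q0: "Q > 0" using p_pos by (simp add: Q_def)
  have GT: "G \<subseteq> T" by (auto simp: G_def)
  obtain c where c: "\<forall>i\<le>Q. c i \<in> ipow G (Q - i)" "A = (\<Sum>i\<le>Q. c i * z l ^ i)"
    using ipow_insert[of A "z l" G Q] A by (auto simp: l_def Q_def G_def)
  \<comment> \<open>K consists of the lower-order parts of equations of integral dependence of
    degree Q over (U, V). The aim is \<open>z l ^ Q = z e\<close> in K.\<close>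
  define K where "K = {\<Sum>i<Q. d i * z l ^ i | d. \<forall>i<Q. d i \<in> ipow G (Q - i)}"
  have K_add: "x + y \<in> K" if "x \<in> K" "y \<in> K" for x y
  proof -
    from that obtain d d' where "\<forall>i<Q. d i \<in> ipow G (Q - i)" "x = (\<Sum>i<Q. d i * z l ^ i)"
      "\<forall>i<Q. d' i \<in> ipow G (Q - i)" "y = (\<Sum>i<Q. d' i * z l ^ i)" by (auto simp: K_def)
    then have "\<forall>i<Q. d i + d' i \<in> ipow G (Q - i)" "x + y = (\<Sum>i<Q. (d i + d' i) * z l ^ i)"
      by (auto intro: ipow_intros simp: sum.distrib distrib_right)
    then show ?thesis unfolding K_def by (intro CollectI exI conjI)
  qed
  have K_smult: "t * x \<in> K" if "x \<in> K" "t \<in> T" for x t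
  proof -
    from that obtain d where "\<forall>i<Q. d i \<in> ipow G (Q - i)" "x = (\<Sum>i<Q. d i * z l ^ i)"
      by (auto simp: K_def)
    then have "\<forall>i<Q. t * d i \<in> ipow G (Q - i)" "t * x = (\<Sum>i<Q. (t * d i) * z l ^ i)"
      using that by (auto intro: ipow_smult simp: sum_distrib_left mult.assoc)
    then show ?thesis unfolding K_def by (intro CollectI exI conjI)
  qed
  have K_ipow: "x \<in> K" if "x \<in> ipow G Q" for x
  proof -
    have "(\<Sum>i<Q. (if i = 0 then x else 0) * z l ^ i) = (\<Sum>i<Q. if i = 0 then x else 0)"
      by (rule sum.cong) auto
    then have "(\<Sum>i<Q. (if i = 0 then x else 0) * z l ^ i) = x"
      using Q0 by simp
    then show ?thesis using that unfolding K_def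
      by (intro CollectI exI[of _ "\<lambda>i. if i = 0 then x else 0"]) (auto intro: ipow_zero)
  qed
  have ple: "\<pi> l ^ Q = \<pi> e" "\<xi> l ^ Q = \<xi> e" "z l ^ Q = z e"
    using \<pi>_power[of e l] \<xi>_power[of e l] z_power[of e l] by (simp_all add: l_def Q_def)
  have UV: "U e \<in> ipow G Q" "V e \<in> ipow G Q"
    using ipow_power[OF ipow_1[of "U l" G], of Q] ipow_power[OF ipow_1[of "V l" G], of Q]
    by (simp_all add: G_def flip: ple) (simp_all add: power_mult[symmetric] mult.commute)
  have UK: "U e * t \<in> K" "V e * t \<in> K" if "t \<in> T" for t
    using K_smult[OF K_ipow[OF UV(1)] that] K_smult[OF K_ipow[OF UV(2)] that]
    by (simp_all add: mult.commute)
  have cQ: "c Q \<in> T" using c ipow_mem[OF _ GT] by auto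
  have "(\<Sum>i<Q. c i * z l ^ i) \<in> K" using c unfolding K_def by auto
  moreover have "z e = (\<zeta> * (U e + V e) + \<pi> e * (\<Sum>i<Q. c i * z l ^ i) + U e * B)
      + (\<pi> e * c Q) * z e"
  proof -
    have "(\<Sum>i\<le>Q. c i * z l ^ i) = (\<Sum>i<Q. c i * z l ^ i) + c Q * z e"
      by (simp add: lessThan_Suc_atMost[symmetric] ple)
    then show ?thesis by (subst ze, subst c(2)) (simp add: algebra_simps)
  qed
  moreover define \<kappa> where "\<kappa> = \<zeta> * (U e + V e) + \<pi> e * (\<Sum>i<Q. c i * z l ^ i) + U e * B"
  ultimately have \<kappa>: "\<kappa> \<in> K" "z e = \<kappa> + (\<pi> e * c Q) * z e"
    unfolding \<kappa>_def
    by (auto intro!: K_add UK B K_smult[OF K_ipow[OF ipow_add[OF UV]] \<zeta>] intro: K_smult)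
  \<comment> \<open>The top term of A has a coefficient of degree 0, which leaves the summand
    \<open>(\<pi> e * c Q) * z e\<close>. Substituting the equation into itself raises its factor to
    powers; the a-th power contains \<open>\<pi> e ^ a = U e\<close>, and then the summand lies in
    K.\<close>
  have "\<exists>k\<in>K. z e = k + (\<pi> e * c Q) ^ n * z e" for n
  proof (induction n)
    case 0
    show ?case by (intro bexI[of _ 0]) (auto intro: K_ipow ipow_zero)
  next
    case (Suc n)
    then obtain k where k: "k \<in> K" "z e = k + (\<pi> e * c Q) ^ n * z e" by blast
    have "z e = (k + (\<pi> e * c Q) ^ n * \<kappa>) + (\<pi> e * c Q) ^ Suc n * z e"
      by (subst k(2), subst \<kappa>(2)) (simp add: algebra_simps)
    moreover have "k + (\<pi> e * c Q) ^ n * \<kappa> \<in> K"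
      using k \<kappa> cQ by (intro K_add K_smult) auto
    ultimately show ?case by blast
  qed
  then obtain k where k: "k \<in> K" "z e = k + (\<pi> e * c Q) ^ a * z e" by blast
  have "(\<pi> e * c Q) ^ a * z e \<in> K"
    using UK(1)[OF mult_mem[OF power_mem[OF cQ, of a] T_roots(3)[of e]]]
    by (simp add: power_mult_distrib mult.assoc)
  then have "z e \<in> K" using k K_add by metis
  then obtain d where d: "\<forall>i<Q. d i \<in> ipow G (Q - i)" "z l ^ Q = (\<Sum>i<Q. d i * z l ^ i)"
    unfolding K_def ple(3) by auto
  \<comment> \<open>Expanding one factor z^Q trades Q - i powers of z for degree Q - i in the ideal,
    so only a remainder of fewer than Q powers is lost.\<close>
  have "z l ^ n \<in> ipow G (n - (Q - 1))" for n
  proof (induction n rule: less_induct)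
    case (less n)
    show ?case
    proof (cases "n < Q")
      case True
      then show ?thesis by (auto intro: ipow_base)
    next
      case False
      then have "z l ^ n = z l ^ (n - Q) * z l ^ Q" by (simp flip: power_add)
      also have "\<dots> = (\<Sum>i<Q. d i * z l ^ (n - Q + i))"
        unfolding d(2) sum_distrib_left by (simp add: power_add mult_ac)
      also have "\<dots> \<in> ipow G (n - (Q - 1))"
      proof (rule ipow_sum)
        fix i assume i: "i \<in> {..<Q}"
        then have "z l ^ (n - Q + i) \<in> ipow G (n - Q + i - (Q - 1))"
          using False by (intro less) auto
        then have "d i * z l ^ (n - Q + i) \<in> ipow G (Q - i + (n - Q + i - (Q - 1)))"
          using d(1) i by (intro ipow_mult) auto
        then show "d i * z l ^ (n - Q + i) \<in> ipow G (n - (Q - 1))"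
          by (rule ipow_dec[OF _ GT]) (use i False in auto)
      qed
      finally show ?thesis .
    qed
  qed
  then have "z l ^ n \<in> ipow G (n - Q)" for n
    by (rule ipow_dec[OF _ GT]) auto
  then show ?thesis by (intro exI[of _ l]) (auto simp: G_def l_def Q_def)
qed

text \<open>The weights are chosen such that \<open>U l\<close> and \<open>V l\<close> both have weight \<open>a b\<close>.\<close>

inductive_set wideal :: "nat \<Rightarrow> nat \<Rightarrow> 'a set" for l w where
  wideal_monom: "t \<in> T \<Longrightarrow> w \<le> b * i + a * h \<Longrightarrow> t * (\<pi> l ^ i * \<xi> l ^ h) \<in> wideal l w"
| wideal_zero: "0 \<in> wideal l w"
| wideal_add: "x \<in> wideal l w \<Longrightarrow> y \<in> wideal l w \<Longrightarrow> x + y \<in> wideal l w"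

lemma wideal_sum: "(\<And>i. i \<in> I \<Longrightarrow> f i \<in> wideal l w) \<Longrightarrow> sum f I \<in> wideal l w"
  by (induction I rule: infinite_finite_induct) (auto intro: wideal.intros)

lemma wideal_mono: "x \<in> wideal l w \<Longrightarrow> w' \<le> w \<Longrightarrow> x \<in> wideal l w'"
  by (induction rule: wideal.induct) (auto intro: wideal.intros order_trans)

lemma wideal_mult:
  assumes "x \<in> wideal l w" "y \<in> wideal l w'"
  shows "x * y \<in> wideal l (w + w')"
  using assms(1)
proof (induction rule: wideal.induct)
  case (wideal_monom t i h)
  from assms(2) show ?case
  proof (induction rule: wideal.induct)
    case (wideal_monom t' i' h')
    have "(t * t') * (\<pi> l ^ (i + i') * \<xi> l ^ (h + h')) \<in> wideal l (w + w')"
      using wideal_monom \<open>t \<in> T\<close> \<open>w \<le> _\<close>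
      by (intro wideal.wideal_monom) (auto simp: distrib_left)
    then show ?case by (simp add: power_add mult_ac)
  qed (auto intro: wideal.intros simp: distrib_left)
qed (auto intro: wideal.intros simp: distrib_right)

lemma wideal_smult: "x \<in> wideal l w \<Longrightarrow> t \<in> T \<Longrightarrow> t * x \<in> wideal l w"
  using wideal_mult[of t l 0 x w] wideal_monom[of t 0 0 0 l] by simp

lemma wideal_power: "x \<in> wideal l w \<Longrightarrow> x ^ n \<in> wideal l (w * n)"
proof (induction n)
  case 0
  then show ?case using wideal_monom[of 1 0 0 0 l] by simp
qed (use wideal_mult in auto)

lemma wideal_raise: "x \<in> wideal l w \<Longrightarrow> l \<le> m \<Longrightarrow> x \<in> wideal m (p ^ (m - l) * w)"
proof (induction rule: wideal.induct)
  case (wideal_monom t i h)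
  let ?s = "p ^ (m - l)"
  have "t * (\<pi> m ^ (?s * i) * \<xi> m ^ (?s * h)) \<in> wideal m (?s * w)"
  proof (rule wideal.wideal_monom)
    have "?s * w \<le> ?s * (b * i + a * h)" using wideal_monom by (intro mult_left_mono) auto
    then show "?s * w \<le> b * (?s * i) + a * (?s * h)" by (simp add: algebra_simps)
  qed (use wideal_monom in auto)
  then show ?case using wideal_monom \<pi>_power[of l m] \<xi>_power[of l m] by (simp add: power_mult)
qed (auto intro: wideal.intros)

lemma UV_wideal: "U l \<in> wideal l (a * b)" "V l \<in> wideal l (a * b)" "\<pi> l \<in> wideal l b"
  using wideal_monom[of 1 "a * b" a 0 l] wideal_monom[of 1 "a * b" 0 b l]
    wideal_monom[of 1 b 1 0 l] by auto

lemma ipow_wideal: "x \<in> ipow {U l, V l} d \<Longrightarrow> x \<in> wideal l (a * b * d)"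
proof (induction rule: ipow_induct)
  case (base t)
  then show ?case using wideal_monom[of t 0 0 0 l] by simp
next
  case (gen x y d)
  then show ?case using wideal_mult[of x l "a * b" y "a * b * d"] UV_wideal by auto
qed (auto intro: wideal.intros)

text \<open>Since \<open>z l\<close> is a power of \<open>z m\<close>, the loss p^(m - e) at the one
  level m covers all l and i. Later a single m has to serve every power of z that occurs in
  A.\<close>

lemma z_power_wideal:
  "\<exists>m\<ge>e. \<forall>l\<le>m. \<forall>i. z l ^ i \<in> wideal m (a * b * (i * p ^ (m - l) - p ^ (m - e)))"
proof -
  obtain m where m: "m \<ge> e" "\<And>n. z m ^ n \<in> ipow {U m, V m} (n - p ^ (m - e))"
    using z_power_ipow[of e] by auto
  have "z l ^ i \<in> wideal m (a * b * (i * p ^ (m - l) - p ^ (m - e)))" if "l \<le> m" for l i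
    using ipow_wideal[OF m(2)[of "i * p ^ (m - l)"]] z_power[OF that]
    by (simp add: mult.commute[of i] power_mult)
  then show ?thesis using m(1) by blast
qed

section \<open>The ideal (p, x) T and high powers of z inside it\<close>

definition param_ideal :: "'a set" where
  "param_ideal = {\<pi> 0 * A + \<xi> 0 * B | A B. A \<in> T \<and> B \<in> T}"

lemma param_ideal_add: "x \<in> param_ideal \<Longrightarrow> y \<in> param_ideal \<Longrightarrow> x + y \<in> param_ideal"
proof -
  assume "x \<in> param_ideal" "y \<in> param_ideal"
  then obtain A B A' B' where "A \<in> T" "B \<in> T" "A' \<in> T" "B' \<in> T"
    "x = \<pi> 0 * A + \<xi> 0 * B" "y = \<pi> 0 * A' + \<xi> 0 * B'" by (auto simp: param_ideal_def)
  then have "x + y = \<pi> 0 * (A + A') + \<xi> 0 * (B + B')" "A + A' \<in> T" "B + B' \<in> T"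
    by (auto simp: algebra_simps)
  then show ?thesis unfolding param_ideal_def by blast
qed

lemma param_ideal_smult: "x \<in> param_ideal \<Longrightarrow> t \<in> T \<Longrightarrow> t * x \<in> param_ideal"
proof -
  assume "x \<in> param_ideal" "t \<in> T"
  then obtain A B where "A \<in> T" "B \<in> T" "x = \<pi> 0 * A + \<xi> 0 * B" by (auto simp: param_ideal_def)
  then have "t * x = \<pi> 0 * (t * A) + \<xi> 0 * (t * B)" "t * A \<in> T" "t * B \<in> T"
    using \<open>t \<in> T\<close> by (auto simp: algebra_simps)
  then show ?thesis unfolding param_ideal_def by blast
qed

lemma param_ideal_gens: "t \<in> T \<Longrightarrow> \<pi> 0 * t \<in> param_ideal" "t \<in> T \<Longrightarrow> \<xi> 0 * t \<in> param_ideal"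
proof -
  assume t: "t \<in> T"
  have "\<pi> 0 * t = \<pi> 0 * t + \<xi> 0 * 0" "\<xi> 0 * t = \<pi> 0 * 0 + \<xi> 0 * t" by simp_all
  then show "\<pi> 0 * t \<in> param_ideal" "\<xi> 0 * t \<in> param_ideal"
    unfolding param_ideal_def using t zero_mem by blast+
qed

lemma param_ideal_zero: "0 \<in> param_ideal"
  using param_ideal_gens(1)[of 0] by simp

lemma param_ideal_uminus: "x \<in> param_ideal \<Longrightarrow> - x \<in> param_ideal"
  using param_ideal_smult[of x "-1"] by auto

lemma param_ideal_diff: "x \<in> param_ideal \<Longrightarrow> y \<in> param_ideal \<Longrightarrow> x - y \<in> param_ideal"
  using param_ideal_add[of x "- y"] param_ideal_uminus[of y] by simp

lemma param_ideal_sum: "(\<And>i. i \<in> I \<Longrightarrow> f i \<in> param_ideal) \<Longrightarrow> sum f I \<in> param_ideal"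
  by (induction I rule: infinite_finite_induct) (auto intro: param_ideal_zero param_ideal_add)

lemma monom_param_ideal:
  assumes "p ^ l \<le> i \<or> p ^ l \<le> h" "t \<in> T"
  shows "t * (\<pi> l ^ i * \<xi> l ^ h) \<in> param_ideal"
proof -
  have *: "\<pi> l ^ i = \<pi> 0 * \<pi> l ^ (i - p ^ l)" if "p ^ l \<le> i"
    using power_add[of "\<pi> l" "p ^ l" "i - p ^ l"] that \<pi>_power[of 0 l] by simp
  have **: "\<xi> l ^ h = \<xi> 0 * \<xi> l ^ (h - p ^ l)" if "p ^ l \<le> h"
    using power_add[of "\<xi> l" "p ^ l" "h - p ^ l"] that \<xi>_power[of 0 l] by simp
  from assms(1) show ?thesis
  proof
    assume "p ^ l \<le> i"
    then have "t * (\<pi> l ^ i * \<xi> l ^ h) = \<pi> 0 * (t * (\<pi> l ^ (i - p ^ l) * \<xi> l ^ h))"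
      by (simp add: * mult_ac)
    then show ?thesis using param_ideal_gens(1) assms(2) by (metis T_roots mult_mem power_mem)
  next
    assume "p ^ l \<le> h"
    then have "t * (\<pi> l ^ i * \<xi> l ^ h) = \<xi> 0 * (t * (\<pi> l ^ i * \<xi> l ^ (h - p ^ l)))"
      by (simp add: ** mult_ac)
    then show ?thesis using param_ideal_gens(2) assms(2) by (metis T_roots mult_mem power_mem)
  qed
qed

text \<open>A monomial with some exponent at least p^l lies in (p, x); the others have weight at
  most (a + b)(p^l - 1).\<close>

lemma wideal_param_ideal:
  assumes "x \<in> wideal l w" "(a + b) * (p ^ l - 1) < w"
  shows "x \<in> param_ideal"
  using assms(1)
proof (induction rule: wideal.induct)
  case (wideal_monom t i h)
  have "p ^ l \<le> i \<or> p ^ l \<le> h"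
  proof (rule ccontr)
    assume "\<not> ?thesis"
    then have "i \<le> p ^ l - 1" "h \<le> p ^ l - 1" by auto
    then have "b * i + a * h \<le> b * (p ^ l - 1) + a * (p ^ l - 1)"
      by (intro add_mono mult_left_mono) auto
    also have "\<dots> = (a + b) * (p ^ l - 1)" by (simp only: add_mult_distrib add.commute)
    finally show False using wideal_monom assms(2) by linarith
  qed
  then show ?case using wideal_monom by (intro monom_param_ideal)
qed (auto intro: param_ideal_zero param_ideal_add)

text \<open>Divided by a b p^e, the second hypothesis reads k/p^s - 1/p^e >= 1/a + 1/b, where 1/p^e
  is the loss from \<open>z_power_wideal\<close>. The strict inequality needed at level m comes from
  p^m - 1 < p^m.\<close>

lemma z_power_param_ideal:
  assumes "s \<le> e" "(a + b) * p ^ e \<le> a * b * (k * p ^ (e - s) - 1)"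
  shows "z s ^ k \<in> param_ideal"
proof -
  obtain m where m: "m \<ge> e"
    "\<And>l i. l \<le> m \<Longrightarrow> z l ^ i \<in> wideal m (a * b * (i * p ^ (m - l) - p ^ (m - e)))"
    using z_power_wideal[of e] by blast
  have "p ^ (m - s) = p ^ (m - e) * p ^ (e - s)" "p ^ m = p ^ (m - e) * p ^ e"
    using m(1) assms(1) by (simp_all flip: power_add)
  then have eq: "a * b * (k * p ^ (m - s) - p ^ (m - e)) = p ^ (m - e) * (a * b * (k * p ^ (e - s) - 1))"
    and "p ^ (m - e) * ((a + b) * p ^ e) = (a + b) * p ^ m"
    by (simp_all add: algebra_simps diff_mult_distrib2)
  moreover have "p ^ (m - e) * ((a + b) * p ^ e) \<le> p ^ (m - e) * (a * b * (k * p ^ (e - s) - 1))"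
    using assms(2) by (intro mult_left_mono) auto
  moreover have "(a + b) * (p ^ m - 1) < (a + b) * p ^ m"
    using a p_pos by (intro mult_strict_left_mono) auto
  ultimately have "(a + b) * (p ^ m - 1) < a * b * (k * p ^ (m - s) - p ^ (m - e))"
    by linarith
  then show ?thesis using wideal_param_ideal[OF m(2)[of s k]] m(1) assms(1) by auto
qed

end

section \<open>Powers of z outside (p, x) T\<close>

text \<open>\<open>regular\<close> is the regular-sequence condition: for t = B/p it says that x B
  in p T implies B in p T.\<close>

locale regular_diagonal_roots = diagonal_roots T p \<pi> \<xi> z a b
  for T :: "'a::alg_closed_field set" and p \<pi> \<xi> z a b +
  assumes regular: "\<pi> 0 * t \<in> T \<Longrightarrow> \<xi> 0 * t \<in> T \<Longrightarrow> t \<in> T"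
    and proper: "1 \<notin> param_ideal"
begin

text \<open>Regularity permits cancelling \<open>\<pi> l ^ (p ^ l - 1)\<close> and then
  \<open>\<xi> l ^ (p ^ l - 1)\<close> from a relation. This would leave 1 in the ideal generated by
  \<open>\<pi> l\<close> and \<open>\<xi> l\<close>, and a high power of that ideal is inside (p,
  x).\<close>

lemma socle_notin_param_ideal: "\<pi> l ^ (p ^ l - 1) * \<xi> l ^ (p ^ l - 1) \<notin> param_ideal"
proof
  assume *: "\<pi> l ^ (p ^ l - 1) * \<xi> l ^ (p ^ l - 1) \<in> param_ideal"
  define P where "P = p ^ l"
  obtain m where m: "P = Suc m" using p_pos by (metis P_def gr0_implies_Suc zero_less_power)
  have P: "\<pi> l ^ P = \<pi> 0" "\<xi> l ^ P = \<xi> 0"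
    using \<pi>_power[of 0 l] \<xi>_power[of 0 l] by (simp_all add: P_def)
  have nz: "\<pi> l \<noteq> 0" "\<xi> l \<noteq> 0" using P \<pi>(2) p_nz \<xi>_nz m by auto
  from * obtain A B where AB: "A \<in> T" "B \<in> T"
    "\<pi> l ^ m * \<xi> l ^ m = \<pi> 0 * A + \<xi> 0 * B"
    by (auto simp: param_ideal_def m simp flip: P_def)
  \<comment> \<open>Here \<open>\<pi> 0 * t = \<pi> l * B\<close>, and the cancelled relation
    expresses \<open>\<xi> 0 * t\<close> through A. Both lie in T, hence so does t.\<close>
  define t where "t = B / \<pi> l ^ m"
  have B: "B = \<pi> l ^ m * t" using nz by (simp add: t_def)
  have "\<pi> l ^ m * (\<xi> l ^ m) = \<pi> l ^ m * (\<pi> l * A + \<xi> 0 * t)"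
    using AB(3) unfolding B P(1)[symmetric] m by (simp add: algebra_simps)
  then have t: "\<xi> l ^ m = \<pi> l * A + \<xi> 0 * t" using nz by simp
  have "\<pi> 0 * t = \<pi> l * B" unfolding B P(1)[symmetric] m by simp
  moreover have "\<xi> 0 * t = \<xi> l ^ m - \<pi> l * A" using t by simp
  ultimately have tT: "t \<in> T" using AB by (metis (full_types) diff_mem mult_mem T_roots one_mem power_mem regular)
  define u where "u = A / \<xi> l ^ m"
  have A: "A = \<xi> l ^ m * u" using nz by (simp add: u_def)
  have "\<xi> l ^ m * 1 = \<xi> l ^ m * (\<pi> l * u + \<xi> l * t)"
    using t unfolding A P(2)[symmetric] m by (simp add: algebra_simps)
  then have u: "1 = \<pi> l * u + \<xi> l * t" using nz by simp
  have "\<xi> 0 * u = \<xi> l * A" unfolding A P(2)[symmetric] m by simp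
  moreover have "\<pi> 0 * u = \<pi> l ^ m * (\<pi> l * u)"
    unfolding P(1)[symmetric] m by (simp add: mult_ac)
  moreover have "\<pi> l * u = 1 - \<xi> l * t" using u by (simp add: eq_diff_eq)
  ultimately have uT: "u \<in> T" using AB tT by (metis (full_types) diff_mem mult_mem T_roots one_mem power_mem regular)
  \<comment> \<open>In the expansion of a 2P-th power each term has one of its exponents at least
    P.\<close>
  have "1 = (\<pi> l * u + \<xi> l * t) ^ (2 * P)" using u by simp
  also have "\<dots> = (\<Sum>k\<le>2 * P. of_nat ((2 * P) choose k) * (\<pi> l * u) ^ k * (\<xi> l * t) ^ (2 * P - k))"
    by (rule binomial_ring)
  also have "\<dots> \<in> param_ideal"
  proof (rule param_ideal_sum)
    fix k
    let ?c = "of_nat ((2 * P) choose k) * (u ^ k * t ^ (2 * P - k))"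
    have "?c * (\<pi> l ^ k * \<xi> l ^ (2 * P - k)) \<in> param_ideal"
      using uT tT by (intro monom_param_ideal) (auto simp flip: P_def)
    then show "of_nat ((2 * P) choose k) * (\<pi> l * u) ^ k * (\<xi> l * t) ^ (2 * P - k) \<in> param_ideal"
      by (simp add: power_mult_distrib mult_ac)
  qed
  finally show False using proper by simp
qed

text \<open>Compared with U e + V e, the term \<open>\<pi> e * A\<close> has the extra factor
  \<open>\<pi> e\<close> of weight b. Removing z from A by \<open>z_power_wideal\<close>, taken s
  levels below the level of A, costs the fraction p^-s of the weight ab.\<close>

lemma root_approximation_wideal:
  assumes "a < s"
  shows "\<exists>\<zeta> m. e + s \<le> m \<and> \<zeta> ^ (2 * p ^ e) = 1 \<and> \<zeta> \<in> T \<and>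
    z e - \<zeta> * (U e + V e) \<in> wideal m ((a * b + b) * p ^ (m - e) - a * b * p ^ (m - e - s))"
proof -
  \<comment> \<open>With k = a + 1 the tail has weight (a + 1) b = ab + b, no less than the error
    term proper.\<close>
  obtain \<zeta> j A B where \<zeta>: "\<zeta> ^ (2 * p ^ e) = 1" "\<zeta> \<in> T"
    and A: "A \<in> ipow {z (e + j), U (e + j), V (e + j)} (p ^ j)" and B: "B \<in> T"
    and ze: "z e = \<zeta> * (U e + V e) + \<pi> e * A + \<pi> e ^ Suc a * B"
    using root_approximation[of e "Suc a"] by blast
  define l where "l = e + j"
  obtain c where c: "\<forall>i\<le>p ^ j. c i \<in> ipow {U l, V l} (p ^ j - i)" "A = (\<Sum>i\<le>p ^ j. c i * z l ^ i)"
    using ipow_insert[OF A] by (auto simp: l_def)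
  obtain m where m: "m \<ge> l + s"
    "\<And>k i. k \<le> m \<Longrightarrow> z k ^ i \<in> wideal m (a * b * (i * p ^ (m - k) - p ^ (m - (l + s))))"
    using z_power_wideal[of "l + s"] by blast
  have lm: "l \<le> m" "e \<le> m" "e + s \<le> m" using m(1) by (auto simp: l_def)
  define w0 \<delta> where "w0 = p ^ (m - e)" and "\<delta> = p ^ (m - (l + s))"
  have w0: "w0 = p ^ j * p ^ (m - l)" using lm by (simp add: w0_def l_def flip: power_add)
  have \<delta>: "\<delta> \<le> p ^ (m - e - s)" unfolding \<delta>_def using p_pos
    by (intro power_increasing) (auto simp: l_def)
  have "A \<in> wideal m (a * b * (w0 - \<delta>))"
    unfolding c(2)
  proof (rule wideal_sum)
    fix i assume i: "i \<in> {..p ^ j}"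
    then have "c i \<in> wideal l (a * b * (p ^ j - i))" using c(1) by (intro ipow_wideal) auto
    from wideal_mult[OF wideal_raise[OF this lm(1)] m(2)[OF lm(1), of i]]
    have "c i * z l ^ i
        \<in> wideal m (p ^ (m - l) * (a * b * (p ^ j - i)) + a * b * (i * p ^ (m - l) - \<delta>))"
      by (simp add: \<delta>_def)
    moreover have "a * b * (w0 - \<delta>)
        \<le> a * b * (p ^ (m - l) * (p ^ j - i) + (i * p ^ (m - l) - \<delta>))"
    proof (intro mult_left_mono)
      have "w0 = p ^ (m - l) * (p ^ j - i) + i * p ^ (m - l)"
        using i by (simp add: w0 mult.commute[of "p ^ (m - l)"] flip: add_mult_distrib)
      then show "w0 - \<delta> \<le> p ^ (m - l) * (p ^ j - i) + (i * p ^ (m - l) - \<delta>)" by linarith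
    qed auto
    ultimately show "c i * z l ^ i \<in> wideal m (a * b * (w0 - \<delta>))"
      by (elim wideal_mono) (simp add: algebra_simps)
  qed
  moreover have \<pi>e: "\<pi> e \<in> wideal m (w0 * b)"
    using wideal_raise[OF UV_wideal(3) lm(2)] by (simp add: w0_def)
  ultimately have 1: "\<pi> e * A \<in> wideal m (w0 * b + a * b * (w0 - \<delta>))"
    by (intro wideal_mult)
  have 2: "B * \<pi> e ^ Suc a \<in> wideal m (w0 * b * Suc a)"
    using wideal_power[OF \<pi>e, of "Suc a"] B by (rule wideal_smult)
  define W where "W = (a * b + b) * w0 - a * b * p ^ (m - e - s)"
  have "a * b * w0 - a * b * p ^ (m - e - s) \<le> a * b * (w0 - \<delta>)"
    unfolding diff_mult_distrib2[symmetric] using \<delta> by (intro mult_left_mono) auto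
  then have "W \<le> w0 * b + a * b * (w0 - \<delta>)"
    unfolding W_def add_mult_distrib by (simp add: mult.commute[of w0])
  moreover have "W \<le> w0 * b * Suc a" unfolding W_def by (simp add: algebra_simps)
  ultimately have "\<pi> e * A + B * \<pi> e ^ Suc a \<in> wideal m W"
    using 1 2 by (intro wideal_add) (auto elim: wideal_mono)
  moreover have "z e - \<zeta> * (U e + V e) = \<pi> e * A + B * \<pi> e ^ Suc a"
    using ze by (simp add: mult.commute[of B])
  ultimately have "z e - \<zeta> * (U e + V e) \<in> wideal m W" by (simp only:)
  with lm \<zeta> show ?thesis unfolding W_def w0_def by blast
qed

text \<open>Multiplication by a monomial \<mu> moves the i-th term of (U + V)^N onto the socle
  monomial, which is outside (p, x). Every other term then has an exponent that is too large, and
  the approximation error has too much weight, so only the i-th term survives modulo (p, x).\<close>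

lemma z_power_notin_param_ideal:
  assumes N: "\<not> p dvd N choose i" and i: "i \<le> N" "a * i < p ^ e" "b * (N - i) < p ^ e"
  shows "z e ^ N \<notin> param_ideal"
proof
  assume zN: "z e ^ N \<in> param_ideal"
  obtain \<zeta> m where m: "e + Suc a \<le> m" and \<zeta>: "\<zeta> ^ (2 * p ^ e) = 1" "\<zeta> \<in> T"
    and h: "z e - \<zeta> * (U e + V e)
      \<in> wideal m ((a * b + b) * p ^ (m - e) - a * b * p ^ (m - e - Suc a))"
    using root_approximation_wideal[of "Suc a" e] by blast
  define w0 P W g where "w0 = p ^ (m - e)" and "P = p ^ m"
    and "W = (a * b + b) * p ^ (m - e) - a * b * p ^ (m - e - Suc a)" and "g = \<zeta> * (U e + V e)"
  have Pw: "P = w0 * p ^ e" using m by (simp add: P_def w0_def flip: power_add)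
  have w0_pos: "w0 > 0" using p_pos by (simp add: w0_def)
  \<comment> \<open>The loss is smaller than the gain because a < p^(a + 1); this is the reason for
    s = a + 1.\<close>
  have small: "a * p ^ (m - e - Suc a) < w0"
  proof -
    have "p \<ge> 2" using p_prime by (rule prime_ge_2_nat)
    then have "a < p ^ Suc a"
      by (metis Suc_lessD less_exp order_less_le_trans power_mono zero_le)
    then have "a * p ^ (m - e - Suc a) < p ^ Suc a * p ^ (m - e - Suc a)"
      using p_pos by simp
    also have "\<dots> = p ^ (Suc a + (m - e - Suc a))" by (simp only: power_add)
    also have "\<dots> = w0" using m unfolding w0_def by (intro arg_cong[of _ _ "power p"]) simp
    finally show ?thesis .
  qed
  have W: "a * b * w0 < W"
  proof -
    have "a * b * p ^ (m - e - Suc a) < b * w0"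
      using mult_strict_left_mono[OF small b] by (simp only: mult_ac)
    then show ?thesis unfolding W_def w0_def[symmetric] add_mult_distrib by linarith
  qed
  have em: "e \<le> m" using m by simp
  have UVm: "U e \<in> wideal m (a * b * w0)" "V e \<in> wideal m (a * b * w0)"
    using wideal_raise[OF UV_wideal(1) em] wideal_raise[OF UV_wideal(2) em]
    by (simp_all add: w0_def mult.commute)
  have gm: "g \<in> wideal m (a * b * w0)"
    unfolding g_def using UVm \<zeta> by (intro wideal_smult wideal_add)
  have hm: "z e - g \<in> wideal m W" using h unfolding W_def g_def .
  have "z e = g + (z e - g)" by simp
  then have zm: "z e \<in> wideal m (a * b * w0)"
    using wideal_add[OF gm wideal_mono[OF hm less_imp_le[OF W]]] by simp
  \<comment> \<open>These exponents carry the i-th term exactly to P - 1 in both roots; the bounds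
    on a i and b (N - i) keep the natural subtractions exact.\<close>
  define c d where "c = P - 1 - a * i * w0" and "d = P - 1 - b * (N - i) * w0"
  have "a * i * w0 \<le> P - 1" "b * (N - i) * w0 \<le> P - 1"
  proof -
    have "Suc (a * i) * w0 \<le> p ^ e * w0" "Suc (b * (N - i)) * w0 \<le> p ^ e * w0"
      using i by (intro mult_right_mono; simp)+
    then show "a * i * w0 \<le> P - 1" "b * (N - i) * w0 \<le> P - 1"
      using w0_pos unfolding Pw by (simp_all add: mult.commute)
  qed
  then have c: "c + a * i * w0 = P - 1" and d: "d + b * (N - i) * w0 = P - 1"
    by (simp_all add: c_def d_def)
  define \<mu> where "\<mu> = \<pi> m ^ c * \<xi> m ^ d"
  have \<mu>T: "\<mu> \<in> T" by (auto simp: \<mu>_def)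
  have \<mu>w: "\<mu> \<in> wideal m (b * c + a * d)"
    using wideal_monom[of 1 "b * c + a * d" c d m] by (simp add: \<mu>_def)
  \<comment> \<open>In the telescoping factorization one factor has weight W > a b w0 and the other
    N - 1 have weight a b w0. Since \<mu> together with N factors of weight a b w0 weighs exactly (a
    + b)(P - 1), the excess forces membership.\<close>
  have H: "\<mu> * (z e ^ N - g ^ N) \<in> param_ideal"
  proof (cases N)
    case 0
    then show ?thesis by (simp add: param_ideal_zero)
  next
    case (Suc n)
    have "(\<Sum>k<N. g ^ (N - Suc k) * z e ^ k) \<in> wideal m (a * b * w0 * n)"
    proof (rule wideal_sum)
      fix k assume "k \<in> {..<N}"
      then have "a * b * w0 * n = a * b * w0 * (N - Suc k) + a * b * w0 * k"
        using Suc by (simp flip: distrib_left)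
      then show "g ^ (N - Suc k) * z e ^ k \<in> wideal m (a * b * w0 * n)"
        using wideal_mult[OF wideal_power[OF gm] wideal_power[OF zm]] by simp
    qed
    from wideal_mult[OF \<mu>w wideal_mult[OF hm this]]
    have "\<mu> * (z e ^ N - g ^ N) \<in> wideal m (b * c + a * d + (W + a * b * w0 * n))"
      by (simp add: power_diff_sumr2)
    then show ?thesis unfolding P_def[symmetric]
    proof (rule wideal_param_ideal)
      have "(a + b) * (P - 1) = b * (c + a * i * w0) + a * (d + b * (N - i) * w0)"
        unfolding c d by (simp add: add_mult_distrib)
      also have "\<dots> = b * c + a * d + a * b * w0 * (i + (N - i))"
        by (simp add: algebra_simps)
      also have "\<dots> = b * c + a * d + (a * b * w0 + a * b * w0 * n)"
        using i(1) Suc by simp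
      also have "\<dots> < b * c + a * d + (W + a * b * w0 * n)" using W by simp
      finally show "(a + b) * (p ^ m - 1) < b * c + a * d + (W + a * b * w0 * n)"
        unfolding P_def .
    qed
  qed
  have "\<mu> * z e ^ N \<in> param_ideal" using zN \<mu>T by (rule param_ideal_smult)
  then have "\<mu> * g ^ N \<in> param_ideal"
    using param_ideal_diff[OF _ H, of "\<mu> * z e ^ N"] by (simp add: algebra_simps)
  moreover have "\<zeta> ^ (2 * p ^ e - 1) * g = U e + V e"
  proof -
    have "\<zeta> ^ (2 * p ^ e - 1) * \<zeta> = 1"
      using \<zeta>(1) p_pos by (metis mult.commute mult_pos_pos pos2 power_minus_mult zero_less_power)
    then show ?thesis by (simp add: g_def mult.assoc[symmetric])
  qed
  then have "\<mu> * (U e + V e) ^ N = (\<zeta> ^ (2 * p ^ e - 1)) ^ N * (\<mu> * g ^ N)"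
    by (metis mult.left_commute power_mult_distrib)
  ultimately have sum: "\<mu> * (U e + V e) ^ N \<in> param_ideal"
    using param_ideal_smult[OF _ power_mem[OF power_mem[OF \<zeta>(2)]]] by metis
  define F where "F k = \<mu> * (of_nat (N choose k) * U e ^ k * V e ^ (N - k))" for k
  have F: "F k = of_nat (N choose k) * (\<pi> m ^ (c + a * k * w0) * \<xi> m ^ (d + b * (N - k) * w0))" for k
    unfolding F_def \<mu>_def \<pi>_power[OF em, symmetric] \<xi>_power[OF em, symmetric] w0_def[symmetric]
    by (simp add: power_add mult_ac flip: power_mult)
  \<comment> \<open>Any other k pushes one of the two exponents beyond P - 1.\<close>
  have Fk: "F k \<in> param_ideal" if k: "k \<noteq> i" "k \<le> N" for k
    unfolding F
  proof (rule monom_param_ideal)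
    consider "i < k" | "k < i" using k by linarith
    then show "p ^ m \<le> c + a * k * w0 \<or> p ^ m \<le> d + b * (N - k) * w0"
    proof cases
      case 1
      then have "a * i * w0 < a * k * w0" using a w0_pos by simp
      then show ?thesis using c unfolding P_def[symmetric] by linarith
    next
      case 2
      then have "N - i < N - k" using k i by linarith
      then have "b * (N - i) * w0 < b * (N - k) * w0" using b w0_pos by simp
      then show ?thesis using d unfolding P_def[symmetric] by linarith
    qed
  qed auto
  have "\<mu> * (U e + V e) ^ N = (\<Sum>k\<le>N. F k)"
    unfolding binomial_ring sum_distrib_left F_def ..
  also have "\<dots> = F i + (\<Sum>k\<in>{..N} - {i}. F k)" using i(1) by (subst sum.remove) auto
  finally have "F i = \<mu> * (U e + V e) ^ N - (\<Sum>k\<in>{..N} - {i}. F k)" by simp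
  then have "F i \<in> param_ideal"
    using sum Fk by (auto intro!: param_ideal_diff param_ideal_sum)
  then have "of_nat (N choose i) * (\<pi> m ^ (P - 1) * \<xi> m ^ (P - 1)) \<in> param_ideal"
    unfolding F c d .
  \<comment> \<open>The binomial coefficient is invertible modulo p, and multiples of p lie in the
    ideal.\<close>
  moreover have "coprime (int (N choose i)) (int p)"
    using N p_prime by (simp add: coprime_commute prime_imp_coprime)
  then obtain u v where "u * int (N choose i) + v * int p = 1"
    by (metis bezout_int coprime_imp_gcd_eq_1)
  then have uv: "of_int u * of_nat (N choose i) + of_int v * of_nat p = (1 :: 'a)"
    by (metis of_int_1 of_int_add of_int_mult of_int_of_nat_eq)
  have "1 * x = of_int u * (of_nat (N choose i) * x) + \<pi> 0 * (of_int v * x)" for x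
    unfolding \<pi>(2) uv[symmetric] distrib_right by (simp only: mult_ac)
  moreover have "\<pi> 0 * (of_int v * (\<pi> m ^ (P - 1) * \<xi> m ^ (P - 1))) \<in> param_ideal"
    by (intro param_ideal_gens(1) mult_mem power_mem T_roots of_int_mem)
  ultimately have "1 * (\<pi> m ^ (P - 1) * \<xi> m ^ (P - 1)) \<in> param_ideal"
    by (simp only: param_ideal_add param_ideal_smult of_int_mem)
  then show False using socle_notin_param_ideal[of m] by (simp add: P_def)
qed

end

section \<open>The absolute integral closure is a ring\<close>

interpretation to_closure_hom: inj_idom_hom "to_closure :: 'a::idom \<Rightarrow> 'a fract alg_closure"
  by unfold_locales (auto simp: to_closure_def)

lemma to_closure_eq_iff [simp]: "to_closure a = to_closure b \<longleftrightarrow> a = b"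
  by (simp add: to_closure_def)

definition closure_span :: "'a::idom fract alg_closure set \<Rightarrow> 'a fract alg_closure set" where
  "closure_span B = {\<Sum>c\<in>B. to_closure (r c) * c | r. True}"

lemma closure_spanI: "(\<Sum>c\<in>B. to_closure (r c) * c) \<in> closure_span B"
  unfolding closure_span_def by auto

lemma closure_span_add: "x \<in> closure_span B \<Longrightarrow> y \<in> closure_span B \<Longrightarrow> x + y \<in> closure_span B"
proof -
  assume "x \<in> closure_span B" "y \<in> closure_span B"
  then obtain r s where "x = (\<Sum>c\<in>B. to_closure (r c) * c)" "y = (\<Sum>c\<in>B. to_closure (s c) * c)"
    by (auto simp: closure_span_def)
  then have "x + y = (\<Sum>c\<in>B. to_closure (r c + s c) * c)"
    by (simp add: sum.distrib distrib_right to_closure_hom.hom_add)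
  then show ?thesis using closure_spanI by metis
qed

lemma closure_span_smult: "x \<in> closure_span B \<Longrightarrow> to_closure a * x \<in> closure_span B"
proof -
  assume "x \<in> closure_span B"
  then obtain r where "x = (\<Sum>c\<in>B. to_closure (r c) * c)" by (auto simp: closure_span_def)
  then have "to_closure a * x = (\<Sum>c\<in>B. to_closure (a * r c) * c)"
    by (simp add: sum_distrib_left mult.assoc to_closure_hom.hom_mult)
  then show ?thesis using closure_spanI by metis
qed

lemma closure_span_zero: "0 \<in> closure_span B"
  using closure_spanI[of "\<lambda>_. 0" B] by (simp add: to_closure_hom.hom_zero)

lemma closure_span_sum: "(\<And>i. i \<in> I \<Longrightarrow> f i \<in> closure_span B) \<Longrightarrow> sum f I \<in> closure_span B"
  by (induction I rule: infinite_finite_induct) (auto intro: closure_span_zero closure_span_add)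

lemma closure_span_base:
  assumes "finite B" "b \<in> B"
  shows "b \<in> closure_span B"
proof -
  let ?r = "\<lambda>c. if c = b then 1 else 0"
  have "(\<Sum>c\<in>B. to_closure (?r c) * c) = to_closure (?r b) * b + (\<Sum>c\<in>B - {b}. to_closure (?r c) * c)"
    using assms by (rule sum.remove)
  also have "(\<Sum>c\<in>B - {b}. to_closure (?r c) * c) = 0"
    by (intro sum.neutral) (simp add: to_closure_hom.hom_zero)
  finally have "(\<Sum>c\<in>B. to_closure (?r c) * c) = b" by (simp add: to_closure_hom.hom_one)
  then show ?thesis using closure_spanI[of ?r B] by simp
qed

lemma closure_span_mult_stable:
  assumes "\<And>b. b \<in> B \<Longrightarrow> s * b \<in> closure_span B" "x \<in> closure_span B"
  shows "s * x \<in> closure_span B"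
proof -
  obtain r where "x = (\<Sum>c\<in>B. to_closure (r c) * c)" using assms(2) by (auto simp: closure_span_def)
  then have "s * x = (\<Sum>c\<in>B. to_closure (r c) * (s * c))"
    by (simp add: sum_distrib_left mult_ac)
  then show ?thesis using assms(1) by (auto intro!: closure_span_sum closure_span_smult)
qed

text \<open>The elements of B form an eigenvector of the coefficient matrix with eigenvalue s,
  nonzero thanks to b0. The matrix is kept explicit because properness of (p, x) T is proved by
  reducing it modulo (p, x).\<close>

lemma char_poly_stable:
  fixes s :: "'a::idom fract alg_closure"
  assumes B: "finite B" "b0 \<in> B" "b0 \<noteq> 0"
    and s: "\<And>b. b \<in> B \<Longrightarrow> s * b = (\<Sum>c\<in>B. to_closure (r b c) * c)"
  obtains n e where "bij_betw e {..<n} B"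
    and "poly (map_poly to_closure (char_poly (mat n n (\<lambda>(i, j). r (e i) (e j))))) s = 0"
proof -
  obtain e where e: "bij_betw e {..<card B} B"
    using ex_bij_betw_nat_finite[OF B(1)] by (auto simp: atLeast0LessThan)
  define n where "n = card B"
  define A where "A = mat n n (\<lambda>(i, j). r (e i) (e j))"
  define v where "v = vec n e"
  let ?A = "map_mat to_closure A"
  have A: "A \<in> carrier_mat n n" by (simp add: A_def)
  have "?A *\<^sub>v v = s \<cdot>\<^sub>v v"
  proof (rule eq_vecI)
    fix i assume "i < dim_vec (s \<cdot>\<^sub>v v)"
    then have i: "i < n" by (simp add: v_def)
    then have "e i \<in> B" using e by (auto simp: n_def bij_betw_def)
    have "(?A *\<^sub>v v) $ i = (\<Sum>j<n. to_closure (r (e i) (e j)) * e j)"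
      using i by (auto simp: A_def v_def scalar_prod_def atLeast0LessThan intro!: sum.cong)
    also have "\<dots> = (\<Sum>c\<in>B. to_closure (r (e i) c) * c)"
      using sum.reindex_bij_betw[OF e, of "\<lambda>c. to_closure (r (e i) c) * c"] by (simp add: n_def)
    also have "\<dots> = s * e i" using s[OF \<open>e i \<in> B\<close>] by simp
    finally show "(?A *\<^sub>v v) $ i = (s \<cdot>\<^sub>v v) $ i" using i by (simp add: v_def)
  qed (simp add: A_def v_def)
  moreover have "v \<noteq> 0\<^sub>v n"
  proof
    assume v: "v = 0\<^sub>v n"
    obtain i where "i < n" "e i = b0" using e B(2) unfolding n_def bij_betw_def by force
    then show False using arg_cong[OF v, of "\<lambda>w. vec_index w i"] B(3) by (simp add: v_def)
  qed
  ultimately have "eigenvalue ?A s"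
    using A unfolding eigenvalue_def eigenvector_def by (intro exI[of _ v]) (auto simp: v_def)
  then have "poly (char_poly ?A) s = 0"
    using eigenvalue_root_char_poly[of ?A n s] A by simp
  then have "poly (map_poly to_closure (char_poly A)) s = 0"
    using to_closure_hom.char_poly_hom[OF A] by simp
  then show thesis using that e by (simp add: A_def n_def)
qed

lemma abs_int_closure_stable:
  assumes B: "finite B" "b0 \<in> B" "b0 \<noteq> 0"
    and s: "\<And>b. b \<in> B \<Longrightarrow> s * b \<in> closure_span B"
  shows "s \<in> abs_int_closure"
proof -
  have "\<forall>b\<in>B. \<exists>r. s * b = (\<Sum>c\<in>B. to_closure (r c) * c)"
    using s by (auto simp: closure_span_def)
  then obtain r where "\<And>b. b \<in> B \<Longrightarrow> s * b = (\<Sum>c\<in>B. to_closure (r b c) * c)" by metis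
  from char_poly_stable[OF B this] obtain n e
    where "poly (map_poly to_closure (char_poly (mat n n (\<lambda>(i, j). r (e i) (e j))))) s = 0" by blast
  moreover have "lead_coeff (char_poly (mat n n (\<lambda>(i, j). r (e i) (e j)))) = 1"
    using degree_monic_char_poly[of "mat n n (\<lambda>(i, j). r (e i) (e j))" n] by auto
  ultimately show ?thesis unfolding abs_int_closure_def by blast
qed

lemma abs_int_closure_power:
  assumes "z \<in> abs_int_closure"
  obtains n c where "0 < n" "z ^ n = (\<Sum>i<n. to_closure (c i) * z ^ i)"
proof -
  obtain P where P: "lead_coeff P = 1" "poly (map_poly to_closure P) z = 0"
    using assms by (auto simp: abs_int_closure_def)
  define n where "n = degree P"
  have "n \<noteq> 0"
  proof
    assume "n = 0"
    then obtain a where "P = [:a:]" by (metis degree_eq_zeroE n_def)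
    then show False using P by auto
  qed
  have "0 = (\<Sum>i\<le>n. to_closure (coeff P i) * z ^ i)"
    using P(2) by (simp add: poly_altdef n_def)
  also have "\<dots> = (\<Sum>i<n. to_closure (coeff P i) * z ^ i) + z ^ n"
    using P(1) by (simp add: lessThan_Suc_atMost[symmetric] n_def)
  finally have "z ^ n = - (\<Sum>i<n. to_closure (coeff P i) * z ^ i)"
    by (simp add: eq_neg_iff_add_eq_0 add.commute)
  also have "\<dots> = (\<Sum>i<n. to_closure (- coeff P i) * z ^ i)"
    by (simp add: sum_negf to_closure_hom.hom_uminus)
  finally show thesis using that[of n "\<lambda>i. - coeff P i"] \<open>n \<noteq> 0\<close> by simp
qed

text \<open>Sums and products require one finitely generated module stable under both elements;
  monomials below the degrees of the two equations span it.\<close>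

lemma abs_int_closure_pair_basis:
  assumes "z \<in> abs_int_closure" "w \<in> abs_int_closure"
  obtains B where "finite B" "1 \<in> B" "\<And>b. b \<in> B \<Longrightarrow> z * b \<in> closure_span B"
    "\<And>b. b \<in> B \<Longrightarrow> w * b \<in> closure_span B"
proof -
  obtain m c where m: "0 < m" "z ^ m = (\<Sum>i<m. to_closure (c i) * z ^ i)"
    using abs_int_closure_power[OF assms(1)] .
  obtain n d where n: "0 < n" "w ^ n = (\<Sum>i<n. to_closure (d i) * w ^ i)"
    using abs_int_closure_power[OF assms(2)] .
  define B where "B = (\<lambda>(i, j). z ^ i * w ^ j) ` ({..<m} \<times> {..<n})"
  have fin: "finite B" by (simp add: B_def)
  have base: "z ^ i * w ^ j \<in> closure_span B" if "i < m" "j < n" for i j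
    using that by (intro closure_span_base[OF fin]) (auto simp: B_def)
  have zb: "z ^ Suc i * w ^ j \<in> closure_span B" if ij: "i < m" "j < n" for i j
  proof (cases "Suc i < m")
    case False
    then have "Suc i = m" using ij by simp
    then have "z ^ Suc i * w ^ j = (\<Sum>i<m. to_closure (c i) * (z ^ i * w ^ j))"
      using m(2) by (simp add: sum_distrib_right mult.assoc del: power_Suc)
    then show ?thesis using base ij by (auto intro!: closure_span_sum closure_span_smult)
  qed (use base[of "Suc i" j] ij in auto)
  have wb: "z ^ i * w ^ Suc j \<in> closure_span B" if ij: "i < m" "j < n" for i j
  proof (cases "Suc j < n")
    case False
    then have "Suc j = n" using ij by simp
    then have "z ^ i * w ^ Suc j = (\<Sum>j<n. to_closure (d j) * (z ^ i * w ^ j))"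
      using n(2) by (simp add: sum_distrib_left mult_ac del: power_Suc)
    then show ?thesis using base ij by (auto intro!: closure_span_sum closure_span_smult)
  qed (use base[of i "Suc j"] ij in auto)
  show thesis
  proof (rule that[OF fin])
    show "1 \<in> B" unfolding B_def using m n by (intro image_eqI[of _ _ "(0, 0)"]) auto
  next
    fix b assume "b \<in> B"
    then obtain i j where "i < m" "j < n" "b = z ^ i * w ^ j" by (auto simp: B_def)
    then show "z * b \<in> closure_span B" "w * b \<in> closure_span B"
      using zb[of i j] wb[of i j] by (simp_all add: mult_ac)
  qed
qed

lemma to_closure_abs_int_closure: "to_closure a \<in> abs_int_closure"
  unfolding abs_int_closure_def
  by (intro CollectI exI[of _ "[:- a, 1:]"]) (simp add: map_poly_pCons to_closure_hom.hom_uminus)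

interpretation abs_int_closure: root_closed_subring "abs_int_closure :: 'a::idom fract alg_closure set"
proof
  show "0 \<in> abs_int_closure" "1 \<in> abs_int_closure"
    using to_closure_abs_int_closure[of 0] to_closure_abs_int_closure[of 1] by auto
next
  fix x y :: "'a fract alg_closure"
  assume "x \<in> abs_int_closure" "y \<in> abs_int_closure"
  then obtain B where B: "finite B" "1 \<in> B" "\<And>b. b \<in> B \<Longrightarrow> x * b \<in> closure_span B"
    "\<And>b. b \<in> B \<Longrightarrow> y * b \<in> closure_span B"
    using abs_int_closure_pair_basis[of x y] by metis
  show "x + y \<in> abs_int_closure"
    by (rule abs_int_closure_stable[OF B(1,2)]) (auto simp: distrib_right intro: closure_span_add B)
  show "x * y \<in> abs_int_closure"
    by (rule abs_int_closure_stable[OF B(1,2)])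
      (auto simp: mult.assoc intro: closure_span_mult_stable B)
next
  fix x :: "'a fract alg_closure"
  assume "x \<in> abs_int_closure"
  then obtain B where B: "finite B" "1 \<in> B" "\<And>b. b \<in> B \<Longrightarrow> x * b \<in> closure_span B"
    using abs_int_closure_pair_basis[of x x] by metis
  have "- x * b \<in> closure_span B" if "b \<in> B" for b
    using closure_span_smult[OF B(3)[OF that], of "-1"] by (simp add: to_closure_hom.hom_uminus)
  then show "- x \<in> abs_int_closure"
    by (intro abs_int_closure_stable[OF B(1,2)]) auto
next
  fix x :: "'a fract alg_closure" and n :: nat
  assume "x ^ n \<in> abs_int_closure" and n: "0 < n"
  then obtain P where P: "lead_coeff P = 1" "poly (map_poly to_closure P) (x ^ n) = 0"
    by (auto simp: abs_int_closure_def)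
  have "degree (monom (1 :: 'a) n) > 0" using n by (simp add: degree_monom_eq)
  then have "lead_coeff (pcompose P (monom 1 n)) = 1"
    using P(1) lead_coeff_monom[of "1 :: 'a" n] by (simp only: lead_coeff_comp) simp
  moreover have "poly (map_poly to_closure (pcompose P (monom 1 n))) x = 0"
    using P(2) by (simp add: to_closure_hom.map_poly_pcompose poly_pcompose poly_monom
        map_poly_monom to_closure_hom.hom_zero to_closure_hom.hom_one)
  ultimately show "x \<in> abs_int_closure" unfolding abs_int_closure_def by blast
qed

section \<open>Denominators of minimal polynomials\<close>

text \<open>Up to sign the i-th coefficient is the elementary symmetric polynomial of degree
  \<open>length rs - i\<close> in the roots, so it absorbs exactly that many factors D.\<close>

lemma prod_linear_coeff_integral:
  fixes rs :: "'a::idom fract alg_closure list"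
  assumes "\<And>r. r \<in> set rs \<Longrightarrow> D * r \<in> abs_int_closure"
  shows "i \<le> length rs \<Longrightarrow>
    D ^ (length rs - i) * coeff (\<Prod>r\<leftarrow>rs. [:- r, 1:]) i \<in> abs_int_closure"
  using assms
proof (induction rs arbitrary: i)
  case (Cons r rs)
  define Q where "Q = (\<Prod>r\<leftarrow>rs. [:- r, 1:])"
  have Q: "D ^ (length rs - i) * coeff Q i \<in> abs_int_closure" if "i \<le> length rs" for i
    using Cons.IH[of i] Cons.prems that by (simp add: Q_def)
  have degQ: "degree Q \<le> length rs"
    unfolding Q_def
  proof (induction rs)
    case (Cons r rs)
    then show ?case using degree_mult_le[of "[:- r, 1:]" "\<Prod>r\<leftarrow>rs. [:- r, 1:]"] by simp
  qed simp
  have r: "D * r \<in> abs_int_closure" using Cons.prems by simp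
  have c: "coeff ([:- r, 1:] * Q) i = (case i of 0 \<Rightarrow> 0 | Suc j \<Rightarrow> coeff Q j) - r * coeff Q i"
    by (simp add: coeff_pCons)
  have 1: "D ^ (Suc (length rs) - i) * (r * coeff Q i) \<in> abs_int_closure"
  proof (cases "i \<le> length rs")
    case True
    have eq: "D ^ (Suc (length rs) - i) * (r * coeff Q i)
        = (D * r) * (D ^ (length rs - i) * coeff Q i)"
      using True by (simp add: Suc_diff_le mult_ac)
    show ?thesis unfolding eq by (rule abs_int_closure.mult_mem[OF r Q[OF True]])
  next
    case False
    then have "coeff Q i = 0" using degQ by (intro coeff_eq_0) auto
    then show ?thesis by simp
  qed
  have 2: "D ^ (Suc (length rs) - i) * (case i of 0 \<Rightarrow> 0 | Suc j \<Rightarrow> coeff Q j) \<in> abs_int_closure"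
    using Q Cons.prems(1) by (auto split: nat.split)
  show ?case
    using abs_int_closure.diff_mem[OF 2 1] unfolding list.map prod_list.Cons Q_def[symmetric] c
    by (simp add: right_diff_distrib)
qed simp

text \<open>The conjugates of \<open>d t\<close> are integral along with \<open>d t\<close>.\<close>

lemma minimal_poly_coeffs:
  fixes t :: "'a::idom fract alg_closure"
  assumes normal: "\<And>k :: 'a fract. to_ac k \<in> abs_int_closure \<Longrightarrow> k \<in> range to_fract"
  obtains \<mu> where "lead_coeff \<mu> = 1" "poly (map_poly to_ac \<mu>) t = 0"
    "\<And>d. d \<noteq> 0 \<Longrightarrow> to_closure d * t \<in> abs_int_closure \<Longrightarrow> \<exists>n. \<forall>i.
       to_fract d ^ n * coeff \<mu> i \<in> range to_fract"
proof -
  interpret to_ac_hom: inj_idom_hom "to_ac :: 'a fract \<Rightarrow> 'a fract alg_closure"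
    by unfold_locales auto
  interpret to_ac_poly: map_poly_inj_idom_hom "to_ac :: 'a fract \<Rightarrow> 'a fract alg_closure" ..
  obtain q :: "'a fract poly" where q: "q \<noteq> 0" "poly (map_poly to_ac q) t = 0"
    by (rule alg_closure_algebraic)
  define N where "N q \<longleftrightarrow> q \<noteq> 0 \<and> poly (map_poly to_ac q) t = 0" for q :: "'a fract poly"
  obtain \<mu>0 where \<mu>0: "N \<mu>0" "\<And>q. N q \<Longrightarrow> degree \<mu>0 \<le> degree q"
    using ex_has_least_nat[of N q degree] q unfolding N_def by blast
  define \<mu> where "\<mu> = smult (inverse (lead_coeff \<mu>0)) \<mu>0"
  have \<mu>: "lead_coeff \<mu> = 1" "poly (map_poly to_ac \<mu>) t = 0" "degree \<mu> = degree \<mu>0"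
    using \<mu>0(1) by (auto simp: \<mu>_def N_def to_ac_hom.map_poly_hom_smult)
  have dvd: "\<mu> dvd q" if "poly (map_poly to_ac q) t = 0" for q
  proof -
    have "poly (map_poly to_ac (q mod \<mu>)) t = 0"
    proof -
      have "q mod \<mu> = q - \<mu> * (q div \<mu>)" by (simp add: minus_mult_div_eq_mod)
      then show ?thesis using that \<mu>(2) by (simp add: to_ac_poly.hom_minus to_ac_poly.hom_mult)
    qed
    moreover have "\<mu> \<noteq> 0" using \<mu>(1) by auto
    ultimately have "q mod \<mu> = 0"
      using \<mu>0(2)[of "q mod \<mu>"] \<mu>(3) degree_mod_less[of \<mu> q] by (fastforce simp: N_def)
    then show ?thesis by auto
  qed
  have "\<exists>n. \<forall>i. to_fract d ^ n * coeff \<mu> i \<in> range to_fract"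
    if d: "d \<noteq> 0" "to_closure d * t \<in> abs_int_closure" for d
  proof -
    define D where "D = to_closure d"
    obtain P where P: "lead_coeff P = 1" "poly (map_poly to_closure P) (D * t) = 0"
      using d(2) by (auto simp: abs_int_closure_def D_def)
    \<comment> \<open>Q(r) = P(d r), so Q vanishes at t and the minimal polynomial divides it. Every
      conjugate r is then a root of Q, which makes d r integral.\<close>
    define Q where "Q = pcompose (map_poly to_fract P) [:0, to_fract d:]"
    have Q: "poly (map_poly to_ac Q) r = poly (map_poly to_closure P) (D * r)" for r
      by (simp add: Q_def to_ac_hom.map_poly_pcompose poly_pcompose map_poly_map_poly comp_def
          to_ac_hom.map_poly_pCons_hom D_def to_closure_def[abs_def] mult.commute)
    define M where "M = map_poly to_ac \<mu>"
    have lM: "lead_coeff M = 1" "degree M = degree \<mu>" using \<mu>(1) by (simp_all add: M_def)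
    have "M \<noteq> 0" using lM by auto
    then obtain A where A: "size A = degree M" "M = smult (lead_coeff M) (\<Prod>x\<in>#A. [:- x, 1:])"
      using alg_closed_imp_factorization[of M] by blast
    obtain rs where rs: "A = mset rs" by (metis ex_mset)
    have M: "M = (\<Prod>x\<leftarrow>rs. [:- x, 1:])" "length rs = degree \<mu>"
      using A lM rs by (auto simp: prod_mset_prod_list simp flip: mset_map)
    have "D * r \<in> abs_int_closure" if "r \<in> set rs" for r
    proof -
      have "poly M r = 0" using that unfolding M(1) poly_prod_list by (auto simp: prod_list_zero_iff)
      moreover have "\<mu> dvd Q" using dvd Q[of t] P(2) by simp
      then have "M dvd map_poly to_ac Q" unfolding M_def by (rule to_ac_poly.hom_dvd)
      ultimately have "poly (map_poly to_ac Q) r = 0" by (meson dvd_trans poly_eq_0_iff_dvd)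
      then show ?thesis using P(1) Q[of r] unfolding abs_int_closure_def by auto
    qed
    then have int: "D ^ (degree \<mu> - i) * coeff M i \<in> abs_int_closure" if "i \<le> degree \<mu>" for i
      using prod_linear_coeff_integral[of rs D i] that by (simp add: M)
    have "to_fract d ^ degree \<mu> * coeff \<mu> i \<in> range to_fract" for i
    proof (cases "i \<le> degree \<mu>")
      case True
      have "D ^ degree \<mu> * coeff M i = D ^ i * (D ^ (degree \<mu> - i) * coeff M i)"
        using True by (simp flip: power_add mult.assoc)
      also have "\<dots> \<in> abs_int_closure"
        using int[OF True] to_closure_abs_int_closure by (auto simp: D_def)
      finally have "to_ac (to_fract d ^ degree \<mu> * coeff \<mu> i) \<in> abs_int_closure"
        by (simp add: D_def to_closure_def M_def coeff_map_poly)
      then show ?thesis by (rule normal)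
    next
      case False
      then show ?thesis by (auto simp: coeff_eq_0 intro: range_eqI[of _ _ 0])
    qed
    then show ?thesis by blast
  qed
  with \<mu> show thesis using that by blast
qed

section \<open>Normality of \<open>\<int>\<^sub>p[[x]]\<close>\<close>

lemmas residue_simps = plus_padic_int.rep_eq minus_padic_int.rep_eq uminus_padic_int.rep_eq
  times_padic_int.rep_eq zero_padic_int.rep_eq one_padic_int.rep_eq

lemma padic_int_eqI: "(\<And>n. residue x n = residue y n) \<Longrightarrow> x = y"
  using residue_inject by blast

lemma residue_of_nat:
  "residue (of_nat k :: 'p::prime_card padic_int) n = int k mod int CARD('p) ^ n"
  by (induction k) (auto simp: residue_simps mod_simps)

lemma residue_of_int:
  "residue (of_int k :: 'p::prime_card padic_int) n = k mod int CARD('p) ^ n"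
  by (cases k) (auto simp: residue_of_nat residue_simps mod_simps)

lemma residue_sum:
  fixes f :: "'i \<Rightarrow> 'p::prime_card padic_int"
  shows "residue (sum f I) n = (\<Sum>i\<in>I. residue (f i) n) mod int CARD('p) ^ n"
  by (induction I rule: infinite_finite_induct) (auto simp: residue_simps mod_simps)

lemma residue_mono:
  assumes "m \<le> n"
  shows "residue (x :: 'p::prime_card padic_int) n mod int CARD('p) ^ m = residue x m"
  using residue_add[of x m "n - m"] assms by simp

lemma ex_padic_int:
  assumes "\<And>n. c n \<in> {0..<int CARD('p::prime_card) ^ n}" "\<And>n. c (Suc n) mod int CARD('p) ^ n = c n"
  shows "\<exists>x :: 'p padic_int. residue x = c"
proof
  show "residue (Abs_padic_int c :: 'p padic_int) = c"
    by (rule Abs_padic_int_inverse) (use assms in auto)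
qed

lemma power_dvd_padic_iff:
  "of_nat CARD('p) ^ n dvd (x :: 'p::prime_card padic_int) \<longleftrightarrow> residue x n = 0"
proof
  let ?q = "int CARD('p)"
  assume "of_nat CARD('p) ^ n dvd x"
  then obtain y where "x = of_nat (CARD('p) ^ n) * y" by (auto elim: dvdE)
  then show "residue x n = 0" by (simp add: residue_simps residue_of_nat del: of_nat_power) simp
next
  let ?q = "int CARD('p)"
  assume x: "residue x n = 0"
  \<comment> \<open>Residue m of the quotient by p^n depends on n further digits of x.\<close>
  define c where "c m = residue x (n + m) div ?q ^ n" for m
  have "c (Suc m) mod ?q ^ m = c m" for m
  proof -
    have "residue x (n + m) = residue x (n + Suc m) mod (?q ^ n * ?q ^ m)"
      using residue_mono[of "n + m" "n + Suc m" x] by (simp add: power_add)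
    then show ?thesis by (simp add: c_def zmod_zmult2_eq)
  qed
  moreover have "c m \<in> {0..<?q ^ m}" for m
  proof -
    have "c m * ?q ^ n \<le> residue x (n + m)"
      using div_mult_mod_eq[of "residue x (n + m)" "?q ^ n"]
        pos_mod_sign[OF zero_less_power[OF CARD_prime_pos[where ?'p = 'p]], of "residue x (n + m)" n]
      unfolding c_def by linarith
    also have "\<dots> < ?q ^ m * ?q ^ n"
      using residue_bounds[of x "n + m"] by (simp add: power_add mult.commute)
    finally have "c m < ?q ^ m" by (rule mult_right_less_imp_less) simp
    moreover have "0 \<le> c m"
      using residue_bounds[of x "n + m"] by (simp add: c_def pos_imp_zdiv_nonneg_iff)
    ultimately show ?thesis by simp
  qed
  ultimately obtain y :: "'p padic_int" where y: "residue y = c"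
    using ex_padic_int[of c] by blast
  have "?q ^ n dvd residue x (n + m)" for m
    using residue_mono[of n "n + m" x] x by (auto simp: dvd_eq_mod_eq_0)
  then have "?q ^ n * c m mod ?q ^ m = residue x m" for m
    using residue_mono[of m "n + m" x] by (simp add: c_def)
  moreover have "residue (of_nat (CARD('p) ^ n) :: 'p padic_int) m = ?q ^ n mod ?q ^ m" for m
    by (subst residue_of_nat) simp
  ultimately have "x = of_nat (CARD('p) ^ n) * y"
    by (intro padic_int_eqI) (simp add: times_padic_int.rep_eq y mod_simps del: of_nat_power)
  then show "of_nat CARD('p) ^ n dvd x" by simp
qed

lemma padic_unit:
  assumes "residue (x :: 'p::prime_card padic_int) 1 \<noteq> 0"
  shows "x dvd 1"
proof -
  let ?q = "int CARD('p)"
  have q: "prime ?q" by (rule prime_card_int)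
  have cop: "coprime (residue x n) (?q ^ n)" for n
  proof (cases n)
    case (Suc m)
    have "\<not> ?q dvd residue x n"
      using residue_mono[of 1 n x] assms Suc by (auto simp: dvd_eq_mod_eq_0)
    then have "coprime ?q (residue x n)" by (rule prime_imp_coprime[OF q])
    then show ?thesis by (simp add: coprime_commute)
  qed simp
  have ex: "\<exists>y. y \<in> {0..<?q ^ n} \<and> (residue x n * y) mod ?q ^ n = 1 mod ?q ^ n" for n
  proof -
    obtain y where "[residue x n * y = 1] (mod ?q ^ n)"
      using cong_solve_coprime_int[OF cop] by blast
    then show ?thesis
      by (intro exI[of _ "y mod ?q ^ n"]) (auto simp: cong_def mod_simps)
  qed
  then obtain c where c: "\<And>n. c n \<in> {0..<?q ^ n}"
    "\<And>n. (residue x n * c n) mod ?q ^ n = 1 mod ?q ^ n" by metis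
  \<comment> \<open>Inverses modulo p^n are unique, so the separate choices are compatible.\<close>
  have "c (Suc n) mod ?q ^ n = c n" for n
  proof -
    have "(residue x (Suc n) * c (Suc n)) mod ?q ^ Suc n mod ?q ^ n = 1 mod ?q ^ n"
      by (simp only: c(2) mod_power_Suc)
    then have "(residue x (Suc n) mod ?q ^ n * c (Suc n)) mod ?q ^ n = 1 mod ?q ^ n"
      by (simp only: mod_power_Suc mod_mult_left_eq)
    then have "[residue x n * c (Suc n) = residue x n * c n] (mod ?q ^ n)"
      using c(2)[of n] by (simp add: cong_def residue_Suc)
    then have "[c (Suc n) = c n] (mod ?q ^ n)"
      using cop cong_mult_lcancel by blast
    then show ?thesis using c(1)[of n] by (simp add: cong_def)
  qed
  then obtain y :: "'p padic_int" where y: "residue y = c" using ex_padic_int[of c] c(1) by blast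
  then have "x * y = 1" using c(2) by (intro padic_int_eqI) (simp add: residue_simps)
  then show ?thesis by (metis dvd_triv_left)
qed

lemma padic_factor:
  assumes "(x :: 'p::prime_card padic_int) \<noteq> 0"
  obtains v u where "x = of_nat CARD('p) ^ v * u" "u dvd 1"
proof -
  have ex: "\<exists>n. residue x (Suc n) \<noteq> 0"
  proof (rule ccontr)
    assume *: "\<not> ?thesis"
    have "residue x n = residue (0 :: 'p padic_int) n" for n
      using * residue_mono[of n "Suc n" x] by (simp add: residue_simps)
    then show False using assms padic_int_eqI by blast
  qed
  define v where "v = (LEAST n. residue x (Suc n) \<noteq> 0)"
  have v: "residue x (Suc v) \<noteq> 0" unfolding v_def using ex by (rule LeastI_ex)
  have "residue x v = 0"
  proof (cases v)
    case 0
    then show ?thesis using residue_bounds[of x 0] by simp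
  next
    case (Suc n)
    then show ?thesis using not_less_Least[of n "\<lambda>n. residue x (Suc n) \<noteq> 0"] v_def by auto
  qed
  then obtain u where u: "x = of_nat CARD('p) ^ v * u"
    using power_dvd_padic_iff[of v x] by (auto elim: dvdE)
  have "residue u 1 \<noteq> 0"
  proof
    assume "residue u 1 = 0"
    then have "of_nat CARD('p) ^ v * of_nat CARD('p) dvd x"
      using power_dvd_padic_iff[of 1 u] unfolding u by (intro mult_dvd_mono) auto
    then show False using v power_dvd_padic_iff[of "Suc v" x] by (simp add: mult.commute)
  qed
  then show thesis using that u padic_unit by blast
qed

lemma padic_p_nonunit: "\<not> of_nat CARD('p) dvd (1 :: 'p::prime_card padic_int)"
  using power_dvd_padic_iff[of 1 "1 :: 'p padic_int"] prime_gt_1_int[OF prime_card_int[where ?'a = 'p]]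
  by (simp add: residue_simps)

lemma padic_p_nonzero [simp]: "(of_nat CARD('p) :: 'p::prime_card padic_int) \<noteq> 0"
proof
  assume "(of_nat CARD('p) :: 'p padic_int) = 0"
  then have "residue (of_nat CARD('p) :: 'p padic_int) 2 = 0" by (simp add: residue_simps)
  moreover have "int CARD('p) < int CARD('p) ^ 2"
    using prime_gt_1_int[OF prime_card_int[where ?'a = 'p]] by (simp add: power2_eq_square)
  ultimately show False by (simp add: residue_of_nat)
qed

section \<open>Complete integral closedness of power series rings\<close>

text \<open>The fraction g/h is almost integral with common denominator d, expressed without
  fractions. This form is used in place of integral closedness because it descends to constant
  terms, and so passes from coefficients to power series.\<close>

definition completely_integrally_closed :: "'a::idom itself \<Rightarrow> bool" where
  "completely_integrally_closed _ \<longleftrightarrow>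
     (\<forall>d g h :: 'a. d \<noteq> 0 \<longrightarrow> h \<noteq> 0 \<longrightarrow> (\<forall>m. h ^ m dvd d * g ^ m) \<longrightarrow> h dvd g)"

lemma completely_integrally_closed_padic:
  "completely_integrally_closed TYPE('p::prime_card padic_int)"
  unfolding completely_integrally_closed_def
proof (intro allI impI)
  fix d g h :: "'p padic_int"
  assume d: "d \<noteq> 0" and h: "h \<noteq> 0" and dvd: "\<forall>m. h ^ m dvd d * g ^ m"
  let ?q = "of_nat CARD('p) :: 'p padic_int"
  show "h dvd g"
  proof (cases "g = 0")
    case False
    obtain c u where c: "d = ?q ^ c * u" "u dvd 1" using padic_factor[OF d] .
    obtain w g' where w: "g = ?q ^ w * g'" "g' dvd 1" using padic_factor[OF False] .
    obtain v h' where v: "h = ?q ^ v * h'" "h' dvd 1" using padic_factor[OF h] .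
    show ?thesis
    proof (cases "v \<le> w")
      case True
      have "?q ^ v * h' dvd ?q ^ w * g'"
        using True v(2) by (intro mult_dvd_mono le_imp_power_dvd) (auto intro: dvd_trans)
      then show ?thesis using v w by simp
    next
      case False
      \<comment> \<open>If g had smaller valuation than h, each of c + 1 factors would lack a power
        of p, and d supplies only c of them.\<close>
      then have "w * Suc c + Suc c \<le> v * Suc c"
        using mult_le_mono1[of "Suc w" v "Suc c"] by simp
      then have "?q ^ (w * Suc c + Suc c) dvd h ^ Suc c"
        unfolding v(1) power_mult_distrib power_mult[symmetric]
        by (intro dvd_mult2 le_imp_power_dvd)
      also have "h ^ Suc c dvd d * g ^ Suc c" using dvd by blast
      also have "d * g ^ Suc c = ?q ^ (w * Suc c + c) * (u * g' ^ Suc c)"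
        unfolding c(1) w(1) power_mult_distrib power_mult power_add by (simp only: mult_ac)
      finally have "?q ^ (w * Suc c + c) * ?q dvd ?q ^ (w * Suc c + c) * (u * g' ^ Suc c)"
        by (simp add: mult_ac)
      then have "?q dvd u * g' ^ Suc c" by (subst (asm) dvd_mult_cancel_left) auto
      moreover have "u * g' ^ Suc c dvd 1"
        using c(2) w(2) by (metis dvd_power_same is_unit_mult_iff power_one)
      ultimately show ?thesis using padic_p_nonunit dvd_trans by blast
    qed
  qed simp
qed

lemma fps_X_power_dvd_iff: "fps_X ^ n dvd (f :: 'a::comm_ring_1 fps) \<longleftrightarrow> (\<forall>i<n. fps_nth f i = 0)"
proof
  assume "fps_X ^ n dvd f"
  then obtain g where "f = fps_X ^ n * g" by (elim dvdE)
  then show "\<forall>i<n. fps_nth f i = 0" by (simp add: fps_X_power_mult_nth)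
next
  assume "\<forall>i<n. fps_nth f i = 0"
  then have "f = fps_X ^ n * fps_shift n f"
    by (intro fps_ext) (auto simp: fps_X_power_mult_nth)
  then show "fps_X ^ n dvd f" by (metis dvd_triv_left)
qed

lemma fps_dvd_cancel_X_power:
  fixes h :: "'a::idom fps"
  assumes h: "fps_nth h 0 \<noteq> 0" and dvd: "h dvd fps_X ^ s * y"
  shows "h dvd y"
  using dvd
proof (induction s)
  case (Suc s)
  then obtain k where k: "fps_X * (fps_X ^ s * y) = h * k" by (auto elim: dvdE simp: mult.assoc)
  have "fps_nth h 0 * fps_nth k 0 = fps_nth (fps_X * (fps_X ^ s * y)) 0"
    unfolding k by (simp add: fps_mult_nth)
  then have "fps_nth k 0 = 0" using h by (simp add: fps_mult_nth)
  then have "fps_X ^ 1 dvd k" by (subst fps_X_power_dvd_iff) auto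
  then obtain k' where "k = fps_X * k'" by (auto elim: dvdE)
  then have "fps_X * (fps_X ^ s * y) = fps_X * (h * k')" using k by (simp add: mult_ac)
  then have "fps_X ^ s * y = h * k'" by simp
  then show ?case using Suc.IH by simp
qed simp

text \<open>The condition concerns g/h only up to elements of the ring, which allows the quotient to
  be built term by term.\<close>

lemma power_dvd_diff_mult:
  fixes h :: "'a::comm_ring_1"
  assumes "\<forall>m. h ^ m dvd d * g ^ m"
  shows "h ^ m dvd d * (g - h * t) ^ m"
proof -
  have "d * (g - h * t) ^ m = d * (g + (- (h * t))) ^ m" by simp
  also have "\<dots> = (\<Sum>k\<le>m. of_nat (m choose k) * (d * g ^ k) * (- (h * t)) ^ (m - k))"
    unfolding binomial_ring sum_distrib_left by (simp add: mult_ac)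
  also have "h ^ m dvd \<dots>"
  proof (rule dvd_sum)
    fix k assume "k \<in> {..m}"
    then have m: "h ^ m = h ^ k * h ^ (m - k)" by (simp flip: power_add)
    have "h ^ (m - k) dvd (- (h * t)) ^ (m - k)" by (intro dvd_power_same) simp
    then show "h ^ m dvd of_nat (m choose k) * (d * g ^ k) * (- (h * t)) ^ (m - k)"
      unfolding m using assms by (intro mult_dvd_mono[OF dvd_mult]) auto
  qed
  finally show ?thesis .
qed

text \<open>Once powers of x are split off, constant terms inherit the hypothesis, which gives the
  constant term of the quotient. Subtracting and dividing by x preserves the hypothesis, so
  iteration yields all coefficients.\<close>

lemma completely_integrally_closed_fps:
  assumes cic: "completely_integrally_closed TYPE('a::idom)"
  shows "completely_integrally_closed TYPE('a fps)"
  unfolding completely_integrally_closed_def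
proof (intro allI impI)
  fix d g h :: "'a fps"
  assume d: "d \<noteq> 0" and h: "h \<noteq> 0" and dvd: "\<forall>m. h ^ m dvd d * g ^ m"
  define s where "s = subdegree d"
  define r where "r = subdegree h"
  obtain d' where d': "d = fps_X ^ s * d'" "fps_nth d' 0 \<noteq> 0"
    using subdegree_decompose[of d] d nth_subdegree_nonzero[OF d]
    by (intro that[of "fps_shift (subdegree d) d"]) (auto simp: s_def mult.commute)
  obtain h' where h': "h = fps_X ^ r * h'" "fps_nth h' 0 \<noteq> 0"
    using subdegree_decompose[of h] h nth_subdegree_nonzero[OF h]
    by (intro that[of "fps_shift (subdegree h) h"]) (auto simp: r_def mult.commute)
  have h'm: "fps_nth (h' ^ m) 0 \<noteq> 0" for m using h'(2) by simp
  show "h dvd g"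
  proof (cases "g = 0")
    case False
    \<comment> \<open>For m = s + 1 a deficit in the order of g would count s + 1 times, more than
      the order s of d can make up.\<close>
    have "r \<le> subdegree g"
    proof (rule ccontr)
      assume "\<not> ?thesis"
      then have "Suc (subdegree g) * Suc s \<le> r * Suc s" by (intro mult_le_mono1) simp
      moreover obtain k where k: "d * g ^ Suc s = h ^ Suc s * k" using dvd by (metis dvdE)
      have "k \<noteq> 0" using k d False by (metis mult_eq_0_iff mult_zero_right power_not_zero)
      then have "s + Suc s * subdegree g = Suc s * r + subdegree k"
        using arg_cong[OF k, of subdegree] d False h
        by (simp del: power_Suc add: subdegree_mult' s_def r_def)
      ultimately show False by (simp add: algebra_simps)
    qed
    then have "fps_X ^ r dvd g" by (subst fps_X_power_dvd_iff) (auto intro: nth_less_subdegree_zero)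
    then obtain g' where g': "g = fps_X ^ r * g'" by (elim dvdE)
    have A0: "\<forall>m. h' ^ m dvd d' * g' ^ m"
    proof
      fix m
      have "(fps_X ^ r) ^ m * h' ^ m dvd (fps_X ^ r) ^ m * (fps_X ^ s * (d' * g' ^ m))"
        using dvd[rule_format, of m] unfolding h'(1) g' d'(1) power_mult_distrib
        by (simp only: mult_ac)
      then have "h' ^ m dvd fps_X ^ s * (d' * g' ^ m)" by (subst (asm) dvd_mult_cancel_left) auto
      then show "h' ^ m dvd d' * g' ^ m" by (rule fps_dvd_cancel_X_power[OF h'm])
    qed
    define A where "A q \<longleftrightarrow> (\<forall>m. h' ^ m dvd d' * q ^ m)" for q
    have step: "\<exists>t q'. q = h' * fps_const t + fps_X * q' \<and> A q'" if q: "A q" for q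
    proof -
      have "\<forall>m. fps_nth h' 0 ^ m dvd fps_nth d' 0 * fps_nth q 0 ^ m"
      proof
        fix m
        obtain k where "d' * q ^ m = h' ^ m * k" using q unfolding A_def by (metis dvdE)
        from arg_cong[OF this, of "\<lambda>f. fps_nth f 0"]
        show "fps_nth h' 0 ^ m dvd fps_nth d' 0 * fps_nth q 0 ^ m" by (simp add: fps_power_zeroth)
      qed
      then have "fps_nth h' 0 dvd fps_nth q 0"
        using cic d'(2) h'(2) unfolding completely_integrally_closed_def by blast
      then obtain t where t: "fps_nth q 0 = fps_nth h' 0 * t" by (elim dvdE)
      have "fps_X ^ 1 dvd q - h' * fps_const t" using t by (subst fps_X_power_dvd_iff) auto
      then obtain q' where q': "q - h' * fps_const t = fps_X * q'" by (auto elim: dvdE)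
      have "A q'" unfolding A_def
      proof
        fix m
        have "h' ^ m dvd d' * (q - h' * fps_const t) ^ m"
          using q unfolding A_def by (rule power_dvd_diff_mult)
        also have "\<dots> = fps_X ^ m * (d' * q' ^ m)"
          unfolding q' by (simp add: power_mult_distrib mult_ac)
        finally show "h' ^ m dvd d' * q' ^ m" by (rule fps_dvd_cancel_X_power[OF h'm])
      qed
      moreover have "q = h' * fps_const t + fps_X * q'" using q' by (simp add: algebra_simps)
      ultimately show ?thesis by blast
    qed
    have "\<exists>Q T. Q 0 = g' \<and> (\<forall>n. A (Q n) \<and> Q n = h' * fps_const (T n) + fps_X * Q (Suc n))"
    proof -
      obtain t q where tq: "\<And>y. A y \<Longrightarrow> y = h' * fps_const (t y) + fps_X * q y"
        "\<And>y. A y \<Longrightarrow> A (q y)" using step by metis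
      define Q where "Q n = (q ^^ n) g'" for n
      have AQ: "A (Q n)" for n
        by (induction n) (use A0 tq(2) in \<open>auto simp: Q_def A_def[symmetric]\<close>)
      moreover have "Q n = h' * fps_const (t (Q n)) + fps_X * Q (Suc n)" for n
        using tq(1)[OF AQ, of n] by (simp add: Q_def)
      moreover have "Q 0 = g'" by (simp add: Q_def)
      ultimately show ?thesis by (intro exI[of _ Q] exI[of _ "\<lambda>n. t (Q n)"]) blast
    qed
    then obtain Q T where Q: "Q 0 = g'" "\<And>n. Q n = h' * fps_const (T n) + fps_X * Q (Suc n)"
      by blast
    have part: "g' = h' * (\<Sum>i<n. fps_const (T i) * fps_X ^ i) + fps_X ^ n * Q n" for n
    proof (induction n)
      case (Suc n)
      show ?case by (subst Suc, subst Q(2)) (simp add: algebra_simps)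
    qed (simp add: Q(1))
    have "g' = h' * Abs_fps T"
    proof (rule fps_ext)
      fix k
      have "fps_X ^ Suc k dvd (\<Sum>i<Suc k. fps_const (T i) * fps_X ^ i) - Abs_fps T"
        by (subst fps_X_power_dvd_iff) (auto simp: fps_sum_nth if_distrib cong: if_cong)
      then have "fps_X ^ Suc k dvd h' * ((\<Sum>i<Suc k. fps_const (T i) * fps_X ^ i) - Abs_fps T)
          + fps_X ^ Suc k * Q (Suc k)"
        by (intro dvd_add[OF dvd_mult dvd_triv_left])
      also have "\<dots> = g' - h' * Abs_fps T"
        by (simp only: right_diff_distrib diff_add_eq part[of "Suc k", symmetric])
      finally show "fps_nth g' k = fps_nth (h' * Abs_fps T) k"
        unfolding fps_X_power_dvd_iff by auto
    qed
    then show ?thesis unfolding h'(1) g' by (metis dvd_triv_left mult_dvd_mono dvd_refl)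
  qed simp
qed

text \<open>By the monic equation every power of k is a combination of powers below n, so
  \<open>h ^ n\<close> is a common denominator for all of them.\<close>

lemma completely_integrally_closed_normal:
  fixes k :: "'a::idom fract"
  assumes cic: "completely_integrally_closed TYPE('a)" and k: "to_ac k \<in> abs_int_closure"
  shows "k \<in> range to_fract"
proof -
  obtain g h where gh: "k = to_fract g / to_fract h" "h \<noteq> 0"
    by (cases k) (auto simp: Fract_conv_to_fract)
  obtain n c where n: "0 < n" "to_ac k ^ n = (\<Sum>i<n. to_closure (c i) * to_ac k ^ i)"
    using abs_int_closure_power[OF k] .
  have "to_ac (k ^ n) = to_ac (\<Sum>i<n. to_fract (c i) * k ^ i)"
    using n(2) by (simp add: to_ac_sum to_closure_def)
  then have kn: "k ^ n = (\<Sum>i<n. to_fract (c i) * k ^ i)" by (simp only: to_ac_eq_iff)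
  define S where "S = {y. to_fract h ^ n * y \<in> range to_fract}"
  have S_smult: "to_fract a * y \<in> S" if "y \<in> S" for a y
  proof -
    from that obtain b where "to_fract h ^ n * y = to_fract b" by (auto simp: S_def)
    then have "to_fract h ^ n * (to_fract a * y) = to_fract (a * b)" by (simp add: mult.left_commute)
    then show ?thesis unfolding S_def by blast
  qed
  have S_add: "x + y \<in> S" if "x \<in> S" "y \<in> S" for x y
  proof -
    from that obtain a b where "to_fract h ^ n * x = to_fract a" "to_fract h ^ n * y = to_fract b"
      by (auto simp: S_def)
    then have "to_fract h ^ n * (x + y) = to_fract (a + b)" by (simp add: distrib_left)
    then show ?thesis unfolding S_def by blast
  qed
  have S_0: "0 \<in> S" unfolding S_def by (auto intro: range_eqI[of _ _ 0])
  have S_sum: "sum f I \<in> S" if "\<And>i. i \<in> I \<Longrightarrow> f i \<in> S" for f and I :: "nat set"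
    using that by (induction I rule: infinite_finite_induct) (auto intro: S_0 S_add)
  have pow: "to_fract (a ^ i) = to_fract a ^ i" for a :: 'a and i by (induction i) auto
  have "k ^ m \<in> S" for m
  proof (induction m rule: less_induct)
    case (less m)
    show ?case
    proof (cases "m \<le> n")
      case True
      have "to_fract h ^ n * k ^ m = to_fract h ^ (n - m) * (to_fract h * k) ^ m"
        using True by (simp add: power_mult_distrib flip: power_add mult.assoc)
      also have "to_fract h * k = to_fract g" using gh by simp
      also have "to_fract h ^ (n - m) * to_fract g ^ m = to_fract (h ^ (n - m) * g ^ m)"
        by (simp add: pow)
      finally show ?thesis unfolding S_def by blast
    next
      case False
      then have "k ^ m = k ^ (m - n) * k ^ n" by (simp flip: power_add)
      also have "\<dots> = (\<Sum>i<n. to_fract (c i) * k ^ (m - n + i))"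
        unfolding kn by (simp add: sum_distrib_left power_add mult_ac)
      also have "\<dots> \<in> S" using False by (intro S_sum S_smult less) auto
      finally show ?thesis .
    qed
  qed
  then have "\<forall>m. h ^ m dvd h ^ n * g ^ m"
  proof (intro allI)
    fix m
    assume "\<And>m. k ^ m \<in> S"
    then obtain y where "to_fract h ^ n * k ^ m = to_fract y" by (auto simp: S_def)
    then have "to_fract (h ^ n * g ^ m) = to_fract (h ^ m * y)"
      using gh by (simp add: pow power_divide field_simps)
    then have "h ^ n * g ^ m = h ^ m * y" by (simp only: to_fract_eq_iff)
    then show "h ^ m dvd h ^ n * g ^ m" by simp
  qed
  then have "h dvd g"
    using cic gh(2) unfolding completely_integrally_closed_def by (metis power_not_zero)
  then obtain y where "g = h * y" by (elim dvdE)
  then have "k = to_fract y" using gh by simp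
  then show ?thesis by blast
qed

section \<open>Regularity and properness of (p, x) on the absolute integral closure\<close>

text \<open>One minimal polynomial serves both hypotheses: its coefficients lie in R[1/p] and in
  R[1/x], hence in R.\<close>

lemma abs_int_closure_regular:
  fixes t :: "'p::prime_card padic_int fps fract alg_closure"
  assumes "to_closure (of_nat CARD('p)) * t \<in> abs_int_closure"
    and "to_closure fps_X * t \<in> abs_int_closure"
  shows "t \<in> abs_int_closure"
proof -
  have normal: "k \<in> range to_fract" if "to_ac k \<in> abs_int_closure" for k :: "'p padic_int fps fract"
    by (intro completely_integrally_closed_normal that completely_integrally_closed_fps
        completely_integrally_closed_padic)
  obtain \<mu> where \<mu>: "lead_coeff \<mu> = 1" "poly (map_poly to_ac \<mu>) t = 0"
    "\<And>d. d \<noteq> 0 \<Longrightarrow> to_closure d * t \<in> abs_int_closure \<Longrightarrow> \<exists>n. \<forall>i.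
       to_fract d ^ n * coeff \<mu> i \<in> range to_fract"
    using minimal_poly_coeffs[OF normal] by metis
  have pow: "to_fract (a ^ i) = to_fract a ^ i" for a :: "'p padic_int fps" and i
    by (induction i) auto
  have of_nat_fps: "of_nat k = fps_const (of_nat k)" for k :: nat
    by (simp add: fps_of_nat)
  have p0: "(of_nat CARD('p) :: 'p padic_int fps) \<noteq> 0"
    unfolding of_nat_fps by simp
  obtain m n where m: "\<And>i. to_fract (of_nat CARD('p)) ^ m * coeff \<mu> i \<in> range to_fract"
    and n: "\<And>i. to_fract fps_X ^ n * coeff \<mu> i \<in> range to_fract"
    using \<mu>(3)[OF p0 assms(1)] \<mu>(3)[OF fps_X_neq_zero assms(2)] by blast
  have "coeff \<mu> i \<in> range to_fract" for i
  proof -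
    obtain \<alpha> where \<alpha>: "to_fract (of_nat CARD('p)) ^ m * coeff \<mu> i = to_fract \<alpha>" using m[of i] by auto
    obtain \<beta> where \<beta>: "to_fract fps_X ^ n * coeff \<mu> i = to_fract \<beta>" using n[of i] by auto
    have "to_fract (of_nat CARD('p) ^ m * \<beta>) = to_fract (fps_X ^ n * \<alpha>)"
      by (simp add: pow flip: \<alpha> \<beta>)
    then have eq: "fps_const (of_nat CARD('p) ^ m) * \<beta> = fps_X ^ n * \<alpha>"
      unfolding to_fract_eq_iff by (simp add: of_nat_fps)
    \<comment> \<open>Since p^m is a nonzero constant, x^n must already divide \<beta>.\<close>
    then have "fps_X ^ n dvd fps_const (of_nat CARD('p) ^ m) * \<beta>" by simp
    then have "fps_X ^ n dvd \<beta>" unfolding fps_X_power_dvd_iff by simp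
    then obtain \<gamma> where "\<beta> = fps_X ^ n * \<gamma>" by (elim dvdE)
    then have "to_fract fps_X ^ n * coeff \<mu> i = to_fract fps_X ^ n * to_fract \<gamma>"
      using \<beta> by (simp add: pow)
    then show ?thesis by simp
  qed
  then have "\<forall>i. \<exists>a. to_fract a = coeff \<mu> i" by (metis rangeE)
  from choice[OF this] obtain P where P: "\<And>i. to_fract (P i) = coeff \<mu> i" by blast
  define M where "M = Abs_poly (\<lambda>i. P i)"
  have "\<forall>\<^sub>\<infinity>i. P i = 0"
  proof -
    have "\<forall>\<^sub>\<infinity>i. coeff \<mu> i = 0" by (rule MOST_coeff_eq_0)
    then show ?thesis by (simp flip: P)
  qed
  then have cM: "coeff M i = P i" for i by (simp add: M_def Abs_poly_inverse)
  have \<mu>M: "\<mu> = map_poly to_fract M" by (intro poly_eqI) (simp add: coeff_map_poly cM P)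
  have "degree M = degree \<mu>" unfolding \<mu>M by (simp add: degree_map_poly)
  then have "to_fract (lead_coeff M) = to_fract 1" using \<mu>(1) by (simp add: cM P)
  then have "lead_coeff M = 1" by (simp only: to_fract_eq_iff)
  moreover have "poly (map_poly to_closure M) t = 0"
    using \<mu>(2) unfolding \<mu>M by (simp add: map_poly_map_poly comp_def to_closure_def[abs_def])
  ultimately show ?thesis unfolding abs_int_closure_def by blast
qed

definition residue_hom :: "'p::prime_card padic_int fps \<Rightarrow> 'p mod_ring" where
  "residue_hom r = of_int (residue (fps_nth r 0) 1)"

lemma of_int_mod_card: "(of_int (k mod int CARD('p)) :: 'p::prime_card mod_ring) = of_int k"
proof -
  have "(of_int k :: 'p mod_ring) = of_int (k div int CARD('p) * int CARD('p) + k mod int CARD('p))"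
    by simp
  also have "\<dots> = of_int (k mod int CARD('p))"
    unfolding of_int_add of_int_mult by simp
  finally show ?thesis ..
qed

interpretation residue_hom: comm_ring_hom "residue_hom :: 'p::prime_card padic_int fps \<Rightarrow> 'p mod_ring"
  by unfold_locales
    (auto simp: residue_hom_def residue_simps of_int_mod_card fps_mult_nth
      of_int_mod_card[of 1, simplified])

lemma residue_hom_p: "residue_hom (of_nat CARD('p) :: 'p::prime_card padic_int fps) = 0"
  and residue_hom_X: "residue_hom (fps_X :: 'p::prime_card padic_int fps) = 0"
  by (simp_all add: residue_hom_def residue_simps fps_of_nat[symmetric] residue_of_nat)

text \<open>Nakayama in determinant form: multiplication by 1 on a finitely generated module would
  have a matrix with entries in (p, x). Its characteristic polynomial vanishes at 1, but modulo (p,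
  x) it is a power of the variable, with value 1 there.\<close>

lemma abs_int_closure_proper:
  assumes "A \<in> abs_int_closure" "B \<in> abs_int_closure"
  shows "to_closure (of_nat CARD('p)) * A + to_closure fps_X * B
    \<noteq> (1 :: 'p::prime_card padic_int fps fract alg_closure)"
proof
  let ?p = "of_nat CARD('p) :: 'p padic_int fps"
  assume 1: "to_closure ?p * A + to_closure fps_X * B = 1"
  obtain S where S: "finite S" "1 \<in> S" "\<And>b. b \<in> S \<Longrightarrow> A * b \<in> closure_span S"
    "\<And>b. b \<in> S \<Longrightarrow> B * b \<in> closure_span S"
    using abs_int_closure_pair_basis[OF assms] by metis
  have "\<forall>b\<in>S. \<exists>r. A * b = (\<Sum>c\<in>S. to_closure (r c) * c)"
    and "\<forall>b\<in>S. \<exists>r. B * b = (\<Sum>c\<in>S. to_closure (r c) * c)"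
    using S(3,4) by (auto simp: closure_span_def)
  from bchoice[OF this(1)] bchoice[OF this(2)] obtain r s
    where rs: "\<And>b. b \<in> S \<Longrightarrow> A * b = (\<Sum>c\<in>S. to_closure (r b c) * c)"
      "\<And>b. b \<in> S \<Longrightarrow> B * b = (\<Sum>c\<in>S. to_closure (s b c) * c)" by blast
  define q where "q b c = ?p * r b c + fps_X * s b c" for b c
  have q: "1 * b = (\<Sum>c\<in>S. to_closure (q b c) * c)" if "b \<in> S" for b
  proof -
    have "1 * b = to_closure ?p * (A * b) + to_closure fps_X * (B * b)"
      unfolding 1[symmetric] by (simp add: algebra_simps)
    also have "\<dots> = (\<Sum>c\<in>S. to_closure (q b c) * c)"
      unfolding rs[OF that] sum_distrib_left q_def
      by (simp add: to_closure_hom.hom_add to_closure_hom.hom_mult algebra_simps sum.distrib)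
    finally show ?thesis .
  qed
  obtain n e where ne: "bij_betw e {..<n} S"
    "poly (map_poly to_closure (char_poly (mat n n (\<lambda>(i, j). q (e i) (e j))))) 1 = 0"
    using char_poly_stable[OF S(1,2) one_neq_zero q] .
  define M where "M = mat n n (\<lambda>(i, j). q (e i) (e j))"
  have "to_closure (poly (char_poly M) 1) = to_closure 0"
    using ne(2) by (simp add: M_def to_closure_hom.poly_map_poly_1 to_closure_hom.hom_zero)
  then have "poly (char_poly M) 1 = 0" by (simp only: to_closure_eq_iff)
  then have "poly (char_poly (map_mat residue_hom M)) 1 = residue_hom 0"
    using residue_hom.char_poly_hom[of M n] residue_hom.poly_map_poly_1[of "char_poly M"]
    by (simp add: M_def)
  moreover have "map_mat residue_hom M = 0\<^sub>m n n"
    by (intro eq_matI)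
      (auto simp: M_def q_def residue_hom.hom_add residue_hom.hom_mult residue_hom_p residue_hom_X)
  moreover have "poly (char_poly (0\<^sub>m n n :: 'p mod_ring mat)) 1 = 1"
    by (subst char_poly_upper_triangular[of _ n]) (auto simp: poly_prod_list diag_mat_def comp_def prod_list_neutral intro!: prod_list_neutral)
  ultimately show False by (simp add: residue_hom.hom_zero)
qed

section \<open>Purity\<close>

lemma module_self: "module ring_of_type_algebra (self_module :: ('a::idom, 'a) module)"
proof (rule moduleI)
  show "cring (ring_of_type_algebra :: 'a ring)" by (rule cring_from_type_algebra)
  show "abelian_group (self_module :: ('a, 'a) module)"
  proof (rule abelian_groupI)
    fix x assume "x \<in> carrier (self_module :: ('a, 'a) module)"
    show "\<exists>y\<in>carrier self_module. y \<oplus>\<^bsub>self_module\<^esub> x = \<zero>\<^bsub>self_module\<^esub>"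
      by (intro bexI[of _ "- x"]) (auto simp: self_module_def)
  qed (auto simp: self_module_def algebra_simps)
qed (auto simp: self_module_def ring_of_type_algebra_def algebra_simps)

lemma module_plus:
  "module ring_of_type_algebra (plus_module :: ('a::idom, 'a fract alg_closure) module)"
proof (rule moduleI)
  show "cring (ring_of_type_algebra :: 'a ring)" by (rule cring_from_type_algebra)
  show "abelian_group (plus_module :: ('a, 'a fract alg_closure) module)"
  proof (rule abelian_groupI)
    fix x assume "x \<in> carrier (plus_module :: ('a, 'a fract alg_closure) module)"
    then show "\<exists>y\<in>carrier plus_module. y \<oplus>\<^bsub>plus_module\<^esub> x = \<zero>\<^bsub>plus_module\<^esub>"
      by (intro bexI[of _ "- x"]) (auto simp: plus_module_def)
  qed (auto simp: plus_module_def algebra_simps)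
qed (auto simp: plus_module_def ring_of_type_algebra_def algebra_simps to_closure_hom.hom_add
      to_closure_hom.hom_mult to_closure_hom.hom_one to_closure_abs_int_closure)

lemma linear_map_multiple:
  "w \<in> abs_int_closure \<Longrightarrow>
    linear_map ring_of_type_algebra self_module plus_module (\<lambda>s :: 'a::idom. to_closure s * w)"
  by (auto simp: linear_map_def self_module_def plus_module_def to_closure_abs_int_closure
      to_closure_hom.hom_add to_closure_hom.hom_mult algebra_simps)

lemma pure_map_of_splitting:
  fixes w :: "'a::idom fract alg_closure"
  assumes w: "w \<in> abs_int_closure"
    and \<psi>: "linear_map ring_of_type_algebra plus_module self_module \<psi>"
    and split: "\<And>s :: 'a. \<psi> (to_closure s * w) = s"
  shows "pure_map ring_of_type_algebra self_module plus_module (\<lambda>s :: 'a. to_closure s * w)"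
  unfolding pure_map_def
proof (intro allI impI)
  fix Q :: "('a, (nat \<Rightarrow> 'a) set) module"
  assume Q: "module ring_of_type_algebra Q"
  let ?\<phi> = "\<lambda>s :: 'a. to_closure s * w"
  show "inj_on (tensor_map ring_of_type_algebra plus_module Q ?\<phi>)
      (carrier (tensor_product ring_of_type_algebra self_module Q))"
    unfolding tensor_map_inj_iff[OF module_self module_plus Q linear_map_multiple[OF w]]
  proof (intro allI impI)
    fix u
    assume "frag_map (map_prod ?\<phi> id) u \<in> tensor_kernel ring_of_type_algebra plus_module Q"
    then have "frag_map (map_prod \<psi> id) (frag_map (map_prod ?\<phi> id) u)
        \<in> tensor_kernel ring_of_type_algebra self_module Q"
      by (rule tensor_kernel_map[OF module_plus Q module_self Q \<psi> linear_map_id])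
    also have "frag_map (map_prod \<psi> id) (frag_map (map_prod ?\<phi> id) u) = frag_extend frag_of u"
      unfolding frag_extend_compose comp_assoc map_prod.comp
      by (rule frag_extend_eq) (auto simp: split)
    also have "\<dots> = u" by (rule frag_expansion[symmetric])
    finally show "u \<in> tensor_kernel ring_of_type_algebra self_module Q" .
  qed
qed

section \<open>Failure of purity for w in (p, x) T\<close>

definition residue_module :: "('p::prime_card padic_int fps, 'p mod_ring) module" where
  "residue_module =
     \<lparr>carrier = UNIV, monoid.mult = (*), one = 1, ring.zero = 0, add = (+),
      module.smult = (\<lambda>r c. residue_hom r * c)\<rparr>"

lemma module_residue:
  "module ring_of_type_algebra (residue_module :: ('p::prime_card padic_int fps, 'p mod_ring) module)"
proof (rule moduleI)
  show "cring (ring_of_type_algebra :: 'p padic_int fps ring)" by (rule cring_from_type_algebra)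
  show "abelian_group (residue_module :: ('p padic_int fps, 'p mod_ring) module)"
  proof (rule abelian_groupI)
    fix x assume "x \<in> carrier (residue_module :: ('p padic_int fps, 'p mod_ring) module)"
    show "\<exists>y\<in>carrier (residue_module :: ('p padic_int fps, 'p mod_ring) module).
        y \<oplus>\<^bsub>residue_module :: ('p padic_int fps, 'p mod_ring) module\<^esub> x
        = \<zero>\<^bsub>residue_module :: ('p padic_int fps, 'p mod_ring) module\<^esub>"
      by (intro bexI[of _ "- x"]) (auto simp: residue_module_def)
  qed (auto simp: residue_module_def algebra_simps)
qed (auto simp: residue_module_def ring_of_type_algebra_def algebra_simps residue_hom.hom_add
      residue_hom.hom_mult residue_hom.hom_one)

text \<open>A test for nonvanishing of tensors: when \<beta> is biadditive and balanced, it kills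
  all relators.\<close>

definition frag_eval :: "('i \<Rightarrow> 'b::comm_ring_1) \<Rightarrow> ('i \<Rightarrow>\<^sub>0 int) \<Rightarrow> 'b" where
  "frag_eval \<beta> u = (\<Sum>k\<in>Poly_Mapping.keys u. of_int (Poly_Mapping.lookup u k) * \<beta> k)"

lemma frag_eval_superset:
  assumes "finite K" "Poly_Mapping.keys u \<subseteq> K"
  shows "frag_eval \<beta> u = (\<Sum>k\<in>K. of_int (Poly_Mapping.lookup u k) * \<beta> k)"
  unfolding frag_eval_def using assms by (intro sum.mono_neutral_left) (auto simp: in_keys_iff)

lemma frag_eval_add: "frag_eval \<beta> (u + v) = frag_eval \<beta> u + frag_eval \<beta> v"
proof -
  let ?K = "Poly_Mapping.keys u \<union> Poly_Mapping.keys v"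
  have "finite ?K" "Poly_Mapping.keys (u + v) \<subseteq> ?K" using Poly_Mapping.keys_add[of u v] by auto
  then show ?thesis
    by (simp add: frag_eval_superset[of ?K] lookup_add distrib_right sum.distrib)
qed

lemma frag_eval_uminus: "frag_eval \<beta> (- u) = - frag_eval \<beta> u"
  by (simp add: frag_eval_def sum_negf)

lemma frag_eval_diff: "frag_eval \<beta> (u - v) = frag_eval \<beta> u - frag_eval \<beta> v"
  using frag_eval_add[of \<beta> u "- v"] by (simp add: frag_eval_uminus)

lemma frag_eval_of [simp]: "frag_eval \<beta> (frag_of k) = \<beta> k"
  by (simp add: frag_eval_def)

text \<open>If \<open>w = p A + x B\<close>, then \<open>w \<otimes> 1 = 0\<close> in \<open>R\<^sup>+ \<otimes> \<F>\<^sub>p\<close> although \<open>1 \<otimes> 1 \<noteq> 0\<close> in \<open>R \<otimes> \<F>\<^sub>p\<close>.\<close>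

lemma not_pure_map:
  fixes A B :: "'p::prime_card padic_int fps fract alg_closure"
  assumes A: "A \<in> abs_int_closure" and B: "B \<in> abs_int_closure"
    and w: "w = to_closure (of_nat CARD('p)) * A + to_closure fps_X * B"
  shows "\<not> pure_map ring_of_type_algebra self_module plus_module
    (\<lambda>s :: 'p padic_int fps. to_closure s * w)"
proof
  let ?R = "ring_of_type_algebra :: 'p padic_int fps ring"
  let ?Q = "residue_module :: ('p padic_int fps, 'p mod_ring) module"
  let ?S = "self_module :: ('p padic_int fps, 'p padic_int fps) module"
  let ?P = "plus_module :: ('p padic_int fps, 'p padic_int fps fract alg_closure) module"
  let ?\<phi> = "\<lambda>s :: 'p padic_int fps. to_closure s * w"
  assume pure: "pure_map ?R ?S ?P ?\<phi>"
  have wT: "w \<in> abs_int_closure"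
    using A B unfolding w by (intro abs_int_closure.add_mem abs_int_closure.mult_mem to_closure_abs_int_closure)
  \<comment> \<open>The residue module lives on another type than the one fixed in
    \<open>pure_map\<close>, so injectivity has to be transferred to it.\<close>
  note inj = pure_map_inj[OF module_self module_plus module_residue linear_map_multiple[OF wT] pure,
      unfolded tensor_map_inj_iff[OF module_self module_plus module_residue linear_map_multiple[OF wT]]]
  define K where "K = tensor_kernel ?R ?P ?Q"
  have KI: "u \<in> K" if "u \<in> tensor_relators ?R ?P ?Q" for u
    using that unfolding K_def by (rule tensor_kernel_rel)
  have K_add: "u + v \<in> K" if "u \<in> K" "v \<in> K" for u v
    using that unfolding K_def by (rule tensor_kernel_add)
  have zero: "frag_of (y, 0) \<in> K" if "y \<in> abs_int_closure" for y
  proof -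
    have "frag_of (y, 0 \<oplus>\<^bsub>?Q\<^esub> 0) - frag_of (y, 0) - frag_of (y, 0) \<in> tensor_relators ?R ?P ?Q"
      using that by (intro tensor_relators_intros(2)) (auto simp: plus_module_def residue_module_def)
    then have "frag_of (y, 0) - frag_of (y, 0) - frag_of (y, 0) \<in> K"
      using KI by (simp add: residue_module_def)
    then have "- (frag_of (y, 0) - frag_of (y, 0) - frag_of (y, 0)) \<in> K"
      unfolding K_def by (intro tensor_kernel_neg module_plus module_residue)
    then show ?thesis by simp
  qed
  have mult: "frag_of (to_closure r * y, 1) \<in> K" if "y \<in> abs_int_closure" "residue_hom r = 0" for r y
  proof -
    have "frag_of (r \<odot>\<^bsub>?P\<^esub> y, 1) - frag_of (y, r \<odot>\<^bsub>?Q\<^esub> 1) \<in> tensor_relators ?R ?P ?Q"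
      using that by (intro tensor_relators_intros(3))
        (auto simp: plus_module_def residue_module_def ring_of_type_algebra_def)
    then have "frag_of (to_closure r * y, 1) - frag_of (y, 0) \<in> K"
      using KI that by (simp add: residue_module_def plus_module_def)
    from K_add[OF this zero[OF that(1)]] show ?thesis by simp
  qed
  let ?a = "to_closure (of_nat CARD('p)) * A" and ?b = "to_closure fps_X * B"
  have "frag_of (?a \<oplus>\<^bsub>?P\<^esub> ?b, 1) - frag_of (?a, 1) - frag_of (?b, 1) \<in> tensor_relators ?R ?P ?Q"
    using A B by (intro tensor_relators_intros(1))
      (auto simp: plus_module_def residue_module_def to_closure_abs_int_closure)
  then have "frag_of (w, 1) - frag_of (?a, 1) - frag_of (?b, 1) \<in> K"
    using KI by (simp add: plus_module_def w)
  from K_add[OF K_add[OF this mult[OF A residue_hom_p]] mult[OF B residue_hom_X]]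
  have "frag_of (w, 1) \<in> K" by simp
  then have "frag_map (map_prod ?\<phi> id) (frag_of (1, 1)) \<in> tensor_kernel ?R ?P ?Q"
    by (simp add: K_def to_closure_hom.hom_one)
  then have "frag_of (1, 1) \<in> tensor_kernel ?R ?S ?Q"
    using inj by (auto simp: self_module_def residue_module_def)
  then have "frag_eval (\<lambda>(r, c). residue_hom r * c) (frag_of (1, 1)
      :: ('p padic_int fps \<times> 'p mod_ring) \<Rightarrow>\<^sub>0 int) = 0"
  proof (rule tensor_kernel_induct[OF module_self module_residue])
    fix u assume "u \<in> tensor_relators ?R ?S ?Q"
    then show *: "frag_eval (\<lambda>(r, c). residue_hom r * c) u = 0"
      unfolding tensor_relators_def
      by safe (simp_all add: frag_eval_diff frag_eval_add self_module_def residue_module_def residue_hom.hom_add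
          residue_hom.hom_mult algebra_simps)
    then show "frag_eval (\<lambda>(r, c). residue_hom r * c) (- u) = 0"
      by (simp add: frag_eval_uminus)
  next
    show "frag_eval (\<lambda>(r, c). residue_hom r * c) 0 = 0" by (simp add: frag_eval_def)
  qed (auto simp: frag_eval_add)
  then show False by (simp add: residue_hom.hom_one)
qed


section \<open>A splitting for w outside (p, x) T\<close>

context
  fixes \<pi> \<xi> w :: "'p::prime_card padic_int fps fract alg_closure"
    and T :: "'p padic_int fps fract alg_closure set"
  defines "\<pi> \<equiv> to_closure (of_nat CARD('p))" and "\<xi> \<equiv> to_closure fps_X"
    and "T \<equiv> abs_int_closure"
  assumes w: "w \<in> T"
    and w_notin: "\<And>A B. A \<in> T \<Longrightarrow> B \<in> T \<Longrightarrow> w \<noteq> \<pi> * A + \<xi> * B"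
begin

lemma \<pi>_eq: "\<pi> = of_nat CARD('p)" "\<pi> = of_int (int CARD('p))"
  by (simp_all add: \<pi>_def to_closure_hom.hom_of_nat)

lemma PX_nonzero: "\<pi> \<noteq> 0" "\<xi> \<noteq> 0"
proof -
  have "(of_nat CARD('p) :: 'p padic_int fps) = fps_const (of_nat CARD('p))"
    by (simp add: fps_of_nat)
  then have "(of_nat CARD('p) :: 'p padic_int fps) \<noteq> 0" by simp
  then show "\<pi> \<noteq> 0" unfolding \<pi>_def by (metis to_closure_eq_iff to_closure_hom.hom_zero)
  show "\<xi> \<noteq> 0" unfolding \<xi>_def by (metis to_closure_eq_iff to_closure_hom.hom_zero fps_X_neq_zero)
qed

lemma T_closure: "to_closure r \<in> T" "\<pi> \<in> T" "\<xi> \<in> T"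
  by (simp_all add: T_def \<pi>_def \<xi>_def to_closure_abs_int_closure)

lemma T_mult: "x \<in> T \<Longrightarrow> y \<in> T \<Longrightarrow> x * y \<in> T" and T_add: "x \<in> T \<Longrightarrow> y \<in> T \<Longrightarrow> x + y \<in> T"
  and T_diff: "x \<in> T \<Longrightarrow> y \<in> T \<Longrightarrow> x - y \<in> T" and T_power: "x \<in> T \<Longrightarrow> x ^ n \<in> T"
  and T_0: "0 \<in> T"
  unfolding T_def by (rule abs_int_closure.mult_mem abs_int_closure.add_mem
      abs_int_closure.diff_mem abs_int_closure.power_mem abs_int_closure.zero_mem; assumption?)+

lemma regular_powers: "\<pi> ^ k * t \<in> T \<Longrightarrow> \<xi> ^ l * t \<in> T \<Longrightarrow> t \<in> T"
proof (induction k arbitrary: t)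
  case (Suc k)
  have "\<pi> ^ k * (\<pi> * t) \<in> T" using Suc.prems by (simp add: mult_ac)
  moreover have "\<xi> ^ l * (\<pi> * t) \<in> T"
    using T_mult[OF T_closure(2) Suc.prems(2)] by (simp add: mult_ac)
  ultimately have Pt: "\<pi> * t \<in> T" by (rule Suc.IH)
  from Suc.prems(2) Pt show "t \<in> T"
  proof (induction l arbitrary: t)
    case (Suc l)
    have "\<xi> ^ l * (\<xi> * t) \<in> T" using Suc.prems by (simp add: mult_ac)
    moreover have "\<pi> * (\<xi> * t) \<in> T"
      using T_mult[OF T_closure(3) Suc.prems(2)] by (simp add: mult_ac)
    ultimately have "\<xi> * t \<in> T" by (rule Suc.IH)
    with Suc.prems(2) show ?case unfolding T_def \<pi>_def \<xi>_def
      by (rule abs_int_closure_regular)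
  qed simp
qed simp

text \<open>The subgroup \<open>T[1/p] + T[1/x]\<close>.\<close>

definition torsion :: "'p padic_int fps fract alg_closure set" where
  "torsion = {g + h | g h k l. \<pi> ^ k * g \<in> T \<and> \<xi> ^ l * h \<in> T}"

lemma torsionI: "\<pi> ^ k * g \<in> T \<Longrightarrow> g \<in> torsion" "\<xi> ^ l * h \<in> T \<Longrightarrow> h \<in> torsion"
proof -
  assume "\<pi> ^ k * g \<in> T"
  then show "g \<in> torsion" unfolding torsion_def
    by (intro CollectI exI[of _ g] exI[of _ 0] exI[of _ k]) (auto simp: T_0)
next
  assume "\<xi> ^ l * h \<in> T"
  then show "h \<in> torsion" unfolding torsion_def
    by (intro CollectI exI[of _ 0] exI[of _ h] exI[of _ k] exI[of _ l]) (auto simp: T_0)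
qed

lemma torsion_diff: "x \<in> torsion \<Longrightarrow> y \<in> torsion \<Longrightarrow> x - y \<in> torsion"
proof -
  assume "x \<in> torsion" "y \<in> torsion"
  then obtain g h k l g' h' k' l' where *: "x = g + h" "\<pi> ^ k * g \<in> T" "\<xi> ^ l * h \<in> T"
    "y = g' + h'" "\<pi> ^ k' * g' \<in> T" "\<xi> ^ l' * h' \<in> T" unfolding torsion_def by blast
  have "\<pi> ^ (k + k') * (g - g') = \<pi> ^ k' * (\<pi> ^ k * g) - \<pi> ^ k * (\<pi> ^ k' * g')"
    "\<xi> ^ (l + l') * (h - h') = \<xi> ^ l' * (\<xi> ^ l * h) - \<xi> ^ l * (\<xi> ^ l' * h')"
    by (simp_all add: power_add algebra_simps)
  then have "\<pi> ^ (k + k') * (g - g') \<in> T" "\<xi> ^ (l + l') * (h - h') \<in> T"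
    using T_diff[OF T_mult[OF T_power[OF T_closure(2)] *(2)] T_mult[OF T_power[OF T_closure(2)] *(5)]]
      T_diff[OF T_mult[OF T_power[OF T_closure(3)] *(3)] T_mult[OF T_power[OF T_closure(3)] *(6)]]
    by (simp_all only:)
  moreover have "x - y = (g - g') + (h - h')" using * by simp
  ultimately show ?thesis unfolding torsion_def by blast
qed

text \<open>Let w/(p x) = g + h. Then p x g lies in T[1/p] and, being w - p x h, also in T[1/x],
  hence in T. Applying regularity once more puts p g and x h in T, so that w = p (x h) + x (p g)
  lies in (p, x) T.\<close>

lemma socle_notin_torsion: "w / (\<pi> * \<xi>) \<notin> torsion"
proof
  assume "w / (\<pi> * \<xi>) \<in> torsion"
  then obtain g h k l where gh: "w / (\<pi> * \<xi>) = g + h" "\<pi> ^ k * g \<in> T" "\<xi> ^ l * h \<in> T"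
    unfolding torsion_def by blast
  then have weq: "w = \<xi> * (\<pi> * g) + \<pi> * (\<xi> * h)" using PX_nonzero by (simp add: field_simps)
  have "\<pi> ^ k * (\<xi> * (\<pi> * g)) = \<pi> * \<xi> * (\<pi> ^ k * g)" "\<xi> ^ l * (\<pi> * (\<xi> * h)) = \<pi> * \<xi> * (\<xi> ^ l * h)"
    by (simp_all add: mult_ac)
  then have 1: "\<pi> ^ k * (\<xi> * (\<pi> * g)) \<in> T" "\<xi> ^ l * (\<pi> * (\<xi> * h)) \<in> T"
    using T_mult[OF T_mult[OF T_closure(2,3)] gh(2)] T_mult[OF T_mult[OF T_closure(2,3)] gh(3)]
    by (simp_all only:)
  have "\<xi> ^ l * (\<xi> * (\<pi> * g)) = \<xi> ^ l * w - \<xi> ^ l * (\<pi> * (\<xi> * h))"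
    unfolding weq by (simp add: algebra_simps)
  then have "\<xi> ^ l * (\<xi> * (\<pi> * g)) \<in> T" using 1 w by (simp add: T_diff T_mult T_power T_closure(3))
  with 1(1) have y: "\<xi> * (\<pi> * g) \<in> T" by (rule regular_powers)
  have "\<pi> * (\<xi> * h) = w - \<xi> * (\<pi> * g)" unfolding weq by simp
  then have y': "\<pi> * (\<xi> * h) \<in> T" using y w by (auto intro: T_diff)
  have "\<pi> ^ k * (\<pi> * g) = \<pi> * (\<pi> ^ k * g)" by (simp add: mult_ac)
  then have "\<pi> * g \<in> T" using regular_powers[of k "\<pi> * g" 1] y T_mult[OF T_closure(2) gh(2)]
    by (simp add: mult.left_commute)
  moreover have "\<xi> ^ l * (\<xi> * h) = \<xi> * (\<xi> ^ l * h)" by (simp add: mult_ac)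
  then have "\<xi> * h \<in> T" using regular_powers[of 1 "\<xi> * h" l] y' T_mult[OF T_closure(3) gh(3)]
    by (metis power_one_right)
  ultimately show False using w_notin[of "\<xi> * h" "\<pi> * g"] weq by (simp add: add.commute)
qed

text \<open>Maximality among subgroups makes the p-power torsion modulo N as small as possible: a
  Pruefer group. N need not be a submodule; linearity over R is recovered by recording coordinates
  for all powers of x.\<close>

lemma ex_maximal_subgroup:
  obtains N where "torsion \<subseteq> N" "w / (\<pi> * \<xi>) \<notin> N" "\<And>x y. x \<in> N \<Longrightarrow> y \<in> N \<Longrightarrow> x - y \<in> N"
    "\<And>N'. N \<subseteq> N' \<Longrightarrow> w / (\<pi> * \<xi>) \<notin> N' \<Longrightarrow> (\<And>x y. x \<in> N' \<Longrightarrow> y \<in> N' \<Longrightarrow> x - y \<in> N') \<Longrightarrow> N' = N"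
proof -
  define \<A> where "\<A> = {N. torsion \<subseteq> N \<and> w / (\<pi> * \<xi>) \<notin> N \<and> (\<forall>x\<in>N. \<forall>y\<in>N. x - y \<in> N)}"
  have "\<exists>M\<in>\<A>. \<forall>N\<in>\<A>. M \<subseteq> N \<longrightarrow> N = M"
  proof (rule subset_Zorn_nonempty)
    show "\<A> \<noteq> {}" using socle_notin_torsion torsion_diff by (auto simp: \<A>_def)
  next
    fix \<C> assume \<C>: "\<C> \<noteq> {}" "subset.chain \<A> \<C>"
    have "x - y \<in> \<Union>\<C>" if "x \<in> \<Union>\<C>" "y \<in> \<Union>\<C>" for x y
    proof -
      from that obtain M N where MN: "M \<in> \<C>" "x \<in> M" "N \<in> \<C>" "y \<in> N" by blast
      then have "M \<subseteq> N \<or> N \<subseteq> M" "M \<in> \<A>" "N \<in> \<A>"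
        using \<C>(2) unfolding subset.chain_def by blast+
      then show ?thesis using MN unfolding \<A>_def by blast
    qed
    moreover have "torsion \<subseteq> M \<and> w / (\<pi> * \<xi>) \<notin> M" if "M \<in> \<C>" for M
      using \<C>(2) that unfolding \<A>_def subset.chain_def by auto
    then have "torsion \<subseteq> \<Union>\<C>" "w / (\<pi> * \<xi>) \<notin> \<Union>\<C>" using \<C>(1) by auto
    ultimately show "\<Union>\<C> \<in> \<A>" by (simp add: \<A>_def)
  qed
  then obtain M where M: "M \<in> \<A>" "\<And>N. N \<in> \<A> \<Longrightarrow> M \<subseteq> N \<Longrightarrow> N = M" by blast
  show thesis
  proof (rule that[of M])
    fix N' assume "M \<subseteq> N'" "w / (\<pi> * \<xi>) \<notin> N'" "\<And>x y. x \<in> N' \<Longrightarrow> y \<in> N' \<Longrightarrow> x - y \<in> N'"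
    then show "N' = M" using M(1) by (intro M(2)) (auto simp: \<A>_def)
  qed (use M(1) in \<open>auto simp: \<A>_def\<close>)
qed

context
  fixes N
  assumes N: "torsion \<subseteq> N" "w / (\<pi> * \<xi>) \<notin> N" "\<And>x y. x \<in> N \<Longrightarrow> y \<in> N \<Longrightarrow> x - y \<in> N"
    and N_max: "\<And>N'. N \<subseteq> N' \<Longrightarrow> w / (\<pi> * \<xi>) \<notin> N' \<Longrightarrow>
      (\<And>x y. x \<in> N' \<Longrightarrow> y \<in> N' \<Longrightarrow> x - y \<in> N') \<Longrightarrow> N' = N"
begin

lemma N_0: "0 \<in> N"
  using torsionI(1)[of 0 0] T_0 N(1) by auto

lemma N_uminus: "x \<in> N \<Longrightarrow> - x \<in> N"
  using N(3)[OF N_0, of x] by simp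

lemma N_add: "x \<in> N \<Longrightarrow> y \<in> N \<Longrightarrow> x + y \<in> N"
  using N(3)[of x "- y"] N_uminus by simp

lemma N_of_int: "x \<in> N \<Longrightarrow> of_int c * x \<in> N"
proof (induction c rule: int_induct[where k = 0])
  case (step1 i)
  then show ?case using N_add[of "of_int i * x" x] by (simp add: algebra_simps)
next
  case (step2 i)
  then show ?case using N(3)[of "of_int i * x" x] by (simp add: algebra_simps)
qed (auto simp: N_0)

lemma N_sum: "(\<And>i. i \<in> I \<Longrightarrow> f i \<in> N) \<Longrightarrow> sum f I \<in> N"
  by (induction I rule: infinite_finite_induct) (auto intro: N_0 N_add)

lemma N_P_power: "x \<in> N \<Longrightarrow> \<pi> ^ n * x \<in> N"
  using N_of_int[of x "int CARD('p) ^ n"] by (simp add: \<pi>_eq(1))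

lemma N_torsion: "\<pi> ^ k * g \<in> T \<Longrightarrow> g \<in> N" "\<xi> ^ l * g \<in> T \<Longrightarrow> g \<in> N"
  using torsionI N(1) by blast+

definition socle_root :: "nat \<Rightarrow> 'p padic_int fps fract alg_closure" where
  "socle_root n = w / (\<pi> ^ n * \<xi>)"

lemma socle_root_P: "\<pi> ^ k * socle_root (k + n) = socle_root n"
  using PX_nonzero by (simp add: socle_root_def power_add)

lemma socle_root_Suc: "\<pi> * socle_root (Suc n) = socle_root n"
  using socle_root_P[of 1 n] by simp

lemma socle_root_0: "socle_root 0 \<in> N"
  by (rule N_torsion(2)[of 1]) (use PX_nonzero w in \<open>auto simp: socle_root_def\<close>)

lemma socle_root_1: "socle_root (Suc 0) \<notin> N"
  using N(2) by (simp add: socle_root_def)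

lemma prime_bezout:
  assumes "\<not> int CARD('p) dvd c"
  obtains u v where "u * c + v * int CARD('p) = 1"
proof -
  have "coprime (int CARD('p)) c"
    using assms prime_card_int[where ?'a = 'p] by (intro prime_imp_coprime)
  then show thesis using that by (metis bezout_int coprime_commute coprime_imp_gcd_eq_1)
qed

text \<open>With \<open>socle_root_0\<close>, this shows that w/(p^n x) has order exactly p^n modulo
  N, which makes coordinates unique modulo p^n.\<close>

lemma socle_root_order: "of_int c * socle_root n \<in> N \<Longrightarrow> int CARD('p) ^ n dvd c"
proof (induction n arbitrary: c)
  case (Suc n)
  have "of_int c * socle_root (Suc 0) \<in> N"
    using N_P_power[OF Suc.prems, of n] socle_root_P[of n "Suc 0"] by (simp add: mult.left_commute)
  have "int CARD('p) dvd c"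
  proof (rule ccontr)
    assume "\<not> ?thesis"
    then obtain u v where uv: "u * c + v * int CARD('p) = 1" by (rule prime_bezout)
    have "socle_root (Suc 0) = of_int (u * c + v * int CARD('p)) * socle_root (Suc 0)"
      unfolding uv by simp
    also have "\<dots> = of_int u * (of_int c * socle_root (Suc 0)) + of_int v * socle_root 0"
      unfolding socle_root_Suc[of 0, symmetric] by (simp add: \<pi>_eq(1) algebra_simps)
    also have "\<dots> \<in> N"
      by (rule N_add[OF N_of_int[OF \<open>of_int c * socle_root (Suc 0) \<in> N\<close>] N_of_int[OF socle_root_0]])
    finally show False using socle_root_1 by blast
  qed
  then obtain d where d: "c = int CARD('p) * d" by (elim dvdE)
  have "of_int d * socle_root n \<in> N"
    using Suc.prems unfolding socle_root_Suc[of n, symmetric] d by (simp add: \<pi>_eq(1) mult_ac)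
  then have "int CARD('p) ^ n dvd d" by (rule Suc.IH)
  then show ?case unfolding d by (simp add: mult_dvd_mono)
qed simp

text \<open>This is where maximality of N is used. The element p^k g is killed by p modulo N, hence
  a multiple of w/(p x); subtracting the matching multiple of w/(p^(k+1) x) from g lowers k.\<close>

lemma ex_socle_root_multiple: "\<pi> ^ k * g \<in> N \<Longrightarrow> \<exists>c. g - of_int c * socle_root k \<in> N"
proof (induction k arbitrary: g)
  case 0
  then show ?case by (intro exI[of _ 0]) simp
next
  case (Suc k)
  define h where "h = \<pi> ^ k * g"
  have Ph: "\<pi> * h \<in> N" using Suc.prems by (simp add: h_def mult_ac)
  have lift: "\<exists>c. g - of_int c * socle_root (Suc k) \<in> N"
    if "g - of_int u * socle_root (Suc k) - of_int c * socle_root k \<in> N" for u c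
    using that unfolding socle_root_Suc[of k, symmetric]
    by (intro exI[of _ "u + c * int CARD('p)"]) (simp add: \<pi>_eq(1) algebra_simps)
  show ?case
  proof (cases "h \<in> N")
    case True
    then obtain c where "g - of_int c * socle_root k \<in> N" using Suc.IH h_def by blast
    then show ?thesis using lift[of 0 c] by simp
  next
    case False
    \<comment> \<open>N' is the subgroup generated by N and h. It contains w/(p x) by maximality,
      and this relation can be solved for h.\<close>
    define N' where "N' = {\<nu> + of_int c * h | \<nu> c. \<nu> \<in> N}"
    have "N' \<noteq> N"
    proof -
      have "0 + of_int 1 * h \<in> N'" using N_0 unfolding N'_def by blast
      then show ?thesis using False by auto
    qed
    moreover have "N \<subseteq> N'"
    proof
      fix x assume "x \<in> N"
      then show "x \<in> N'" unfolding N'_def by (intro CollectI exI[of _ x] exI[of _ 0]) simp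
    qed
    moreover have "x - y \<in> N'" if "x \<in> N'" "y \<in> N'" for x y
    proof -
      from that obtain \<nu> c \<nu>' c' where "x = \<nu> + of_int c * h" "\<nu> \<in> N" "y = \<nu>' + of_int c' * h" "\<nu>' \<in> N"
        unfolding N'_def by blast
      then have "x - y = (\<nu> - \<nu>') + of_int (c - c') * h" "\<nu> - \<nu>' \<in> N"
        using N(3) by (auto simp: algebra_simps)
      then show ?thesis unfolding N'_def by blast
    qed
    ultimately have "w / (\<pi> * \<xi>) \<in> N'" using N_max[of N'] by blast
    then obtain \<nu> c where \<nu>: "\<nu> \<in> N" "socle_root (Suc 0) = \<nu> + of_int c * h"
      unfolding N'_def by (auto simp: socle_root_def)
    have "\<not> int CARD('p) dvd c"
    proof
      assume "int CARD('p) dvd c"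
      then obtain d where d: "c = int CARD('p) * d" by (elim dvdE)
      have "of_int c * h = of_int d * (\<pi> * h)" unfolding d by (simp add: \<pi>_eq(1) mult_ac)
      have "socle_root (Suc 0) \<in> N"
        unfolding \<nu>(2) \<open>of_int c * h = _\<close> by (intro N_add \<nu>(1) N_of_int Ph)
      then show False using socle_root_1 by simp
    qed
    then obtain u v where uv: "u * c + v * int CARD('p) = 1" by (rule prime_bezout)
    \<comment> \<open>As u inverts c modulo p, this subtraction moves p^k times the element into
      N.\<close>
    have "\<pi> ^ k * (g - of_int u * socle_root (Suc k)) = h - of_int u * socle_root (Suc 0)"
      using socle_root_P[of k "Suc 0"] by (simp add: h_def algebra_simps)
    also have "\<dots> = of_int (u * c + v * int CARD('p)) * h - of_int u * socle_root (Suc 0)"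
      unfolding uv by simp
    also have "\<dots> = of_int v * (\<pi> * h) - of_int u * \<nu>"
      unfolding \<nu>(2) by (simp add: \<pi>_eq(1) algebra_simps)
    also have "\<dots> \<in> N" using N_of_int Ph \<nu>(1) N(3) by blast
    finally obtain c' where "g - of_int u * socle_root (Suc k) - of_int c' * socle_root k \<in> N"
      using Suc.IH by blast
    then show ?thesis by (rule lift)
  qed
qed

text \<open>
  Modulo \<open>N\<close>, the elements of \<open>p\<close>-power torsion form a Pruefer group generated by the \<open>w/(p\<^sup>n x)\<close>.  The
  coefficient of \<open>x\<^sup>i\<close> modulo \<open>p\<^sup>n\<close> is read off from the class of \<open>z/(p\<^sup>n x\<^sup>i\<^sup>+\<^sup>1)\<close>.
\<close>

definition coord :: "'p padic_int fps fract alg_closure \<Rightarrow> nat \<Rightarrow> nat \<Rightarrow> int" where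
  "coord z i n = (SOME c. c \<in> {0..<int CARD('p) ^ n} \<and>
     z / (\<pi> ^ n * \<xi> ^ Suc i) - of_int c * socle_root n \<in> N)"

lemma socle_root_mod:
  "of_int c * socle_root n - of_int (c mod int CARD('p) ^ n) * socle_root n \<in> N"
proof -
  have "of_int c * socle_root n - of_int (c mod int CARD('p) ^ n) * socle_root n
      = of_int (c - c mod int CARD('p) ^ n) * socle_root n"
    by (simp add: algebra_simps)
  also have "c - c mod int CARD('p) ^ n = c div int CARD('p) ^ n * int CARD('p) ^ n"
    by (simp add: minus_mod_eq_div_mult)
  also have "of_int (c div int CARD('p) ^ n * int CARD('p) ^ n) * socle_root n
      = of_int (c div int CARD('p) ^ n) * (\<pi> ^ n * socle_root (n + 0))"
    by (simp add: \<pi>_eq(1) mult.assoc)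
  also have "\<dots> \<in> N" unfolding socle_root_P by (intro N_of_int socle_root_0)
  finally show ?thesis .
qed

lemma coord:
  assumes z: "z \<in> T"
  shows "coord z i n \<in> {0..<int CARD('p) ^ n}"
    and "z / (\<pi> ^ n * \<xi> ^ Suc i) - of_int (coord z i n) * socle_root n \<in> N"
proof -
  have "\<pi> ^ n * (z / (\<pi> ^ n * \<xi> ^ Suc i)) \<in> N"
    by (rule N_torsion(2)[of "Suc i"]) (use PX_nonzero z in auto)
  then obtain c where c: "z / (\<pi> ^ n * \<xi> ^ Suc i) - of_int c * socle_root n \<in> N"
    using ex_socle_root_multiple by blast
  have "z / (\<pi> ^ n * \<xi> ^ Suc i) - of_int (c mod int CARD('p) ^ n) * socle_root n \<in> N"
    using N_add[OF c socle_root_mod[of c n]] by simp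
  then have "\<exists>c. c \<in> {0..<int CARD('p) ^ n} \<and> z / (\<pi> ^ n * \<xi> ^ Suc i) - of_int c * socle_root n \<in> N"
    by (intro exI[of _ "c mod int CARD('p) ^ n"]) auto
  from someI_ex[OF this]
  show "coord z i n \<in> {0..<int CARD('p) ^ n}"
    "z / (\<pi> ^ n * \<xi> ^ Suc i) - of_int (coord z i n) * socle_root n \<in> N"
    unfolding coord_def by blast+
qed

lemma coord_unique:
  assumes z: "z \<in> T" and c: "z / (\<pi> ^ n * \<xi> ^ Suc i) - of_int c * socle_root n \<in> N"
  shows "coord z i n = c mod int CARD('p) ^ n"
proof -
  have "of_int (c - coord z i n) * socle_root n \<in> N"
    using N(3)[OF coord(2)[OF z, of n i] c] by (simp add: algebra_simps)
  then have "c mod int CARD('p) ^ n = coord z i n mod int CARD('p) ^ n"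
    using socle_root_order by (simp add: mod_eq_dvd_iff)
  then show ?thesis using coord(1)[OF z, of i n] by simp
qed

lemma ex_coord_padic:
  assumes z: "z \<in> T"
  shows "\<exists>x :: 'p padic_int. residue x = coord z i"
proof (rule ex_padic_int)
  fix n
  show "coord z i n \<in> {0..<int CARD('p) ^ n}" by (rule coord(1)[OF z])
  have "\<pi> * (z / (\<pi> ^ Suc n * \<xi> ^ Suc i) - of_int (coord z i (Suc n)) * socle_root (Suc n))
      = z / (\<pi> ^ n * \<xi> ^ Suc i) - of_int (coord z i (Suc n)) * socle_root n"
    unfolding socle_root_Suc[of n, symmetric] using PX_nonzero
    by (simp add: right_diff_distrib mult.left_commute)
  then have "z / (\<pi> ^ n * \<xi> ^ Suc i) - of_int (coord z i (Suc n)) * socle_root n \<in> N"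
    using N_P_power[OF coord(2)[OF z, of "Suc n" i], of 1] by (simp only: power_one_right)
  from coord_unique[OF z this] show "coord z i (Suc n) mod int CARD('p) ^ n = coord z i n" ..
qed

definition coord_series :: "'p padic_int fps fract alg_closure \<Rightarrow> 'p padic_int fps" where
  "coord_series z = Abs_fps (\<lambda>i. SOME x. residue x = coord z i)"

lemma residue_coord_series:
  assumes "z \<in> T"
  shows "residue (fps_nth (coord_series z) i) n = coord z i n"
  using someI_ex[OF ex_coord_padic[OF assms, of i]] by (simp add: coord_series_def)

lemma coord_series_add:
  assumes "y \<in> T" "z \<in> T"
  shows "coord_series (y + z) = coord_series y + coord_series z"
proof (intro fps_ext padic_int_eqI)
  fix i n
  have "(y + z) / (\<pi> ^ n * \<xi> ^ Suc i) - of_int (coord y i n + coord z i n) * socle_root n \<in> N"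
    using N_add[OF coord(2)[OF assms(1)] coord(2)[OF assms(2)], of n i n i]
    by (simp add: add_divide_distrib algebra_simps)
  from coord_unique[OF T_add[OF assms] this]
  show "residue (fps_nth (coord_series (y + z)) i) n
      = residue (fps_nth (coord_series y + coord_series z) i) n"
    by (simp add: residue_coord_series T_add assms residue_simps)
qed

text \<open>N is known to be stable under integers, not under p-adic scalars. Modulo p^n and
  x^(i+1), which is all that coordinate (i, n) sees, r is a polynomial with integer
  coefficients.\<close>

lemma fps_truncation:
  fixes r :: "'p padic_int fps"
  obtains s s' where "r = (\<Sum>k\<le>i. of_int (residue (fps_nth r k) n) * fps_X ^ k)
    + of_nat CARD('p) ^ n * s + fps_X ^ Suc i * s'"
proof -
  let ?q = "of_nat CARD('p) :: 'p padic_int"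
  have "?q ^ n dvd fps_nth r k - of_int (residue (fps_nth r k) n)" for k
    unfolding power_dvd_padic_iff
    by (simp add: residue_simps residue_of_int residue_mod_self mod_simps)
  then obtain c where c: "\<And>k. fps_nth r k - of_int (residue (fps_nth r k) n) = ?q ^ n * c k"
    unfolding dvd_def by metis
  define s where "s = (\<Sum>k\<le>i. fps_const (c k) * fps_X ^ k)"
  define u where "u = (\<Sum>k\<le>i. of_int (residue (fps_nth r k) n) * fps_X ^ k)
    + of_nat CARD('p) ^ n * s"
  have q: "of_nat CARD('p) ^ n = (fps_const (?q ^ n) :: 'p padic_int fps)"
    by (simp add: fps_of_nat flip: fps_const_power)
  have "u = (\<Sum>k\<le>i. (of_int (residue (fps_nth r k) n) + fps_const (?q ^ n * c k)) * fps_X ^ k)"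
    unfolding u_def s_def q sum_distrib_left sum.distrib[symmetric]
    by (intro sum.cong refl) (simp add: algebra_simps flip: fps_const_mult)
  also have "\<dots> = (\<Sum>k\<le>i. fps_const (fps_nth r k) * fps_X ^ k)"
    unfolding c[symmetric]
    by (intro sum.cong refl) (simp add: fps_of_int flip: fps_const_sub)
  finally have u: "u = (\<Sum>k\<le>i. fps_const (fps_nth r k) * fps_X ^ k)" .
  have "fps_X ^ Suc i dvd r - u"
    unfolding fps_X_power_dvd_iff u
    by (auto simp: fps_sum_nth if_distrib cong: if_cong)
  then obtain s' where "r - u = fps_X ^ Suc i * s'" by (elim dvdE)
  then have "r = u + fps_X ^ Suc i * s'" by (simp add: algebra_simps)
  then show thesis using that unfolding u_def by blast
qed

text \<open>Multiplication by x^k shifts the index i by k, so coordinates multiply by convolution.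
  The two tails of r leave only p or only x in the denominator and vanish modulo N.\<close>

lemma coord_series_mult:
  assumes z: "z \<in> T"
  shows "coord_series (to_closure r * z) = r * coord_series z"
proof (intro fps_ext padic_int_eqI)
  fix i n
  let ?\<rho> = "\<lambda>k. residue (fps_nth r k) n"
  obtain s s' where r: "r = (\<Sum>k\<le>i. of_int (?\<rho> k) * fps_X ^ k)
    + of_nat CARD('p) ^ n * s + fps_X ^ Suc i * s'" by (rule fps_truncation)
  have rz: "to_closure r * z \<in> T" using z T_closure T_mult by blast
  have "to_closure r = (\<Sum>k\<le>i. of_int (?\<rho> k) * \<xi> ^ k) + \<pi> ^ n * to_closure s + \<xi> ^ Suc i * to_closure s'"
    by (subst r) (simp only: to_closure_hom.hom_add to_closure_hom.hom_mult to_closure_hom.hom_power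
        to_closure_hom.hom_sum to_closure_hom.hom_of_int \<pi>_def \<xi>_def)
  then have "to_closure r * z / (\<pi> ^ n * \<xi> ^ Suc i)
      = (\<Sum>k\<le>i. of_int (?\<rho> k) * (\<xi> ^ k * z / (\<pi> ^ n * \<xi> ^ Suc i)))
        + to_closure s * z / \<xi> ^ Suc i + to_closure s' * z / \<pi> ^ n"
    using PX_nonzero
    by (simp add: add_divide_distrib distrib_right sum_distrib_right sum_divide_distrib mult.assoc)
  also have "(\<Sum>k\<le>i. of_int (?\<rho> k) * (\<xi> ^ k * z / (\<pi> ^ n * \<xi> ^ Suc i)))
      = (\<Sum>k\<le>i. of_int (?\<rho> k) * (z / (\<pi> ^ n * \<xi> ^ Suc (i - k))))"
  proof (rule sum.cong)
    fix k assume "k \<in> {..i}"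
    then have "\<xi> ^ Suc i = \<xi> ^ k * \<xi> ^ Suc (i - k)" by (simp flip: power_add)
    then show "of_int (?\<rho> k) * (\<xi> ^ k * z / (\<pi> ^ n * \<xi> ^ Suc i))
        = of_int (?\<rho> k) * (z / (\<pi> ^ n * \<xi> ^ Suc (i - k)))"
      using PX_nonzero by (simp del: power_Suc)
  qed simp
  finally have eq: "to_closure r * z / (\<pi> ^ n * \<xi> ^ Suc i)
      - of_int (\<Sum>k\<le>i. ?\<rho> k * coord z (i - k) n) * socle_root n
    = (\<Sum>k\<le>i. of_int (?\<rho> k) * (z / (\<pi> ^ n * \<xi> ^ Suc (i - k)) - of_int (coord z (i - k) n) * socle_root n))
        + to_closure s * z / \<xi> ^ Suc i + to_closure s' * z / \<pi> ^ n"
    by (simp add: right_diff_distrib sum_subtractf sum_distrib_right mult.assoc del: power_Suc)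
  have "to_closure s * z / \<xi> ^ Suc i \<in> N"
    by (rule N_torsion(2)[of "Suc i"]) (use PX_nonzero z T_closure T_mult in auto)
  moreover have "to_closure s' * z / \<pi> ^ n \<in> N"
    by (rule N_torsion(1)[of n]) (use PX_nonzero z T_closure T_mult in auto)
  ultimately have "to_closure r * z / (\<pi> ^ n * \<xi> ^ Suc i)
      - of_int (\<Sum>k\<le>i. ?\<rho> k * coord z (i - k) n) * socle_root n \<in> N"
    unfolding eq by (intro N_add N_sum N_of_int coord(2)[OF z])
  from coord_unique[OF rz this]
  show "residue (fps_nth (coord_series (to_closure r * z)) i) n
      = residue (fps_nth (r * coord_series z) i) n"
    by (simp add: residue_coord_series[OF rz] residue_coord_series[OF z] fps_mult_nth residue_sum
        residue_simps mod_simps atLeast0AtMost)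
qed

lemma coord_series_w: "fps_nth (coord_series w) 0 = 1"
proof (rule padic_int_eqI)
  fix n
  have "coord w 0 n = 1 mod int CARD('p) ^ n"
    by (rule coord_unique[OF w]) (simp add: socle_root_def N_0)
  then show "residue (fps_nth (coord_series w) 0) n = residue (1 :: 'p padic_int) n"
    by (simp add: residue_coord_series[OF w] residue_simps)
qed

text \<open>The image of w has constant coefficient 1, hence is a unit; dividing by it turns
  \<open>coord_series\<close> into a splitting.\<close>

lemma ex_splitting:
  "\<exists>\<psi>. linear_map ring_of_type_algebra plus_module self_module \<psi> \<and> (\<forall>s. \<psi> (to_closure s * w) = s)"
proof -
  have "coord_series w * fps_right_inverse (coord_series w) 1 = 1"
    by (rule fps_right_inverse) (simp add: coord_series_w)
  then obtain v where v: "coord_series w * v = 1" by blast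
  have "linear_map ring_of_type_algebra plus_module self_module (\<lambda>z. coord_series z * v)"
    using coord_series_add coord_series_mult
    by (auto simp: linear_map_def plus_module_def self_module_def T_def distrib_right mult.assoc)
  moreover have "coord_series (to_closure s * w) * v = s" for s
    using v by (simp add: coord_series_mult[OF w] mult.assoc)
  ultimately show ?thesis by blast
qed

end

lemma pure_map_multiple:
  "pure_map ring_of_type_algebra self_module plus_module
     (\<lambda>s :: 'p padic_int fps. to_closure s * w)"
proof -
  obtain N where "torsion \<subseteq> N" "w / (\<pi> * \<xi>) \<notin> N" "\<And>x y. x \<in> N \<Longrightarrow> y \<in> N \<Longrightarrow> x - y \<in> N"
    "\<And>N'. N \<subseteq> N' \<Longrightarrow> w / (\<pi> * \<xi>) \<notin> N' \<Longrightarrow> (\<And>x y. x \<in> N' \<Longrightarrow> y \<in> N' \<Longrightarrow> x - y \<in> N') \<Longrightarrow> N' = N"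
    using ex_maximal_subgroup by blast
  from ex_splitting[OF this] obtain \<psi>
    where "linear_map ring_of_type_algebra plus_module self_module \<psi>"
      "\<And>s. \<psi> (to_closure s * w) = s" by blast
  then show ?thesis using w by (intro pure_map_of_splitting) (auto simp: T_def)
qed

end

section \<open>Comparison of the thresholds\<close>

lemma rat_power:
  fixes F :: "'a::idom fract alg_closure"
  assumes F: "F \<in> abs_int_closure" and \<alpha>: "0 \<le> \<alpha>"
  obtains n m where "0 < m" "\<alpha> = of_nat n / of_nat m" "rat_power F \<alpha> \<in> abs_int_closure"
    "rat_power F \<alpha> ^ m = F ^ n"
proof -
  obtain n m where nm: "quotient_of \<alpha> = (n, m)" by (cases "quotient_of \<alpha>")
  have m: "m > 0" using nm by (rule quotient_of_denom_pos)
  have \<alpha>nm: "\<alpha> = of_int n / of_int m" using nm by (rule quotient_of_div)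
  have n: "n \<ge> 0"
  proof (rule ccontr)
    assume "\<not> ?thesis"
    then have "(of_int n :: rat) / of_int m < 0" using m by (intro divide_neg_pos) auto
    then show False using \<alpha> \<alpha>nm by simp
  qed
  obtain w where w: "w ^ nat m = F ^ nat n" using nth_root_exists[of "nat m" "F ^ nat n"] m by auto
  have "w \<in> abs_int_closure"
    by (rule abs_int_closure.root_mem[of w "nat m"])
      (use w m F in \<open>auto intro: abs_int_closure.power_mem\<close>)
  then have "\<exists>w. w \<in> abs_int_closure \<and> w ^ nat m = F ^ nat n" using w by blast
  from someI_ex[OF this]
  have "rat_power F \<alpha> \<in> abs_int_closure \<and> rat_power F \<alpha> ^ nat m = F ^ nat n"
    by (simp add: rat_power_def nm)
  moreover have "\<alpha> = of_nat (nat n) / of_nat (nat m)" using n m \<alpha>nm by (simp add: of_nat_nat)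
  ultimately show thesis using that[of "nat m" "nat n"] m by auto
qed

section \<open>The F-pure threshold of y^a + x^b\<close>

lemma type_ideal_sum:
  assumes I: "ideal I (ring_of_type_algebra :: 'a::comm_ring_1 ring)"
    and f: "\<And>i. i \<in> A \<Longrightarrow> f i \<in> I"
  shows "sum f A \<in> I"
proof -
  note I_add = additive_subgroup.a_closed[OF ideal.axioms(1)[OF I]]
  note I_zero = additive_subgroup.zero_closed[OF ideal.axioms(1)[OF I]]
  show ?thesis using f
  proof (induction A rule: infinite_finite_induct)
    case (insert x A)
    then show ?case using I_add[of "f x" "sum f A"] by (simp add: ring_of_type_algebra_def)
  qed (use I_zero in \<open>auto simp: ring_of_type_algebra_def\<close>)
qed

text \<open>Some term of the binomial expansion must lie outside the ideal; its coefficient is then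
  nonzero modulo p and both its exponents are below q.\<close>

lemma fpt_ideal_monomial:
  fixes a b N q :: nat
  defines "I \<equiv> Idl\<^bsub>ring_of_type_algebra\<^esub> {fps_const fps_X ^ q, fps_X ^ q} :: 'p::prime_card mod_ring fps fps set"
  assumes "(fps_const fps_X ^ a + fps_X ^ b) ^ N \<notin> I"
  obtains i where "i \<le> N" "\<not> CARD('p) dvd N choose i" "a * i < q" "b * (N - i) < q"
proof -
  let ?R = "ring_of_type_algebra :: 'p mod_ring fps fps ring"
  let ?y = "fps_const fps_X :: 'p mod_ring fps fps"
  interpret R: cring ?R by (rule cring_from_type_algebra)
  have I: "ideal I ?R"
    unfolding I_def by (rule R.genideal_ideal) (auto simp: ring_of_type_algebra_def)
  have gen: "?y ^ q \<in> I" "fps_X ^ q \<in> I"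
    using R.genideal_self[of "{?y ^ q, fps_X ^ q}"]
    unfolding I_def by (auto simp: ring_of_type_algebra_def)
  have mult: "c * x \<in> I" if "x \<in> I" for c x
    using ideal.I_l_closed[OF I that, of c] by (simp add: ring_of_type_algebra_def)
  have exp: "(?y ^ a + fps_X ^ b) ^ N
      = (\<Sum>i\<le>N. of_nat (N choose i) * ?y ^ (a * i) * fps_X ^ (b * (N - i)))"
    by (simp add: binomial_ring power_mult)
  have "\<exists>i\<le>N. of_nat (N choose i) * ?y ^ (a * i) * fps_X ^ (b * (N - i)) \<notin> I"
  proof (rule ccontr)
    assume "\<not> ?thesis"
    then have "(?y ^ a + fps_X ^ b) ^ N \<in> I" unfolding exp by (intro type_ideal_sum[OF I]) auto
    then show False using assms by simp
  qed
  then obtain i where i: "i \<le> N" "of_nat (N choose i) * ?y ^ (a * i) * fps_X ^ (b * (N - i)) \<notin> I"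
    by blast
  have "\<not> CARD('p) dvd N choose i"
  proof
    assume "CARD('p) dvd N choose i"
    then obtain k where "N choose i = CARD('p) * k" by (elim dvdE)
    then have "(of_nat (N choose i) :: 'p mod_ring fps fps)
        = fps_const (fps_const (of_nat CARD('p))) * of_nat k"
      by (simp only: of_nat_mult fps_of_nat)
    then have "(of_nat (N choose i) :: 'p mod_ring fps fps) = 0" by simp
    then show False using i mult[OF gen(1), of 0] by simp
  qed
  moreover have "a * i < q"
  proof (rule ccontr)
    assume "\<not> ?thesis"
    then have "?y ^ (a * i) = ?y ^ (a * i - q) * ?y ^ q" by (simp flip: power_add)
    then have "of_nat (N choose i) * ?y ^ (a * i) * fps_X ^ (b * (N - i))
        = (of_nat (N choose i) * ?y ^ (a * i - q) * fps_X ^ (b * (N - i))) * ?y ^ q"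
      by (simp only: mult_ac)
    also have "\<dots> \<in> I" by (rule mult[OF gen(1)])
    finally show False using i(2) by blast
  qed
  moreover have "b * (N - i) < q"
  proof (rule ccontr)
    assume "\<not> ?thesis"
    then have "(fps_X :: 'p mod_ring fps fps) ^ (b * (N - i)) = fps_X ^ (b * (N - i) - q) * fps_X ^ q"
      by (simp flip: power_add)
    then have "of_nat (N choose i) * ?y ^ (a * i) * fps_X ^ (b * (N - i))
        = (of_nat (N choose i) * ?y ^ (a * i) * fps_X ^ (b * (N - i) - q)) * fps_X ^ q"
      by (simp only: mult_ac)
    also have "\<dots> \<in> I" by (rule mult[OF gen(2)])
    finally show False using i(2) by blast
  qed
  ultimately show thesis using that i(1) by blast
qed

text \<open>Ensures that the set defining \<open>fpt\<close> is nonempty, so that its supremum is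
  meaningful.\<close>

lemma fpt_base_notin_ideal:
  assumes "0 < b" "a < q"
  shows "fps_const fps_X ^ a + fps_X ^ b \<notin>
    (Idl\<^bsub>ring_of_type_algebra\<^esub> {fps_const fps_X ^ q, fps_X ^ q} :: 'a::{comm_ring_1} fps fps set)"
proof -
  let ?R = "ring_of_type_algebra :: 'a fps fps ring"
  interpret R: cring ?R by (rule cring_from_type_algebra)
  \<comment> \<open>An ideal containing both generators that only tests the coefficient of x^0,
    where y^a survives because a < q.\<close>
  define J where "J = {f :: 'a fps fps. fps_X ^ q dvd fps_nth f 0}"
  have "ideal J ?R"
  proof (rule idealI)
    show "ring ?R" by (rule R.ring_axioms)
    have inv: "\<ominus>\<^bsub>?R\<^esub> x = - x" for x
      by (rule R.minus_equality) (auto simp: ring_of_type_algebra_def)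
    have "0 \<in> J" by (simp add: J_def)
    then show "subgroup J (add_monoid ?R)"
      by (intro R.add.subgroupI) (auto simp: inv, auto simp: J_def ring_of_type_algebra_def)
  qed (auto simp: J_def ring_of_type_algebra_def fps_mult_nth)
  moreover have "{fps_const fps_X ^ q, fps_X ^ q} \<subseteq> J"
    using assms by (auto simp: J_def fps_power_zeroth power_0_left)
  ultimately have "Idl\<^bsub>?R\<^esub> {fps_const fps_X ^ q, fps_X ^ q} \<subseteq> J"
    by (rule R.genideal_minimal)
  moreover have "fps_const fps_X ^ a + fps_X ^ b \<notin> J"
    using assms by (auto simp: J_def fps_power_zeroth fps_X_power_dvd_iff power_0_left intro!: exI[of _ a])
  ultimately show ?thesis by blast
qed

theorem proposition2p9:
  fixes a b :: nat
    and f :: "'p::prime_card padic_int fps"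
    and f\<^sub>0 :: "'p mod_ring fps fps"
  assumes "a \<ge> 2" and "b \<ge> 2"
    and "f = of_nat CARD('p) ^ a + fps_X ^ b"
    and "f\<^sub>0 = fps_const fps_X ^ a + fps_X ^ b"
  shows "fpt f\<^sub>0 \<le> ppt f \<and> ppt f \<le> 1 / real a + 1 / real b"
proof -
  define p where "p = CARD('p)"
  let ?T = "abs_int_closure :: 'p padic_int fps fract alg_closure set"
  define F where "F = to_closure f"
  have p: "prime p" unfolding p_def by (rule prime_card)
  then have p2: "p \<ge> 2" by (rule prime_ge_2_nat)
  have pnz: "(of_nat p :: 'p padic_int fps fract alg_closure) \<noteq> 0"
  proof -
    have "(of_nat CARD('p) :: 'p padic_int fps) = fps_const (of_nat CARD('p))"
      by (simp add: fps_of_nat)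
    then have "to_closure (of_nat CARD('p) :: 'p padic_int fps) \<noteq> to_closure 0"
      unfolding to_closure_eq_iff by simp
    then show ?thesis by (simp add: p_def to_closure_hom.hom_of_nat)
  qed
  interpret T: prime_root_closed_subring ?T p
    by unfold_locales (use p pnz in auto)
  obtain \<pi> where \<pi>': "T.root_system \<pi>" "\<pi> 0 = of_nat p" using T.ex_root_system[of "of_nat p"] by auto
  obtain \<xi> where \<xi>': "T.root_system \<xi>" "\<xi> 0 = to_closure fps_X"
    using T.ex_root_system[OF to_closure_abs_int_closure] by blast
  obtain z where z': "T.root_system z" "z 0 = F"
    using T.ex_root_system[OF to_closure_abs_int_closure] unfolding F_def by blast
  have pi0: "\<pi> 0 = to_closure (of_nat CARD('p))"
    using \<pi>'(2) by (simp add: p_def to_closure_hom.hom_of_nat)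
  have Feq: "F = \<pi> 0 ^ a + \<xi> 0 ^ b"
    by (simp add: F_def assms(3) pi0 \<xi>'(2) to_closure_hom.hom_add to_closure_hom.hom_power)
  have xi0: "\<xi> 0 \<noteq> 0"
    unfolding \<xi>'(2) by (metis to_closure_eq_iff to_closure_hom.hom_zero fps_X_neq_zero)
  interpret diagonal_roots ?T p \<pi> \<xi> z a b
    by unfold_locales (use \<pi>' \<xi>' z' xi0 Feq assms(1,2) in auto)
  interpret regular_diagonal_roots ?T p \<pi> \<xi> z a b
  proof
    show "t \<in> ?T" if "\<pi> 0 * t \<in> ?T" "\<xi> 0 * t \<in> ?T" for t
      using that unfolding pi0 \<xi>'(2) by (rule abs_int_closure_regular)
    show "1 \<notin> param_ideal"
    proof
      assume "1 \<in> param_ideal"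
      then obtain A B where "A \<in> ?T" "B \<in> ?T" "1 = \<pi> 0 * A + \<xi> 0 * B"
        unfolding param_ideal_def by blast
      then show False using abs_int_closure_proper[of A B] unfolding pi0 \<xi>'(2) by metis
    qed
  qed
  have fnz: "f \<noteq> 0"
  proof
    assume "f = 0"
    then have "fps_nth f b = 0" by simp
    moreover have "of_nat CARD('p) ^ a = (fps_const (of_nat CARD('p) ^ a) :: 'p padic_int fps)"
      by (simp add: fps_of_nat flip: fps_const_power)
    ultimately show False using assms(1-3) by simp
  qed
  have Fnz: "F \<noteq> 0" unfolding F_def using fnz by (metis to_closure_eq_iff to_closure_hom.hom_zero)
  have znz: "z e \<noteq> 0" for e using z_power[of 0 e] z'(2) Fnz p2 by (auto simp: power_0_left)
  have zF: "z e ^ (p ^ e) = F" for e using z_power[of 0 e] z'(2) by simp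
  have FT: "F \<in> ?T" unfolding F_def by (rule to_closure_abs_int_closure)
  let ?w = "\<lambda>\<alpha>. rat_power F \<alpha>"
  let ?pure = "\<lambda>\<alpha>. pure_map ring_of_type_algebra self_module plus_module
     (\<lambda>s :: 'p padic_int fps. to_closure s * ?w \<alpha>)"
  define S where "S = {real_of_rat \<alpha> | \<alpha>. 0 \<le> \<alpha> \<and> ?pure \<alpha>}"
  have ppt: "ppt f = Sup S" by (simp add: ppt_def S_def F_def)
  have pure_iff: "?pure \<alpha> \<longleftrightarrow> ?w \<alpha> \<notin> param_ideal" if \<alpha>: "0 \<le> \<alpha>" for \<alpha>
  proof
    assume pure: "?pure \<alpha>"
    show "?w \<alpha> \<notin> param_ideal"
    proof
      assume "?w \<alpha> \<in> param_ideal"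
      then obtain A B where "A \<in> ?T" "B \<in> ?T" "?w \<alpha> = \<pi> 0 * A + \<xi> 0 * B"
        unfolding param_ideal_def by blast
      then show False using not_pure_map[of A B "?w \<alpha>"] pure unfolding pi0 \<xi>'(2) by blast
    qed
  next
    assume w: "?w \<alpha> \<notin> param_ideal"
    have "?w \<alpha> \<in> ?T" using rat_power[OF FT \<alpha>] by blast
    then show "?pure \<alpha>"
    proof (rule pure_map_multiple)
      fix A B assume "A \<in> ?T" "B \<in> ?T"
      then show "?w \<alpha> \<noteq> to_closure (of_nat CARD('p)) * A + to_closure fps_X * B"
        using w unfolding param_ideal_def pi0 \<xi>'(2) by blast
    qed
  qed
  have upper: "t \<le> 1 / real a + 1 / real b" if tS: "t \<in> S" for t
  proof (rule ccontr)
    assume t: "\<not> ?thesis"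
    obtain \<alpha> where \<alpha>: "t = real_of_rat \<alpha>" "0 \<le> \<alpha>" "?pure \<alpha>" using tS unfolding S_def by blast
    obtain n m where nm: "0 < m" "\<alpha> = of_nat n / of_nat m" "?w \<alpha> \<in> ?T" "?w \<alpha> ^ m = F ^ n"
      using rat_power[OF FT \<alpha>(2)] .
    have tnm: "t = real n / real m" by (simp add: \<alpha>(1) nm(2) of_rat_divide)
    define \<epsilon> where "\<epsilon> = real (a * b) * t - real (a + b)"
    have "real (a * b) * (1 / real a + 1 / real b) < real (a * b) * t"
      using t assms(1,2) by (intro mult_strict_left_mono) auto
    also have "real (a * b) * (1 / real a + 1 / real b) = real (a + b)"
      using assms(1,2) by (simp add: field_simps)
    finally have \<epsilon>: "\<epsilon> > 0" by (simp add: \<epsilon>_def)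
    \<comment> \<open>The slack \<epsilon> p^e has to exceed 2 a b: one a b pays for rounding t p^e
      down to k, the other for the loss in \<open>z_power_param_ideal\<close>.\<close>
    obtain e where e: "real (2 * a * b) / \<epsilon> < real p ^ e"
      using real_arch_pow[of "real p"] p2 by auto
    define k where "k = nat \<lfloor>t * real p ^ e\<rfloor>"
    have t0: "0 \<le> t" by (simp add: tnm)
    have k: "real k \<le> t * real p ^ e" "t * real p ^ e < real k + 1"
      using t0 by (simp_all add: k_def)
    have "real ((a + b) * p ^ e) + real (2 * a * b) \<le> real (a * b) * (t * real p ^ e)"
      using e \<epsilon> by (simp add: \<epsilon>_def field_simps)
    also have "\<dots> \<le> real (a * b) * (real k + 1)" using k(2) by (intro mult_left_mono) auto
    finally have "real ((a + b) * p ^ e + 2 * a * b) \<le> real (a * b * (k + 1))"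
      by (simp add: algebra_simps)
    then have "(a + b) * p ^ e + 2 * a * b \<le> a * b * (k + 1)" by (simp only: of_nat_le_iff)
    then have "(a + b) * p ^ e \<le> a * b * (k - 1)" by (cases k) (auto simp: algebra_simps)
    then have zk: "z e ^ k \<in> param_ideal" using z_power_param_ideal[of e e k] by simp
    have "real (k * m) \<le> real (n * p ^ e)"
      using k(1) nm(1) by (simp add: tnm field_simps)
    then have km: "k * m \<le> n * p ^ e" by (simp only: of_nat_le_iff)
    \<comment> \<open>As k/p^e <= n/m, a power of u is a nonnegative power of F, so u lies in T by
      root closure.\<close>
    define u where "u = ?w \<alpha> / z e ^ k"
    have "u ^ (m * p ^ e) = (?w \<alpha> ^ m) ^ (p ^ e) / (z e ^ (p ^ e)) ^ (k * m)"
      by (simp add: u_def power_divide mult_ac flip: power_mult)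
    also have "\<dots> = F ^ (n * p ^ e - k * m)"
      unfolding nm(4) zF using Fnz km by (simp add: power_diff flip: power_mult)
    finally have "u \<in> ?T"
      using abs_int_closure.root_mem[of u "m * p ^ e"] abs_int_closure.power_mem[OF FT] nm(1) p2 by simp
    moreover have "?w \<alpha> = u * z e ^ k" using znz by (simp add: u_def)
    ultimately have "?w \<alpha> \<in> param_ideal" using zk param_ideal_smult by simp
    then show False using pure_iff \<alpha> by blast
  qed
  have lower: "\<exists>s\<in>S. t \<le> s"
    if t: "0 < t" "f\<^sub>0 ^ nat \<lceil>t * real CARD('p) ^ e\<rceil> \<notin>
       Idl\<^bsub>ring_of_type_algebra\<^esub> {fps_const fps_X ^ (CARD('p) ^ e), fps_X ^ (CARD('p) ^ e)}" for t e
  proof -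
    define N where "N = nat \<lceil>t * real p ^ e\<rceil>"
    obtain i where i: "i \<le> N" "\<not> p dvd N choose i" "a * i < p ^ e" "b * (N - i) < p ^ e"
      using fpt_ideal_monomial[OF t(2)[unfolded assms(4)]] unfolding N_def p_def by blast
    have zN: "z e ^ N \<notin> param_ideal" by (rule z_power_notin_param_ideal[OF i(2,1,3,4)])
    define \<alpha> :: rat where "\<alpha> = of_nat N / of_nat (p ^ e)"
    have \<alpha>0: "0 \<le> \<alpha>" by (simp add: \<alpha>_def)
    obtain n m where nm: "0 < m" "\<alpha> = of_nat n / of_nat m" "?w \<alpha> \<in> ?T" "?w \<alpha> ^ m = F ^ n"
      using rat_power[OF FT \<alpha>0] .
    have pe: "p ^ e > 0" using p2 by simp
    have "(of_nat (N * m) :: rat) = of_nat (n * p ^ e)"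
      using nm(1,2) pe unfolding \<alpha>_def by (simp add: field_simps)
    then have Nm: "N * m = n * p ^ e" by (simp only: of_nat_eq_iff)
    have wnz: "?w \<alpha> \<noteq> 0" using nm(1,4) Fnz by (metis power_0_left power_not_zero less_irrefl)
    \<comment> \<open>Both elements represent f^(N/p^e), so u is a root of unity and nonmembership
      passes from one to the other.\<close>
    define u where "u = z e ^ N / ?w \<alpha>"
    have "u ^ (m * p ^ e) = (z e ^ (p ^ e)) ^ (N * m) / (?w \<alpha> ^ m) ^ (p ^ e)"
      by (simp add: u_def power_divide mult_ac flip: power_mult)
    also have "\<dots> = 1" unfolding nm(4) zF Nm using Fnz by (simp flip: power_mult)
    finally have "u \<in> ?T" using abs_int_closure.root_mem[of u "m * p ^ e"] nm(1) pe by simp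
    moreover have "z e ^ N = u * ?w \<alpha>" using wnz by (simp add: u_def)
    ultimately have "?w \<alpha> \<notin> param_ideal" using zN param_ideal_smult by metis
    then have "real_of_rat \<alpha> \<in> S" using pure_iff[OF \<alpha>0] \<alpha>0 unfolding S_def by blast
    moreover have "t \<le> real_of_rat \<alpha>"
    proof -
      have "t * real p ^ e \<le> real N" unfolding N_def by linarith
      then show ?thesis using pe by (simp add: \<alpha>_def of_rat_divide of_rat_power field_simps)
    qed
    ultimately show ?thesis by blast
  qed
  define W where "W = {t. 0 < t \<and> (\<exists>e\<ge>1. f\<^sub>0 ^ nat \<lceil>t * real CARD('p) ^ e\<rceil> \<notin>
       Idl\<^bsub>ring_of_type_algebra\<^esub> {fps_const fps_X ^ (CARD('p) ^ e), fps_X ^ (CARD('p) ^ e)})}"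
  have fpt: "fpt f\<^sub>0 = Sup W" by (simp add: fpt_def W_def)
  have "W \<noteq> {}"
  proof -
    have "a < 2 ^ a" by simp
    also have "(2::nat) ^ a \<le> p ^ a" using p2 by (intro power_mono) auto
    finally have "a < CARD('p) ^ a" unfolding p_def .
    then have "f\<^sub>0 \<notin> Idl\<^bsub>ring_of_type_algebra\<^esub>
        {fps_const fps_X ^ (CARD('p) ^ a), fps_X ^ (CARD('p) ^ a)}"
      unfolding assms(4) using assms(2) by (intro fpt_base_notin_ideal) auto
    moreover have "0 < real CARD('p) ^ a" using p2 by (simp add: p_def)
    \<comment> \<open>With e = a and t = 1/p^a the exponent is 1, so the test is on
      \<open>f\<^sub>0\<close> itself.\<close>
    ultimately have "1 / real CARD('p) ^ a \<in> W"
      using assms(1) unfolding W_def by (intro CollectI conjI exI[of _ a]) auto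
    then show ?thesis by blast
  qed
  have bdd: "bdd_above S" using upper by (intro bdd_aboveI) auto
  have W: "\<exists>s\<in>S. t \<le> s" if "t \<in> W" for t using that lower unfolding W_def by blast
  have "Sup W \<le> Sup S"
  proof (rule cSup_least[OF \<open>W \<noteq> {}\<close>])
    fix t assume "t \<in> W"
    then obtain s where "s \<in> S" "t \<le> s" using W by blast
    then show "t \<le> Sup S" using cSup_upper[OF _ bdd] by fastforce
  qed
  moreover have "S \<noteq> {}" using \<open>W \<noteq> {}\<close> W by blast
  then have "Sup S \<le> 1 / real a + 1 / real b" using upper by (rule cSup_least)
  ultimately show ?thesis unfolding fpt ppt by simp
qed

end
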